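(* For any $k\in\mathbb{Z}$, $\mathcal{H}'_{\langle k\rangle}$ is an irreducible $osp(2n+1|2m)$-module. Moreover, $\mathcal{B}=\bigoplus_{\ell\in\mathbb{N},\,k\in\mathbb{Z}}(\eta')^\ell(\mathcal{H}'_{\langle k\rangle})$ is a direct sum of irreducible $osp(2n+1|2m)$-submodules.
   Context: Fix positive integers $n,m$ and integers $n_1,n_2$ with $1\le n_1$, $n_1+1<n_2\le n$. Let $\mathcal{B}$ be the complex supercommutative polynomial algebra in even variables $x_0,x_1,\dots,x_n,y_1,\dots,y_n$ and odd variables $\theta_1,\dots,\theta_m,\vartheta_1,\dots,\vartheta_m$, with partial derivatives and odd derivations $\partial_{\theta_r},\partial_{\vartheta_r}$ (super Leibniz rule). Let $\rho$ be the representation of $osp(2n+1|2m)\subset gl(2n+1|2m)$ (indices $0,\dots,2n$ even, $2n+1,\dots,2n+2m$ odd) on $\mathcal{B}$ given on a spanning set by ($i,j\in\{1..n\}$, $r,s\in\{1..m\}$): $E_{i,j}-E_{n+j,n+i}\mapsto x_i\partial_{x_j}-y_j\partial_{y_i}$; $E_{2n+r,2n+s}-E_{2n+m+s,2n+m+r}\mapsto\theta_r\partial_{\theta_s}-\vartheta_s\partial_{\vartheta_r}$; $E_{i,2n+r}-E_{2n+m+r,n+i}\mapsto x_i\partial_{\theta_r}-\vartheta_r\partial_{y_i}$; $E_{2n+r,i}+E_{n+i,2n+m+r}\mapsto\theta_r\partial_{x_i}+y_i\partial_{\vartheta_r}$; ($i<j$) $E_{i,n+j}-E_{j,n+i}\mapsto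 x_i\partial_{y_j}-x_j\partial_{y_i}$, $E_{n+i,j}-E_{n+j,i}\mapsto y_i\partial_{x_j}-y_j\partial_{x_i}$; ($r\le s$) $E_{2n+m+r,2n+s}+E_{2n+m+s,2n+r}\mapsto\vartheta_r\partial_{\theta_s}+\vartheta_s\partial_{\theta_r}$, $E_{2n+r,2n+m+s}+E_{2n+s,2n+m+r}\mapsto\theta_r\partial_{\vartheta_s}+\theta_s\partial_{\vartheta_r}$; $E_{i,2n+m+r}+E_{2n+r,n+i}\mapsto x_i\partial_{\vartheta_r}+\theta_r\partial_{y_i}$; $E_{n+i,2n+r}-E_{2n+m+r,i}\mapsto y_i\partial_{\theta_r}-\vartheta_r\partial_{x_i}$; $E_{0,i}-E_{n+i,0}\mapsto x_0\partial_{x_i}-y_i\partial_{x_0}$; $E_{0,n+i}-E_{i,0}\mapsto x_0\partial_{y_i}-x_i\partial_{x_0}$; $E_{0,2n+r}-E_{2n+m+r,0}\mapsto x_0\partial_{\theta_r}-\vartheta_r\partial_{x_0}$; $E_{0,2n+m+r}+E_{2n+r,0}\mapsto x_0\partial_{\vartheta_r}+\theta_r\partial_{x_0}$. Let $\sigma$ be the automorphism of the algebra of polynomial-coefficient differential operators on $\mathcal{B}$ with $\sigma(x_r)=\partial_{x_r}$, $\sigma(\partial_{x_r})=-x_r$ for $1\le r\le n_1$, $\sigma(y_s)=\partial_{y_s}$, $\sigma(\partial_{y_s})=-y_s$ for $s>n_2$, fixing all other generators (operators composed in the order written). The representation considered is $\xi\mapsto\sigma(\rho(\xi))$. Let $\Delta=-\sum_{i=1}^{n_1}x_i\partial_{y_i}+\sum_{r=n_1+1}^{n_2}\partial_{x_r}\partial_{y_r}-\sum_{s=n_2+1}^ny_s\partial_{x_s}+\sum_{r=1}^m\partial_{\theta_r}\partial_{\vartheta_r}$,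 $\eta=\sum_{i=1}^{n_1}y_i\partial_{x_i}+\sum_{r=n_1+1}^{n_2}x_ry_r+\sum_{s=n_2+1}^nx_s\partial_{y_s}+\sum_{r=1}^m\theta_r\vartheta_r$, $\Delta'=\partial_{x_0}^2+2\Delta$, $\eta'=x_0^2+2\eta$ (operators). Let $\mathcal{A}\subset\mathcal{B}$ be the subalgebra not involving $x_0$; for $j\in\mathbb{Z}$, $\mathcal{A}_{\langle j\rangle}$ is the span of monomials $x^\alpha y^\beta\theta_{i_1}\cdots\theta_{i_a}\vartheta_{j_1}\cdots\vartheta_{j_b}$ in $\mathcal{A}$ with $\sum_{r=n_1+1}^n\alpha_r-\sum_{i=1}^{n_1}\alpha_i+\sum_{i=1}^{n_2}\beta_i-\sum_{r=n_2+1}^n\beta_r+a+b=j$. For $k\in\mathbb{Z}$, $\mathcal{B}_{\langle k\rangle}=\sum_{i=0}^\infty\mathcal{A}_{\langle k-i\rangle}x_0^i$ and $\mathcal{H}'_{\langle k\rangle}=\{f\in\mathcal{B}_{\langle k\rangle}\mid\Delta'(f)=0\}$. *)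

theory Defs
  imports Complex_Main
begin

text \<open>The supercommutative polynomial algebra B.
  A monomial  x^a y^b theta_{i1}...theta_{ik} vartheta_{j1}...vartheta_{jl}
  (with i1 < ... < ik, j1 < ... < jl; x indexed 0..n, y indexed 1..n,
  theta, vartheta indexed 1..m) is encoded as (a, b, A, B) with
  A = {i1,...,ik}, B = {j1,...,jl}.  An element of B is a finitely supported
  coefficient function on monomials, supported on valid monomials.\<close>

type_synonym mono = "(nat \<Rightarrow> nat) \<times> (nat \<Rightarrow> nat) \<times> nat set \<times> nat set"
type_synonym spoly = "mono \<Rightarrow> complex"

definition pzero :: spoly where "pzero = (\<lambda>_. 0)"
definition padd :: "spoly \<Rightarrow> spoly \<Rightarrow> spoly" where "padd p q = (\<lambda>\<mu>. p \<mu> + q \<mu>)"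
definition psub :: "spoly \<Rightarrow> spoly \<Rightarrow> spoly" where "psub p q = (\<lambda>\<mu>. p \<mu> - q \<mu>)"
definition psmult :: "complex \<Rightarrow> spoly \<Rightarrow> spoly" where "psmult c p = (\<lambda>\<mu>. c * p \<mu>)"

definition Bsp :: "nat \<Rightarrow> nat \<Rightarrow> spoly set" where
  "Bsp n m = {p. finite {\<mu>. p \<mu> \<noteq> 0} \<and>
      (\<forall>a b A B. p (a, b, A, B) \<noteq> 0 \<longrightarrow>
         (\<forall>i>n. a i = 0) \<and> b 0 = 0 \<and> (\<forall>i>n. b i = 0) \<and> A \<subseteq> {1..m} \<and> B \<subseteq> {1..m})}"

definition mx :: "nat \<Rightarrow> spoly \<Rightarrow> spoly" where
  "mx i p = (\<lambda>(a, b, A, B). if 0 < a i then p (a(i := a i - 1), b, A, B) else 0)"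
definition dx :: "nat \<Rightarrow> spoly \<Rightarrow> spoly" where
  "dx i p = (\<lambda>(a, b, A, B). of_nat (a i + 1) * p (a(i := a i + 1), b, A, B))"
definition my :: "nat \<Rightarrow> spoly \<Rightarrow> spoly" where
  "my i p = (\<lambda>(a, b, A, B). if 0 < b i then p (a, b(i := b i - 1), A, B) else 0)"
definition dy :: "nat \<Rightarrow> spoly \<Rightarrow> spoly" where
  "dy i p = (\<lambda>(a, b, A, B). of_nat (b i + 1) * p (a, b(i := b i + 1), A, B))"

text \<open>Odd variables (left multiplication) and odd derivations (acting from the left,
  super Leibniz rule), with the ordering convention theta's before vartheta's,
  increasing indices.\<close>
definition th :: "nat \<Rightarrow> spoly \<Rightarrow> spoly" where
  "th r p = (\<lambda>(a, b, A, B). if r \<in> A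
      then (-1) ^ card {i\<in>A. i < r} * p (a, b, A - {r}, B) else 0)"
definition dth :: "nat \<Rightarrow> spoly \<Rightarrow> spoly" where
  "dth r p = (\<lambda>(a, b, A, B). if r \<notin> A
      then (-1) ^ card {i\<in>A. i < r} * p (a, b, insert r A, B) else 0)"
definition vt :: "nat \<Rightarrow> spoly \<Rightarrow> spoly" where
  "vt r p = (\<lambda>(a, b, A, B). if r \<in> B
      then (-1) ^ (card A + card {j\<in>B. j < r}) * p (a, b, A, B - {r}) else 0)"
definition dvt :: "nat \<Rightarrow> spoly \<Rightarrow> spoly" where
  "dvt r p = (\<lambda>(a, b, A, B). if r \<notin> B
      then (-1) ^ (card A + card {j\<in>B. j < r}) * p (a, b, A, insert r B) else 0)"

text \<open>Images of the generators x_r, d/dx_r, y_s, d/dy_s under the automorphism sigma.\<close>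
definition sX :: "nat \<Rightarrow> nat \<Rightarrow> spoly \<Rightarrow> spoly" where
  "sX n1 i = (if 1 \<le> i \<and> i \<le> n1 then dx i else mx i)"
definition sDX :: "nat \<Rightarrow> nat \<Rightarrow> spoly \<Rightarrow> spoly" where
  "sDX n1 i = (if 1 \<le> i \<and> i \<le> n1 then (\<lambda>p. psmult (-1) (mx i p)) else dx i)"
definition sY :: "nat \<Rightarrow> nat \<Rightarrow> spoly \<Rightarrow> spoly" where
  "sY n2 s = (if n2 < s then dy s else my s)"
definition sDY :: "nat \<Rightarrow> nat \<Rightarrow> spoly \<Rightarrow> spoly" where
  "sDY n2 s = (if n2 < s then (\<lambda>p. psmult (-1) (my s p)) else dy s)"

definition oadd :: "(spoly \<Rightarrow> spoly) \<Rightarrow> (spoly \<Rightarrow> spoly) \<Rightarrow> spoly \<Rightarrow> spoly" where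
  "oadd T U = (\<lambda>p. padd (T p) (U p))"
definition osub :: "(spoly \<Rightarrow> spoly) \<Rightarrow> (spoly \<Rightarrow> spoly) \<Rightarrow> spoly \<Rightarrow> spoly" where
  "osub T U = (\<lambda>p. psub (T p) (U p))"

text \<open>The operators sigma(rho(xi)) for xi in the given spanning set of osp(2n+1|2m).\<close>
definition ospOps :: "nat \<Rightarrow> nat \<Rightarrow> nat \<Rightarrow> nat \<Rightarrow> (spoly \<Rightarrow> spoly) set" where
  "ospOps n m n1 n2 =
     {osub (sX n1 i \<circ> sDX n1 j) (sY n2 j \<circ> sDY n2 i) | i j. i \<in> {1..n} \<and> j \<in> {1..n}}
   \<union> {osub (th r \<circ> dth s) (vt s \<circ> dvt r) | r s. r \<in> {1..m} \<and> s \<in> {1..m}}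
   \<union> {osub (sX n1 i \<circ> dth r) (vt r \<circ> sDY n2 i) | i r. i \<in> {1..n} \<and> r \<in> {1..m}}
   \<union> {oadd (th r \<circ> sDX n1 i) (sY n2 i \<circ> dvt r) | i r. i \<in> {1..n} \<and> r \<in> {1..m}}
   \<union> {osub (sX n1 i \<circ> sDY n2 j) (sX n1 j \<circ> sDY n2 i) | i j. 1 \<le> i \<and> i < j \<and> j \<le> n}
   \<union> {osub (sY n2 i \<circ> sDX n1 j) (sY n2 j \<circ> sDX n1 i) | i j. 1 \<le> i \<and> i < j \<and> j \<le> n}
   \<union> {oadd (vt r \<circ> dth s) (vt s \<circ> dth r) | r s. 1 \<le> r \<and> r \<le> s \<and> s \<le> m}
   \<union> {oadd (th r \<circ> dvt s) (th s \<circ> dvt r) | r s. 1 \<le> r \<and> r \<le> s \<and> s \<le> m}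
   \<union> {oadd (sX n1 i \<circ> dvt r) (th r \<circ> sDY n2 i) | i r. i \<in> {1..n} \<and> r \<in> {1..m}}
   \<union> {osub (sY n2 i \<circ> dth r) (vt r \<circ> sDX n1 i) | i r. i \<in> {1..n} \<and> r \<in> {1..m}}
   \<union> {osub (mx 0 \<circ> sDX n1 i) (sY n2 i \<circ> dx 0) | i. i \<in> {1..n}}
   \<union> {osub (mx 0 \<circ> sDY n2 i) (sX n1 i \<circ> dx 0) | i. i \<in> {1..n}}
   \<union> {osub (mx 0 \<circ> dth r) (vt r \<circ> dx 0) | r. r \<in> {1..m}}
   \<union> {oadd (mx 0 \<circ> dvt r) (th r \<circ> dx 0) | r. r \<in> {1..m}}"

definition Delta :: "nat \<Rightarrow> nat \<Rightarrow> nat \<Rightarrow> nat \<Rightarrow> spoly \<Rightarrow> spoly" where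
  "Delta n m n1 n2 p = (\<lambda>\<mu>.
       - (\<Sum>i\<in>{1..n1}. mx i (dy i p) \<mu>)
       + (\<Sum>r\<in>{n1+1..n2}. dx r (dy r p) \<mu>)
       - (\<Sum>s\<in>{n2+1..n}. my s (dx s p) \<mu>)
       + (\<Sum>r\<in>{1..m}. dth r (dvt r p) \<mu>))"
definition eta :: "nat \<Rightarrow> nat \<Rightarrow> nat \<Rightarrow> nat \<Rightarrow> spoly \<Rightarrow> spoly" where
  "eta n m n1 n2 p = (\<lambda>\<mu>.
         (\<Sum>i\<in>{1..n1}. my i (dx i p) \<mu>)
       + (\<Sum>r\<in>{n1+1..n2}. mx r (my r p) \<mu>)
       + (\<Sum>s\<in>{n2+1..n}. mx s (dy s p) \<mu>)
       + (\<Sum>r\<in>{1..m}. th r (vt r p) \<mu>))"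
definition Delta' :: "nat \<Rightarrow> nat \<Rightarrow> nat \<Rightarrow> nat \<Rightarrow> spoly \<Rightarrow> spoly" where
  "Delta' n m n1 n2 p = padd (dx 0 (dx 0 p)) (psmult 2 (Delta n m n1 n2 p))"
definition eta' :: "nat \<Rightarrow> nat \<Rightarrow> nat \<Rightarrow> nat \<Rightarrow> spoly \<Rightarrow> spoly" where
  "eta' n m n1 n2 p = padd (mx 0 (mx 0 p)) (psmult 2 (eta n m n1 n2 p))"

text \<open>The grading: a monomial x_0^{a 0} x^a y^b theta_A vartheta_B lies in
  A_{<j>} x_0^{a 0} with j as in the paper, hence in B_{<j + a 0>}.\<close>
definition sdeg :: "nat \<Rightarrow> nat \<Rightarrow> nat \<Rightarrow> mono \<Rightarrow> int" where
  "sdeg n n1 n2 \<mu> = (case \<mu> of (a, b, A, B) \<Rightarrow>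
      int (a 0) + (\<Sum>r\<in>{n1+1..n}. int (a r)) - (\<Sum>i\<in>{1..n1}. int (a i))
      + (\<Sum>i\<in>{1..n2}. int (b i)) - (\<Sum>r\<in>{n2+1..n}. int (b r))
      + int (card A) + int (card B))"

definition Bk :: "nat \<Rightarrow> nat \<Rightarrow> nat \<Rightarrow> nat \<Rightarrow> int \<Rightarrow> spoly set" where
  "Bk n m n1 n2 k = {p \<in> Bsp n m. \<forall>\<mu>. p \<mu> \<noteq> 0 \<longrightarrow> sdeg n n1 n2 \<mu> = k}"

definition Hk :: "nat \<Rightarrow> nat \<Rightarrow> nat \<Rightarrow> nat \<Rightarrow> int \<Rightarrow> spoly set" where
  "Hk n m n1 n2 k = {f \<in> Bk n m n1 n2 k. Delta' n m n1 n2 f = pzero}"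

text \<open>Module-theoretic notions (the Lie superalgebra acts linearly, so invariance
  under the spanning set of operators is invariance under the whole algebra).\<close>
definition csubspace :: "spoly set \<Rightarrow> bool" where
  "csubspace W \<longleftrightarrow> pzero \<in> W \<and> (\<forall>p\<in>W. \<forall>q\<in>W. padd p q \<in> W)
     \<and> (\<forall>c. \<forall>p\<in>W. psmult c p \<in> W)"

definition op_invariant :: "(spoly \<Rightarrow> spoly) set \<Rightarrow> spoly set \<Rightarrow> bool" where
  "op_invariant Ops W \<longleftrightarrow> (\<forall>T\<in>Ops. \<forall>p\<in>W. T p \<in> W)"

definition irreducible_submodule ::
    "(spoly \<Rightarrow> spoly) set \<Rightarrow> spoly set \<Rightarrow> spoly set \<Rightarrow> bool" where
  "irreducible_submodule Ops V W \<longleftrightarrow>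
     W \<subseteq> V \<and> csubspace W \<and> op_invariant Ops W \<and> W \<noteq> {pzero} \<and>
     (\<forall>U. csubspace U \<and> U \<subseteq> W \<and> op_invariant Ops U \<longrightarrow> U = {pzero} \<or> U = W)"

end

theory Submission
  imports Defs "HOL-Library.Function_Algebras"
begin

text \<open>The superalgebra acts by the operators L(v,w) = V_v D_w - (sign) V_w D_v, where V_v and D_v
  are the (twisted) multiplications and dual derivations attached to a basis of the natural
  module. Both Delta' and eta' are quadratic in these and supercommute with all L(v,w); they
  generate an sl2 whose weight on B_<k> is 4k + 2 + 4(n2 - n1) - 4m. This is never 0 and Delta'
  is locally nilpotent, so B is the direct sum of the images of the harmonics under powers of eta'.

  For irreducibility let W be the isotropic span of the twisted directions and of x_{n1+1}. A
  nonzero submodule U contains a weight vector u of least depth with respect to W, and this u is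
  killed by L(w,v) for w in W and v orthogonal to W. Applying V_w to Delta' u = 0 and moving it
  inwards with V_w D_v u = V_v D_w u yields c D_w u = 0. Here c is an odd integer, because x_0
  makes the even part of the natural module odd-dimensional, so D_w u = 0. As multiplication by
  x_{n1+1} is injective, u then depends on the variables of W only. Hence it is a monomial, from
  which one reaches x_1^(-k) or x_{n1+1}^k. So this one monomial lies in every nonzero submodule.
  The Fischer-type form for which eta' is adjoint to Delta' is contravariant and pairs harmonics
  nondegenerately on the finite-dimensional weight spaces. The orthogonal complement of U is a
  submodule that misses the non-isotropic common monomial, hence it is 0 and U is everything.\<close>

section \<open>Creation and annihilation operators\<close>

text \<open>Because sigma is an automorphism, the twisted operators \<open>Mul\<close> and
  \<open>Der\<close> satisfy the same canonical relations as the untwisted ones, so operator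
  identities ignore the twist. What the twist changes is the size of the modules: variables of
  negative degree make each B_<k> infinite-dimensional, so neither complete reducibility nor a
  finite-dimensional dual is at hand. A grading bounded below on B_<k> replaces finiteness when a
  lowest vector is sought, and a weight is fixed before any duality is used. The direction x_{n1+1}
  is adjoined to W because for a twisted w the operator V_w is a derivative and has a kernel; an
  untwisted isotropic direction allows V_w to be cancelled. The oddness of c has two sources. The
  self-dual x_0 adds one unpaired unit to its constant part. Its variable part is the degree minus
  the depth, equal for u and D_w u, and its evenness has to be read off the support of u: some
  monomial there contains no variable of the complement of W in its orthogonal space, and every
  other variable enters the difference with an even coefficient.\<close>

notation psmult (infixr "\<odot>" 75)

lemma psmult_apply [simp]: "(c \<odot> p) \<mu> = c * p \<mu>"
  by (simp add: psmult_def)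

lemma padd_eq [simp]: "padd p q = p + q"
  by (simp add: padd_def fun_eq_iff)

lemma psub_eq [simp]: "psub p q = p - q"
  by (simp add: psub_def fun_eq_iff)

lemma pzero_eq [simp]: "pzero = 0"
  by (simp add: pzero_def fun_eq_iff)

lemma sum_fun_apply: "(\<Sum>i\<in>I. f i) x = (\<Sum>i\<in>I. f i x)"
  by (induction I rule: infinite_finite_induct) auto

interpretation spoly: vector_space psmult
  by unfold_locales (auto simp: fun_eq_iff algebra_simps)

lemma csubspace_iff: "csubspace W \<longleftrightarrow> spoly.subspace W"
  by (auto simp: csubspace_def spoly.subspace_def)

section \<open>Modes, monomials and the signs of odd variables\<close>

datatype mode = X nat | Y nat | Th nat | Vt nat

fun odd_mode :: "mode \<Rightarrow> bool" where
  "odd_mode (X i) = False" | "odd_mode (Y i) = False" | "odd_mode (Th i) = True" | "odd_mode (Vt i) = True"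

fun expo :: "mono \<Rightarrow> mode \<Rightarrow> nat" where
  "expo (a, b, A, B) (X i) = a i"
| "expo (a, b, A, B) (Y i) = b i"
| "expo (a, b, A, B) (Th i) = of_bool (i \<in> A)"
| "expo (a, b, A, B) (Vt i) = of_bool (i \<in> B)"

fun inc :: "mode \<Rightarrow> mono \<Rightarrow> mono" where
  "inc (X i) (a, b, A, B) = (a(i := a i + 1), b, A, B)"
| "inc (Y i) (a, b, A, B) = (a, b(i := b i + 1), A, B)"
| "inc (Th i) (a, b, A, B) = (a, b, insert i A, B)"
| "inc (Vt i) (a, b, A, B) = (a, b, A, insert i B)"

fun dec :: "mode \<Rightarrow> mono \<Rightarrow> mono" where
  "dec (X i) (a, b, A, B) = (a(i := a i - 1), b, A, B)"
| "dec (Y i) (a, b, A, B) = (a, b(i := b i - 1), A, B)"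
| "dec (Th i) (a, b, A, B) = (a, b, A - {i}, B)"
| "dec (Vt i) (a, b, A, B) = (a, b, A, B - {i})"

fun mono_sign :: "mode \<Rightarrow> mono \<Rightarrow> complex" where
  "mono_sign (X i) \<mu> = 1"
| "mono_sign (Y i) \<mu> = 1"
| "mono_sign (Th i) (a, b, A, B) = (-1) ^ card {j\<in>A. j < i}"
| "mono_sign (Vt i) (a, b, A, B) = (-1) ^ (card A + card {j\<in>B. j < i})"

text \<open>Order of the odd factors in a normal-ordered monomial. Adjoining an earlier odd factor
  moves a later one by one place and so flips the later one's \<open>mono_sign\<close>; even modes
  are never comparable.\<close>

fun precedes :: "mode \<Rightarrow> mode \<Rightarrow> bool" where
  "precedes (Th i) (Th j) = (i < j)"
| "precedes (Th i) (Vt j) = True"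
| "precedes (Vt i) (Vt j) = (i < j)"
| "precedes _ _ = False"

definition order_sign :: "mode \<Rightarrow> mode \<Rightarrow> complex" where
  "order_sign v w = (if precedes w v then -1 else 1)"

definition swap_sign :: "mode \<Rightarrow> mode \<Rightarrow> complex" where
  "swap_sign v w = (if odd_mode v \<and> odd_mode w then -1 else 1)"

text \<open>An odd mode already present blocks creation, but \<open>inc\<close> leaves such a
  monomial unchanged. \<open>free\<close> marks the monomials on which \<open>inc v\<close> really
  adds a factor and is undone by \<open>dec v\<close>.\<close>

definition free :: "mode \<Rightarrow> mono \<Rightarrow> bool" where
  "free v \<mu> \<longleftrightarrow> (odd_mode v \<longrightarrow> expo \<mu> v = 0)"

definition finite_thetas :: "mono \<Rightarrow> bool" where
  "finite_thetas \<mu> = (case \<mu> of (a, b, A, B) \<Rightarrow> finite A)"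

fun creat :: "mode \<Rightarrow> spoly \<Rightarrow> spoly" where
  "creat (X i) = mx i" | "creat (Y i) = my i" | "creat (Th i) = th i" | "creat (Vt i) = vt i"

fun annih :: "mode \<Rightarrow> spoly \<Rightarrow> spoly" where
  "annih (X i) = dx i" | "annih (Y i) = dy i" | "annih (Th i) = dth i" | "annih (Vt i) = dvt i"

lemma creat_apply: "creat v p \<mu> = (if 0 < expo \<mu> v then mono_sign v \<mu> * p (dec v \<mu>) else 0)"
  by (cases v; cases \<mu>) (auto simp: mx_def my_def th_def vt_def)

lemma annih_apply: "annih v p \<mu> = (if free v \<mu> then of_nat (expo \<mu> v + 1) * mono_sign v \<mu> * p (inc v \<mu>) else 0)"
  by (cases v; cases \<mu>) (auto simp: dx_def dy_def dth_def dvt_def free_def)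

lemma mono_eqI:
  assumes "\<And>v. expo \<mu> v = expo \<nu> v"
  shows "\<mu> = \<nu>"
proof -
  obtain a b A B a' b' A' B' where \<mu>\<nu>: "\<mu> = (a, b, A, B)" "\<nu> = (a', b', A', B')"
    by (metis prod_cases4)
  have "a i = a' i" "b i = b' i" "i \<in> A \<longleftrightarrow> i \<in> A'" "i \<in> B \<longleftrightarrow> i \<in> B'" for i
    using assms[of "X i"] assms[of "Y i"] assms[of "Th i"] assms[of "Vt i"]
    by (simp_all only: expo.simps of_bool_eq_iff \<mu>\<nu>)
  then show ?thesis by (auto simp: \<mu>\<nu>)
qed

lemma expo_inc: "expo (inc w \<mu>) v = (if v = w then (if odd_mode v then 1 else expo \<mu> v + 1) else expo \<mu> v)"
  by (cases v; cases w; cases \<mu>) auto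

lemma expo_dec: "expo (dec w \<mu>) v = (if v = w then expo \<mu> v - 1 else expo \<mu> v)"
  by (cases v; cases w; cases \<mu>) auto

lemma expo_odd_le: "odd_mode v \<Longrightarrow> expo \<mu> v \<le> 1"
  by (cases v; cases \<mu>) auto

lemma finite_thetas_inc [simp]: "finite_thetas (inc w \<mu>) = finite_thetas \<mu>"
  by (cases w; cases \<mu>) (auto simp: finite_thetas_def)

lemma finite_thetas_dec [simp]: "finite_thetas (dec w \<mu>) = finite_thetas \<mu>"
  by (cases w; cases \<mu>) (auto simp: finite_thetas_def)

lemma inc_commute: "inc v (inc w \<mu>) = inc w (inc v \<mu>)"
  by (rule mono_eqI) (auto simp: expo_inc)

lemma dec_commute: "dec v (dec w \<mu>) = dec w (dec v \<mu>)"
  by (rule mono_eqI) (auto simp: expo_dec)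

lemma inc_dec_commute: "v \<noteq> w \<Longrightarrow> inc v (dec w \<mu>) = dec w (inc v \<mu>)"
  by (rule mono_eqI) (auto simp: expo_inc expo_dec)

lemma dec_inc: "free v \<mu> \<Longrightarrow> dec v (inc v \<mu>) = \<mu>"
  by (rule mono_eqI) (auto simp: expo_inc expo_dec free_def)

lemma inc_dec: "0 < expo \<mu> v \<Longrightarrow> inc v (dec v \<mu>) = \<mu>"
  using expo_odd_le[of v \<mu>] by (intro mono_eqI) (auto simp: expo_inc expo_dec)

lemma free_dec: "free v (dec v \<mu>)"
  using expo_odd_le[of v \<mu>] by (auto simp: free_def expo_dec)

lemma free_neq: "v \<noteq> w \<Longrightarrow> free v (dec w \<mu>) = free v \<mu>" "v \<noteq> w \<Longrightarrow> free v (inc w \<mu>) = free v \<mu>"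
  by (auto simp: free_def expo_dec expo_inc)

lemma mono_sign_square [simp]: "mono_sign v \<mu> * mono_sign v \<mu> = 1"
  by (cases v; cases \<mu>) (auto simp flip: power_mult_distrib)

lemma mono_sign_inc_self: "mono_sign v (inc v \<mu>) = mono_sign v \<mu>"
proof -
  have *: "{j \<in> insert i A. j < i} = {j \<in> A. j < i}" for A and i :: nat by auto
  have **: "{j. (j = i \<or> j \<in> A) \<and> j < i} = {j \<in> A. j < i}" for A and i :: nat by auto
  show ?thesis by (cases v; cases \<mu>) (auto simp: * **)
qed

lemma card_less_insert:
  fixes i j :: nat
  assumes "i \<notin> A"
  shows "card {k. (k = i \<or> k \<in> A) \<and> k < j} = (if i < j then 1 else 0) + card {k \<in> A. k < j}"
proof (cases "i < j")
  case True
  then have "{k. (k = i \<or> k \<in> A) \<and> k < j} = insert i {k \<in> A. k < j}" by auto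
  then show ?thesis using assms True by simp
next
  case False
  then have "{k. (k = i \<or> k \<in> A) \<and> k < j} = {k \<in> A. k < j}" by auto
  then show ?thesis using False by simp
qed

lemma mono_sign_inc:
  assumes "finite_thetas \<mu>" "v \<noteq> w" "free w \<mu>"
  shows "mono_sign v (inc w \<mu>) = order_sign v w * mono_sign v \<mu>"
  using assms
  by (cases v; cases w; cases \<mu>) (auto simp: order_sign_def free_def card_less_insert finite_thetas_def)

lemma mono_sign_dec_self: "mono_sign v (dec v \<mu>) = mono_sign v \<mu>"
proof -
  have *: "{j \<in> A - {i}. j < i} = {j \<in> A. j < i}" for A and i :: nat by auto
  have **: "{j. j \<in> A \<and> j \<noteq> i \<and> j < i} = {j \<in> A. j < i}" for A and i :: nat by auto
  show ?thesis by (cases v; cases \<mu>) (auto simp: * **)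
qed

lemma order_sign_square [simp]: "order_sign v w * (order_sign v w * c) = c"
  by (simp add: order_sign_def)

lemma mono_sign_dec:
  assumes "finite_thetas \<mu>" "v \<noteq> w" "0 < expo \<mu> w"
  shows "mono_sign v (dec w \<mu>) = order_sign v w * mono_sign v \<mu>"
  using mono_sign_inc[of "dec w \<mu>" v w] assms inc_dec[of \<mu> w] free_dec[of w \<mu>] by simp

text \<open>Of two distinct odd modes exactly one precedes the other, so exactly one of the two
  order signs is -1. This turns the signs of a fixed ordering into the graded commutation
  rule.\<close>

lemma order_sign_swap: "v \<noteq> w \<Longrightarrow> order_sign v w = swap_sign v w * order_sign w v"
  by (cases v; cases w) (auto simp: order_sign_def swap_sign_def)

lemma swap_sign_sym: "swap_sign v w = swap_sign w v"
  by (auto simp: swap_sign_def)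

lemma swap_sign_square [simp]: "swap_sign v w * swap_sign v w = 1" "swap_sign v w * (swap_sign v w * c) = c"
  by (auto simp: swap_sign_def)

text \<open>The sign in vt and dvt uses the cardinality of the set of theta indices, which is the junk
  value 0 on infinite sets. The sign rules therefore need finiteness of the support sets.\<close>

definition theta_finite :: "spoly \<Rightarrow> bool" where
  "theta_finite p \<longleftrightarrow> (\<forall>\<mu>. p \<mu> \<noteq> 0 \<longrightarrow> finite_thetas \<mu>)"

lemma thfinD: "theta_finite p \<Longrightarrow> \<not> finite_thetas \<mu> \<Longrightarrow> p \<mu> = 0"
  by (metis theta_finite_def)

lemma creat_creat:
  assumes "theta_finite p"
  shows "creat v (creat w p) = swap_sign v w \<odot> creat w (creat v p)"
proof (cases "v = w")
  case True
  show ?thesis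
  proof (cases "odd_mode v")
    case odd: True
    then have "creat v (creat v p) = 0"
      using expo_odd_le[of v] by (auto simp: fun_eq_iff creat_apply expo_dec)
    then show ?thesis using True by (simp add: fun_eq_iff)
  qed (simp add: True fun_eq_iff swap_sign_def)
next
  case False
  show ?thesis
  proof
    fix \<mu>
    show "creat v (creat w p) \<mu> = (swap_sign v w \<odot> creat w (creat v p)) \<mu>"
      using False mono_sign_dec[of \<mu> v w] mono_sign_dec[of \<mu> w v] order_sign_swap[of v w] thfinD[OF assms]
      by (cases "finite_thetas \<mu>") (auto simp: creat_apply expo_dec dec_commute[of v w])
  qed
qed

lemma annih_annih:
  assumes "theta_finite p"
  shows "annih v (annih w p) = swap_sign v w \<odot> annih w (annih v p)"
proof (cases "v = w")
  case True
  show ?thesis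
  proof (cases "odd_mode v")
    case odd: True
    then have "annih v (annih v p) = 0"
      by (auto simp: fun_eq_iff annih_apply free_def expo_inc)
    then show ?thesis using True by (simp add: fun_eq_iff)
  qed (simp add: True fun_eq_iff swap_sign_def)
next
  case False
  show ?thesis
  proof
    fix \<mu>
    show "annih v (annih w p) \<mu> = (swap_sign v w \<odot> annih w (annih v p)) \<mu>"
      using False mono_sign_inc[of \<mu> v w] mono_sign_inc[of \<mu> w v] order_sign_swap[of v w] thfinD[OF assms]
      by (cases "finite_thetas \<mu>") (auto simp: annih_apply expo_inc inc_commute[of v w] free_neq)
  qed
qed

lemma annih_creat:
  assumes "theta_finite p" "v \<noteq> w"
  shows "annih v (creat w p) = swap_sign v w \<odot> creat w (annih v p)"
proof
  fix \<mu>
  show "annih v (creat w p) \<mu> = (swap_sign v w \<odot> creat w (annih v p)) \<mu>"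
    using assms(2) mono_sign_inc[of \<mu> w v] mono_sign_dec[of \<mu> v w] order_sign_swap[of v w] thfinD[OF assms(1)]
    by (cases "finite_thetas \<mu>") (auto simp: creat_apply annih_apply expo_inc expo_dec inc_dec_commute free_neq swap_sign_sym)
qed

text \<open>Together with \<open>creat_annih_self\<close> these are the canonical relations at a
  single mode: the two products add up to 1 for an odd mode and differ by 1 for an even one.\<close>

lemma annih_creat_self: "annih v (creat v p) \<mu> = (if odd_mode v then 1 - of_nat (expo \<mu> v) else 1 + of_nat (expo \<mu> v)) * p \<mu>"
  using expo_odd_le[of v \<mu>]
  by (cases "free v \<mu>") (auto simp: creat_apply annih_apply expo_inc mono_sign_inc_self dec_inc free_def le_Suc_eq)

lemma creat_annih_self: "creat v (annih v p) \<mu> = of_nat (expo \<mu> v) * p \<mu>"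
  by (cases "expo \<mu> v") (auto simp: creat_apply annih_apply expo_dec mono_sign_dec_self inc_dec free_dec)

lemma creat_add [simp]: "creat v (p + q) = creat v p + creat v q"
  by (auto simp: fun_eq_iff creat_apply algebra_simps)

lemma creat_scale [simp]: "creat v (c \<odot> p) = c \<odot> creat v p"
  by (auto simp: fun_eq_iff creat_apply)

lemma annih_neg [simp]: "annih v (- p) = - annih v p"
  by (auto simp: fun_eq_iff annih_apply)

lemma annih_add [simp]: "annih v (p + q) = annih v p + annih v q"
  by (auto simp: fun_eq_iff annih_apply algebra_simps)

lemma annih_scale [simp]: "annih v (c \<odot> p) = c \<odot> annih v p"
  by (auto simp: fun_eq_iff annih_apply)

text \<open>Modes double as basis vectors of the natural module, star being the dual basis. X 0 is
  self-dual; Y 0 stands for no variable and is kept fixed only to make star an involution.\<close>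

fun star :: "mode \<Rightarrow> mode" where
  "star (X i) = (if i = 0 then X 0 else Y i)"
| "star (Y i) = (if i = 0 then Y 0 else X i)"
| "star (Th r) = Vt r"
| "star (Vt r) = Th r"

lemma star_star [simp]: "star (star v) = v"
  by (cases v) auto

lemma star_eq_iff: "star v = w \<longleftrightarrow> v = star w"
  by auto

lemma star_inject [simp]: "star v = star w \<longleftrightarrow> v = w"
  by (metis star_star)

lemma odd_mode_star [simp]: "odd_mode (star v) = odd_mode v"
  by (cases v) auto

lemma swap_sign_star [simp]: "swap_sign (star v) w = swap_sign v w" "swap_sign v (star w) = swap_sign v w"
  by (auto simp: swap_sign_def)

text \<open>Sign of the invariant form of the natural module, which pairs \<open>v\<close> with
  \<open>star v\<close>: symmetric on even modes, skew on odd ones, as \<open>kappa_star\<close>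
  records. The sign at \<open>Th r\<close> makes \<open>Der (Th r)\<close> the negative of
  \<open>dvt r\<close>.\<close>

fun kappa :: "mode \<Rightarrow> complex" where
  "kappa (Th r) = -1"
| "kappa _ = 1"

lemma kappa_square [simp]: "kappa v * kappa v = 1" "kappa v * (kappa v * c) = c"
  by (cases v; simp)+

lemma kappa_nonzero [simp]: "kappa v \<noteq> 0"
  by (cases v) auto

lemma kappa_star: "kappa (star v) = swap_sign v v * kappa v"
  by (cases v) (auto simp: swap_sign_def)

section \<open>The polynomial space on the given variables\<close>

locale oscillator =
  fixes n m n1 n2 :: nat
  assumes n1_pos: "1 \<le> n1" and n1_n2: "n1 < n2" and n2_n: "n2 \<le> n"
begin

definition Modes :: "mode set" where
  "Modes = X ` {0..n} \<union> Y ` {1..n} \<union> Th ` {1..m} \<union> Vt ` {1..m}"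

definition valid :: "mono \<Rightarrow> bool" where
  "valid \<mu> \<longleftrightarrow> (\<forall>v. expo \<mu> v \<noteq> 0 \<longrightarrow> v \<in> Modes)"

lemma Modes_simps [simp]:
  "X i \<in> Modes \<longleftrightarrow> i \<le> n" "Y i \<in> Modes \<longleftrightarrow> 1 \<le> i \<and> i \<le> n"
  "Th r \<in> Modes \<longleftrightarrow> 1 \<le> r \<and> r \<le> m" "Vt r \<in> Modes \<longleftrightarrow> 1 \<le> r \<and> r \<le> m"
  by (auto simp: Modes_def)

lemma finite_Modes [simp]: "finite Modes"
  by (simp add: Modes_def)

lemma star_Modes [simp]: "star v \<in> Modes \<longleftrightarrow> v \<in> Modes"
  by (cases v) auto

lemma valid_iff:
  "valid (a, b, A, B) \<longleftrightarrow>
    (\<forall>i>n. a i = 0) \<and> b 0 = 0 \<and> (\<forall>i>n. b i = 0) \<and> A \<subseteq> {1..m} \<and> B \<subseteq> {1..m}"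
proof -
  have all_mode: "(\<forall>v. P v) \<longleftrightarrow> (\<forall>i. P (X i) \<and> P (Y i) \<and> P (Th i) \<and> P (Vt i))" for P
    by (metis mode.exhaust)
  show ?thesis
    unfolding valid_def all_mode
    by (auto simp: not_le subset_eq Suc_le_eq) (metis neq0_conv not_le)+
qed

lemma mem_Bsp: "p \<in> Bsp n m \<longleftrightarrow> finite {\<mu>. p \<mu> \<noteq> 0} \<and> (\<forall>\<mu>. p \<mu> \<noteq> 0 \<longrightarrow> valid \<mu>)"
  unfolding Bsp_def by (simp add: valid_iff split_paired_all)

lemma Bsp_finite: "p \<in> Bsp n m \<Longrightarrow> finite {\<mu>. p \<mu> \<noteq> 0}"
  by (simp add: mem_Bsp)

lemma Bsp_valid: "p \<in> Bsp n m \<Longrightarrow> p \<mu> \<noteq> 0 \<Longrightarrow> valid \<mu>"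
  unfolding mem_Bsp by blast

lemma subspace_Bsp: "spoly.subspace (Bsp n m)"
proof -
  have "p + q \<in> Bsp n m" if "p \<in> Bsp n m" "q \<in> Bsp n m" for p q
  proof -
    have "finite {\<mu>. (p + q) \<mu> \<noteq> 0}"
      by (rule finite_subset[of _ "{\<mu>. p \<mu> \<noteq> 0} \<union> {\<mu>. q \<mu> \<noteq> 0}"]) (use that Bsp_finite in auto)
    moreover have "valid \<mu>" if "(p + q) \<mu> \<noteq> 0" for \<mu>
      using that \<open>p \<in> _\<close> \<open>q \<in> _\<close> Bsp_valid[of p \<mu>] Bsp_valid[of q \<mu>] by fastforce
    ultimately show ?thesis by (simp only: mem_Bsp) blast
  qed
  moreover have "c \<odot> p \<in> Bsp n m" if "p \<in> Bsp n m" for c p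
  proof -
    have "finite {\<mu>. (c \<odot> p) \<mu> \<noteq> 0}"
      by (rule finite_subset[of _ "{\<mu>. p \<mu> \<noteq> 0}"]) (use that Bsp_finite in auto)
    moreover have "valid \<mu>" if "(c \<odot> p) \<mu> \<noteq> 0" for \<mu>
      using that \<open>p \<in> _\<close> Bsp_valid[of p \<mu>] by auto
    ultimately show ?thesis by (simp only: mem_Bsp) blast
  qed
  moreover have "0 \<in> Bsp n m" by (auto simp: Bsp_def)
  ultimately show ?thesis by (auto simp: spoly.subspace_def)
qed

lemmas Bsp_add [intro, simp] = spoly.subspace_add[OF subspace_Bsp]
  and Bsp_scale [intro, simp] = spoly.subspace_scale[OF subspace_Bsp]
  and Bsp_0 [simp] = spoly.subspace_0[OF subspace_Bsp]
  and Bsp_diff [intro, simp] = spoly.subspace_diff[OF subspace_Bsp]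
  and Bsp_sum [intro] = spoly.subspace_sum[OF subspace_Bsp]

lemma valid_decD: "valid (dec v \<mu>) \<Longrightarrow> v \<in> Modes \<Longrightarrow> valid \<mu>"
  unfolding valid_def by (metis expo_dec)

lemma valid_incD: "valid (inc v \<mu>) \<Longrightarrow> valid \<mu>"
  unfolding valid_def by (metis add_gr_0 expo_inc not_gr_zero zero_less_one)

lemma valid_finite_thetas: "valid \<mu> \<Longrightarrow> finite_thetas \<mu>"
  by (cases \<mu>) (auto simp: valid_iff finite_thetas_def intro: finite_subset)

lemma theta_finite_Bsp [simp]: "p \<in> Bsp n m \<Longrightarrow> theta_finite p"
  unfolding theta_finite_def using Bsp_valid valid_finite_thetas by blast

lemma creat_Bsp [simp]: "p \<in> Bsp n m \<Longrightarrow> v \<in> Modes \<Longrightarrow> creat v p \<in> Bsp n m"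
  unfolding mem_Bsp
proof (intro conjI allI impI)
  assume p: "finite {\<mu>. p \<mu> \<noteq> 0} \<and> (\<forall>\<mu>. p \<mu> \<noteq> 0 \<longrightarrow> valid \<mu>)" and v: "v \<in> Modes"
  have "{\<mu>. creat v p \<mu> \<noteq> 0} \<subseteq> inc v ` {\<mu>. p \<mu> \<noteq> 0}"
  proof
    fix \<mu> assume "\<mu> \<in> {\<mu>. creat v p \<mu> \<noteq> 0}"
    then have "p (dec v \<mu>) \<noteq> 0" "0 < expo \<mu> v" by (auto simp: creat_apply split: if_splits)
    then show "\<mu> \<in> inc v ` {\<mu>. p \<mu> \<noteq> 0}"
      by (intro image_eqI[of _ _ "dec v \<mu>"]) (simp_all add: inc_dec)
  qed
  then show "finite {\<mu>. creat v p \<mu> \<noteq> 0}"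
    using p finite_surj by blast
  show "valid \<mu>" if "creat v p \<mu> \<noteq> 0" for \<mu>
  proof -
    have "p (dec v \<mu>) \<noteq> 0" using that by (auto simp: creat_apply split: if_splits)
    then show ?thesis using p v valid_decD by blast
  qed
qed

lemma annih_Bsp [simp]: "p \<in> Bsp n m \<Longrightarrow> annih v p \<in> Bsp n m"
  unfolding mem_Bsp
proof (intro conjI allI impI)
  assume p: "finite {\<mu>. p \<mu> \<noteq> 0} \<and> (\<forall>\<mu>. p \<mu> \<noteq> 0 \<longrightarrow> valid \<mu>)"
  have "{\<mu>. annih v p \<mu> \<noteq> 0} \<subseteq> dec v ` {\<mu>. p \<mu> \<noteq> 0}"
  proof
    fix \<mu> assume "\<mu> \<in> {\<mu>. annih v p \<mu> \<noteq> 0}"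
    then have "p (inc v \<mu>) \<noteq> 0" "free v \<mu>" by (auto simp: annih_apply split: if_splits)
    then show "\<mu> \<in> dec v ` {\<mu>. p \<mu> \<noteq> 0}"
      by (intro image_eqI[of _ _ "inc v \<mu>"]) (simp_all add: dec_inc)
  qed
  then show "finite {\<mu>. annih v p \<mu> \<noteq> 0}"
    using p finite_surj by blast
  show "valid \<mu>" if "annih v p \<mu> \<noteq> 0" for \<mu>
  proof -
    have "p (inc v \<mu>) \<noteq> 0" using that by (auto simp: annih_apply split: if_splits)
    then show ?thesis using p valid_incD by blast
  qed
qed

section \<open>Twisted multiplications and derivations\<close>

fun twisted :: "mode \<Rightarrow> bool" where
  "twisted (X i) \<longleftrightarrow> 1 \<le> i \<and> i \<le> n1"
| "twisted (Y i) \<longleftrightarrow> n2 < i"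
| "twisted (Th i) \<longleftrightarrow> False"
| "twisted (Vt i) \<longleftrightarrow> False"

lemma twisted_even: "twisted v \<Longrightarrow> \<not> odd_mode v"
  by (cases v) auto

definition Mul :: "mode \<Rightarrow> spoly \<Rightarrow> spoly" where
  "Mul v = (if twisted v then annih v else creat v)"

text \<open>Twisting swaps creation and annihilation on the modes moved by sigma. Since Der v is
  the derivation with respect to the mode dual to v, it is built from the operators of star v.\<close>

definition der_sign :: "mode \<Rightarrow> complex" where
  "der_sign v = (if twisted (star v) then -1 else kappa v)"

definition Der :: "mode \<Rightarrow> spoly \<Rightarrow> spoly" where
  "Der v p = der_sign v \<odot> (if twisted (star v) then creat (star v) p else annih (star v) p)"

lemma Mul_linear: "module_hom psmult psmult (Mul v)"
  by unfold_locales (auto simp: Mul_def)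

lemma Der_linear: "module_hom psmult psmult (Der v)"
  by unfold_locales (auto simp: Der_def fun_eq_iff algebra_simps)

lemmas Mul_simps [simp] =
  module_hom.add[OF Mul_linear] module_hom.scale[OF Mul_linear]
  module_hom.diff[OF Mul_linear] module_hom.neg[OF Mul_linear]
  module_hom.zero[OF Mul_linear] module_hom.sum[OF Mul_linear]

lemmas Der_simps [simp] =
  module_hom.add[OF Der_linear] module_hom.scale[OF Der_linear]
  module_hom.diff[OF Der_linear] module_hom.neg[OF Der_linear]
  module_hom.zero[OF Der_linear] module_hom.sum[OF Der_linear]

lemma Mul_Bsp [simp]: "p \<in> Bsp n m \<Longrightarrow> v \<in> Modes \<Longrightarrow> Mul v p \<in> Bsp n m"
  by (auto simp: Mul_def)

lemma Der_Bsp [simp]: "p \<in> Bsp n m \<Longrightarrow> v \<in> Modes \<Longrightarrow> Der v p \<in> Bsp n m"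
  by (auto simp: Der_def)

lemma Mul_Mul: "p \<in> Bsp n m \<Longrightarrow> Mul v (Mul w p) = swap_sign v w \<odot> Mul w (Mul v p)"
  using creat_creat[of p v w] annih_annih[of p v w] annih_creat[of p v w] annih_creat[of p w v]
  by (cases "v = w") (auto simp: Mul_def swap_sign_sym)

lemma Der_Der:
  assumes "p \<in> Bsp n m"
  shows "Der v (Der w p) = swap_sign v w \<odot> Der w (Der v p)"
proof (cases "v = w")
  case True
  then show ?thesis
    using assms creat_creat[of p "star v" "star v"] annih_annih[of p "star v" "star v"]
    by (cases "odd_mode v") (auto simp: Der_def swap_sign_def fun_eq_iff)
next
  case False
  then show ?thesis
    using assms creat_creat[of p "star v" "star w"] annih_annih[of p "star v" "star w"]
      annih_creat[of p "star v" "star w"] annih_creat[of p "star w" "star v"]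
    by (cases "twisted (star v)"; cases "twisted (star w)") (simp_all add: Der_def swap_sign_sym mult_ac)
qed

definition pairing :: "mode \<Rightarrow> mode \<Rightarrow> complex" where
  "pairing v w = (if w = star v then kappa v else 0)"

text \<open>A twist replaces the pair (creation, annihilation) by (annihilation, minus creation),
  which satisfies the same relation; hence the right-hand side does not mention
  \<open>twisted\<close>. Later operator identities rest on this and on the supercommutation of the
  \<open>Mul\<close> and of the \<open>Der\<close> among themselves.\<close>

lemma Der_Mul:
  assumes "p \<in> Bsp n m"
  shows "Der v (Mul w p) = swap_sign v w \<odot> Mul w (Der v p) + pairing v w \<odot> p"
proof (cases "w = star v")
  case False
  then show ?thesis
    using assms creat_creat[of p "star v" w] annih_annih[of p "star v" w]
      annih_creat[of p "star v" w] annih_creat[of p w "star v"]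
    by (simp add: Der_def Mul_def swap_sign_sym mult_ac pairing_def)
next
  case True
  show ?thesis
  proof (cases "twisted w")
    case twisted: True
    then have "\<not> odd_mode w" by (rule twisted_even)
    with twisted True have "kappa v = 1" by (cases v) auto
    with twisted True \<open>\<not> odd_mode w\<close> show ?thesis
      by (auto simp: Der_def Mul_def fun_eq_iff annih_creat_self creat_annih_self swap_sign_def pairing_def der_sign_def algebra_simps)
  next
    case False
    with True show ?thesis
      by (auto simp: Der_def Mul_def fun_eq_iff annih_creat_self creat_annih_self swap_sign_def pairing_def der_sign_def algebra_simps)
  qed
qed

section \<open>The orthosymplectic operators\<close>

definition osp_op :: "mode \<Rightarrow> mode \<Rightarrow> spoly \<Rightarrow> spoly" where
  "osp_op v w p = Mul v (Der w p) - swap_sign v w \<odot> Mul w (Der v p)"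

lemma osp_op_linear: "module_hom psmult psmult (osp_op v w)"
  by unfold_locales (auto simp: osp_op_def fun_eq_iff algebra_simps)

lemma osp_op_swap: "osp_op w v p = (- swap_sign v w) \<odot> osp_op v w p"
  by (auto simp: osp_op_def fun_eq_iff algebra_simps swap_sign_sym)

lemma Mul_eqs: "Mul (X i) = sX n1 i" "Mul (Y i) = sY n2 i" "Mul (Th i) = th i" "Mul (Vt i) = vt i"
  by (auto simp: Mul_def sX_def sY_def)

lemma Der_eqs:
  "1 \<le> i \<Longrightarrow> Der (X i) = sDY n2 i" "1 \<le> i \<Longrightarrow> Der (Y i) = sDX n1 i"
  "Der (X 0) = dx 0" "Der (Th i) p = - dvt i p" "Der (Vt i) = dth i"
  by (auto simp: Der_def sDX_def sDY_def der_sign_def fun_eq_iff)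

lemma sX_0: "sX n1 0 = mx 0"
  by (simp add: sX_def)

lemma sigma_neg:
  "sX n1 i (- p) = - sX n1 i p" "sY n2 i (- p) = - sY n2 i p"
  "th i (- p) = - th i p" "vt i (- p) = - vt i p" "mx 0 (- p) = - mx 0 p"
  unfolding Mul_eqs[symmetric] sX_0[symmetric] by simp_all

text \<open>The sign \<open>c\<close> absorbs \<open>Der (Th i) p = - dvt i p\<close>: the witnesses
  have it equal to -1 exactly for the families matched with a \<open>Th\<close> in the second
  slot.\<close>

lemma ospOps_is_osp_op:
  assumes "T \<in> ospOps n m n1 n2"
  shows "\<exists>v\<in>Modes. \<exists>w\<in>Modes. \<exists>c\<in>{1, -1}. \<forall>p. T p = c \<odot> osp_op v w p"
proof -
  have P: "\<exists>v\<in>Modes. \<exists>w\<in>Modes. \<exists>c\<in>{1, -1}. \<forall>p. T p = c \<odot> osp_op v w p"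
    if "v \<in> Modes" "w \<in> Modes" "c \<in> {1, -1}" "\<And>p. T p = c \<odot> osp_op v w p" for v w c
    using that by blast
  note L = osp_op_def Mul_eqs Der_eqs sX_0 swap_sign_def oadd_def osub_def sigma_neg
  show ?thesis
    using assms unfolding ospOps_def
  proof (elim UnE CollectE exE conjE, goal_cases)
    case (1 i j) then show ?case by (intro P[of "X i" "Y j" 1]) (simp_all add: L)
  next
    case (2 r s) then show ?case by (intro P[of "Th r" "Vt s" 1]) (simp_all add: L)
  next
    case (3 i r) then show ?case by (intro P[of "X i" "Vt r" 1]) (simp_all add: L)
  next
    case (4 i r) then show ?case by (intro P[of "Th r" "Y i" 1]) (simp_all add: L)
  next
    case (5 i j) then show ?case by (intro P[of "X i" "X j" 1]) (simp_all add: L)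
  next
    case (6 i j) then show ?case by (intro P[of "Y i" "Y j" 1]) (simp_all add: L)
  next
    case (7 r s) then show ?case by (intro P[of "Vt r" "Vt s" 1]) (simp_all add: L)
  next
    case (8 r s) then show ?case by (intro P[of "Th r" "Th s" "-1"]) (simp_all add: L)
  next
    case (9 i r) then show ?case by (intro P[of "X i" "Th r" "-1"]) (simp_all add: L)
  next
    case (10 i r) then show ?case by (intro P[of "Y i" "Vt r" 1]) (simp_all add: L)
  next
    case (11 i) then show ?case by (intro P[of "X 0" "Y i" 1]) (simp_all add: L)
  next
    case (12 i) then show ?case by (intro P[of "X 0" "X i" 1]) (simp_all add: L)
  next
    case (13 r) then show ?case by (intro P[of "X 0" "Vt r" 1]) (simp_all add: L)
  next
    case (14 r) then show ?case by (intro P[of "X 0" "Th r" "-1"]) (simp_all add: L)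
  qed
qed

text \<open>The case c = 0 covers osp_op v v for even v, which vanishes and is not in the spanning set.\<close>

definition in_ops :: "mode \<Rightarrow> mode \<Rightarrow> bool" where
  "in_ops v w \<longleftrightarrow> (\<exists>c T. (c = 0 \<or> T \<in> ospOps n m n1 n2) \<and> (\<forall>p. osp_op v w p = c \<odot> T p))"

lemma in_ops_swap: "in_ops v w \<Longrightarrow> in_ops w v"
  unfolding in_ops_def
proof (elim exE conjE)
  fix c T assume "c = 0 \<or> T \<in> ospOps n m n1 n2" "\<forall>p. osp_op v w p = c \<odot> T p"
  then have "(- swap_sign v w * c = 0 \<or> T \<in> ospOps n m n1 n2) \<and> (\<forall>p. osp_op w v p = (- swap_sign v w * c) \<odot> T p)"
    by (subst osp_op_swap) auto
  then show "\<exists>c T. (c = 0 \<or> T \<in> ospOps n m n1 n2) \<and> (\<forall>p. osp_op w v p = c \<odot> T p)" by blast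
qed

lemma ospOps_intros:
  "i \<in> {1..n} \<Longrightarrow> j \<in> {1..n} \<Longrightarrow> osub (sX n1 i \<circ> sDX n1 j) (sY n2 j \<circ> sDY n2 i) \<in> ospOps n m n1 n2"
  "r \<in> {1..m} \<Longrightarrow> s \<in> {1..m} \<Longrightarrow> osub (th r \<circ> dth s) (vt s \<circ> dvt r) \<in> ospOps n m n1 n2"
  "i \<in> {1..n} \<Longrightarrow> r \<in> {1..m} \<Longrightarrow> osub (sX n1 i \<circ> dth r) (vt r \<circ> sDY n2 i) \<in> ospOps n m n1 n2"
  "i \<in> {1..n} \<Longrightarrow> r \<in> {1..m} \<Longrightarrow> oadd (th r \<circ> sDX n1 i) (sY n2 i \<circ> dvt r) \<in> ospOps n m n1 n2"
  "1 \<le> i \<and> i < j \<and> j \<le> n \<Longrightarrow> osub (sX n1 i \<circ> sDY n2 j) (sX n1 j \<circ> sDY n2 i) \<in> ospOps n m n1 n2"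
  "1 \<le> i \<and> i < j \<and> j \<le> n \<Longrightarrow> osub (sY n2 i \<circ> sDX n1 j) (sY n2 j \<circ> sDX n1 i) \<in> ospOps n m n1 n2"
  "1 \<le> r \<and> r \<le> s \<and> s \<le> m \<Longrightarrow> oadd (vt r \<circ> dth s) (vt s \<circ> dth r) \<in> ospOps n m n1 n2"
  "1 \<le> r \<and> r \<le> s \<and> s \<le> m \<Longrightarrow> oadd (th r \<circ> dvt s) (th s \<circ> dvt r) \<in> ospOps n m n1 n2"
  "i \<in> {1..n} \<Longrightarrow> r \<in> {1..m} \<Longrightarrow> oadd (sX n1 i \<circ> dvt r) (th r \<circ> sDY n2 i) \<in> ospOps n m n1 n2"
  "i \<in> {1..n} \<Longrightarrow> r \<in> {1..m} \<Longrightarrow> osub (sY n2 i \<circ> dth r) (vt r \<circ> sDX n1 i) \<in> ospOps n m n1 n2"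
  "i \<in> {1..n} \<Longrightarrow> osub (mx 0 \<circ> sDX n1 i) (sY n2 i \<circ> dx 0) \<in> ospOps n m n1 n2"
  "i \<in> {1..n} \<Longrightarrow> osub (mx 0 \<circ> sDY n2 i) (sX n1 i \<circ> dx 0) \<in> ospOps n m n1 n2"
  "r \<in> {1..m} \<Longrightarrow> osub (mx 0 \<circ> dth r) (vt r \<circ> dx 0) \<in> ospOps n m n1 n2"
  "r \<in> {1..m} \<Longrightarrow> oadd (mx 0 \<circ> dvt r) (th r \<circ> dx 0) \<in> ospOps n m n1 n2"
  unfolding ospOps_def Un_iff mem_Collect_eq
  by (((rule disjI2, (intro exI conjI, rule refl; fast)) | rule disjI1 |
    (intro exI conjI, rule refl; fast))+)

text \<open>The spanning set lists one order of each pair of modes; the other order follows from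
  graded skew symmetry. Equal even modes give the zero operator, equal odd modes belong to the
  families with r \<le> s.\<close>

lemma osp_op_in_ops:
  assumes "v \<in> Modes" "w \<in> Modes"
  shows "in_ops v w"
proof -
  note L = osp_op_def Mul_eqs Der_eqs sX_0 swap_sign_def oadd_def osub_def sigma_neg
  have I: "in_ops v w" if "T \<in> ospOps n m n1 n2" "\<And>p. osp_op v w p = c \<odot> T p" for v w c T
    using that unfolding in_ops_def by blast
  have Z: "in_ops v w" if "\<And>p. osp_op v w p = 0" for v w
    unfolding in_ops_def by (intro exI[of _ 0] exI[of _ id]) (simp add: that fun_eq_iff)
  note M = ospOps_intros
  have XY: "in_ops (X i) (Y j)" if "i \<le> n" "1 \<le> j" "j \<le> n" for i j
  proof (cases "i = 0")
    case True
    have "osub (mx 0 \<circ> sDX n1 j) (sY n2 j \<circ> dx 0) \<in> ospOps n m n1 n2" 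
      by (rule M) (use that in auto)
    from I[OF this, of "X i" "Y j" 1] show ?thesis using that True by (simp add: L)
  next
    case False
    have "osub (sX n1 i \<circ> sDX n1 j) (sY n2 j \<circ> sDY n2 i) \<in> ospOps n m n1 n2"
      by (rule M) (use that False in auto)
    from I[OF this, of "X i" "Y j" 1] show ?thesis using that False by (simp add: L)
  qed
  have XX: "in_ops (X i) (X j)" if "i < j" "j \<le> n" for i j
  proof (cases "i = 0")
    case True
    have "osub (mx 0 \<circ> sDY n2 j) (sX n1 j \<circ> dx 0) \<in> ospOps n m n1 n2" 
      by (rule M) (use that in auto)
    from I[OF this, of "X i" "X j" 1] show ?thesis using that True by (simp add: L)
  next
    case False
    then have "1 \<le> i \<and> i < j \<and> j \<le> n" using that by simp
    then have "osub (sX n1 i \<circ> sDY n2 j) (sX n1 j \<circ> sDY n2 i) \<in> ospOps n m n1 n2"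
      by (intro M) auto
    from I[OF this, of "X i" "X j" 1] show ?thesis using that False by (simp add: L)
  qed
  have XX0: "in_ops (X i) (X i)" for i
    by (rule Z) (simp add: osp_op_def swap_sign_def fun_eq_iff)
  have YY: "in_ops (Y i) (Y j)" if "1 \<le> i" "i < j" "j \<le> n" for i j
  proof -
    have "osub (sY n2 i \<circ> sDX n1 j) (sY n2 j \<circ> sDX n1 i) \<in> ospOps n m n1 n2"
      by (rule M) (use that in auto)
    from I[OF this, of "Y i" "Y j" 1] show ?thesis using that by (simp add: L)
  qed
  have YY0: "in_ops (Y i) (Y i)" for i
    by (rule Z) (simp add: osp_op_def swap_sign_def fun_eq_iff)
  have XT: "in_ops (X i) (Th r)" if "i \<le> n" "1 \<le> r" "r \<le> m" for i r
  proof (cases "i = 0")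
    case True
    have "oadd (mx 0 \<circ> dvt r) (th r \<circ> dx 0) \<in> ospOps n m n1 n2" 
      by (rule M) (use that in auto)
    from I[OF this, of "X i" "Th r" "-1"] show ?thesis using that True by (simp add: L)
  next
    case False
    have "oadd (sX n1 i \<circ> dvt r) (th r \<circ> sDY n2 i) \<in> ospOps n m n1 n2"
      by (rule M) (use that False in auto)
    from I[OF this, of "X i" "Th r" "-1"] show ?thesis using that False by (simp add: L)
  qed
  have XV: "in_ops (X i) (Vt r)" if "i \<le> n" "1 \<le> r" "r \<le> m" for i r
  proof (cases "i = 0")
    case True
    have "osub (mx 0 \<circ> dth r) (vt r \<circ> dx 0) \<in> ospOps n m n1 n2" 
      by (rule M) (use that in auto)
    from I[OF this, of "X i" "Vt r" 1] show ?thesis using that True by (simp add: L)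
  next
    case False
    have "osub (sX n1 i \<circ> dth r) (vt r \<circ> sDY n2 i) \<in> ospOps n m n1 n2"
      by (rule M) (use that False in auto)
    from I[OF this, of "X i" "Vt r" 1] show ?thesis using that False by (simp add: L)
  qed
  have YT: "in_ops (Th r) (Y i)" if "1 \<le> i" "i \<le> n" "1 \<le> r" "r \<le> m" for i r
  proof -
    have "oadd (th r \<circ> sDX n1 i) (sY n2 i \<circ> dvt r) \<in> ospOps n m n1 n2" 
      by (rule M) (use that in auto)
    from I[OF this, of "Th r" "Y i" 1] show ?thesis using that by (simp add: L)
  qed
  have YV: "in_ops (Y i) (Vt r)" if "1 \<le> i" "i \<le> n" "1 \<le> r" "r \<le> m" for i r
  proof -
    have "osub (sY n2 i \<circ> dth r) (vt r \<circ> sDX n1 i) \<in> ospOps n m n1 n2" 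
      by (rule M) (use that in auto)
    from I[OF this, of "Y i" "Vt r" 1] show ?thesis using that by (simp add: L)
  qed
  have TV: "in_ops (Th r) (Vt s)" if "1 \<le> r" "r \<le> m" "1 \<le> s" "s \<le> m" for r s
  proof -
    have "osub (th r \<circ> dth s) (vt s \<circ> dvt r) \<in> ospOps n m n1 n2" 
      by (rule M) (use that in auto)
    from I[OF this, of "Th r" "Vt s" 1] show ?thesis using that by (simp add: L)
  qed
  have TT: "in_ops (Th r) (Th s)" if "1 \<le> r" "r \<le> s" "s \<le> m" for r s
  proof -
    have "oadd (th r \<circ> dvt s) (th s \<circ> dvt r) \<in> ospOps n m n1 n2" 
      by (rule M) (use that in auto)
    from I[OF this, of "Th r" "Th s" "-1"] show ?thesis using that by (simp add: L)
  qed
  have VV: "in_ops (Vt r) (Vt s)" if "1 \<le> r" "r \<le> s" "s \<le> m" for r s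
  proof -
    have "oadd (vt r \<circ> dth s) (vt s \<circ> dth r) \<in> ospOps n m n1 n2" 
      by (rule M) (use that in auto)
    from I[OF this, of "Vt r" "Vt s" 1] show ?thesis using that by (simp add: L)
  qed
  note sw = in_ops_swap
  have XX': "in_ops (X i) (X j)" if "i \<le> n" "j \<le> n" for i j
    using XX[of i j] XX0[of i] sw[OF XX[of j i]] that by (cases i j rule: linorder_cases) auto
  have YY': "in_ops (Y i) (Y j)" if "1 \<le> i" "i \<le> n" "1 \<le> j" "j \<le> n" for i j
    using YY[of i j] YY0[of i] sw[OF YY[of j i]] that by (cases i j rule: linorder_cases) auto
  have TT': "in_ops (Th i) (Th j)" if "1 \<le> i" "i \<le> m" "1 \<le> j" "j \<le> m" for i j
    using TT[of i j] sw[OF TT[of j i]] that by (cases "i \<le> j") auto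
  have VV': "in_ops (Vt i) (Vt j)" if "1 \<le> i" "i \<le> m" "1 \<le> j" "j \<le> m" for i j
    using VV[of i j] sw[OF VV[of j i]] that by (cases "i \<le> j") auto
  show ?thesis
    using assms
    by (cases v; cases w) (simp_all add: XX' YY' TT' VV' XY XT XV YT YV TV
      sw[OF XY] sw[OF XT] sw[OF XV] sw[OF YT] sw[OF YV] sw[OF TV])
qed

lemma op_invariant_iff:
  assumes "spoly.subspace U"
  shows "op_invariant (ospOps n m n1 n2) U \<longleftrightarrow> (\<forall>v\<in>Modes. \<forall>w\<in>Modes. \<forall>p\<in>U. osp_op v w p \<in> U)"
proof safe
  fix v w p assume *: "op_invariant (ospOps n m n1 n2) U" "v \<in> Modes" "w \<in> Modes" "p \<in> U"
  obtain c T where "c = 0 \<or> T \<in> ospOps n m n1 n2" "\<forall>p. osp_op v w p = c \<odot> T p"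
    using osp_op_in_ops[OF *(2,3)] unfolding in_ops_def by blast
  then show "osp_op v w p \<in> U"
    using * spoly.subspace_scale[OF assms] spoly.subspace_0[OF assms]
    by (auto simp: op_invariant_def)
next
  assume *: "\<forall>v\<in>Modes. \<forall>w\<in>Modes. \<forall>p\<in>U. osp_op v w p \<in> U"
  show "op_invariant (ospOps n m n1 n2) U"
    unfolding op_invariant_def
  proof (intro ballI)
    fix T p assume "T \<in> ospOps n m n1 n2" "p \<in> U"
    with ospOps_is_osp_op[of T] * spoly.subspace_scale[OF assms] show "T p \<in> U" by metis
  qed
qed

section \<open>The commuting sl2\<close>

text \<open>Each dual pair occurs twice in the sum and the self-dual \<open>X 0\<close> once; hence
  the factor 2 that \<open>Delta'\<close> has in front of \<open>Delta\<close> but not in front of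
  the square of \<open>dx 0\<close>.\<close>

definition Lap :: "spoly \<Rightarrow> spoly" where
  "Lap p = (\<Sum>v\<in>Modes. kappa v \<odot> Der (star v) (Der v p))"

definition Eta :: "spoly \<Rightarrow> spoly" where
  "Eta p = (\<Sum>v\<in>Modes. kappa v \<odot> Mul (star v) (Mul v p))"

lemma sum_Modes:
  fixes f :: "mode \<Rightarrow> 'a::comm_monoid_add"
  shows "sum f Modes = f (X 0) + (\<Sum>i\<in>{1..n}. f (X i) + f (Y i)) + (\<Sum>r\<in>{1..m}. f (Th r) + f (Vt r))"
proof -
  have "sum f (X ` {0..n}) = f (X 0) + (\<Sum>i\<in>{1..n}. f (X i))"
    by (simp add: sum.reindex inj_on_def sum.atLeast_Suc_atMost)
  moreover have "sum f Modes = sum f (X ` {0..n}) + sum f (Y ` {1..n}) + sum f (Th ` {1..m}) + sum f (Vt ` {1..m})"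
    unfolding Modes_def by ((subst sum.union_disjoint, simp, simp, force)+, simp)
  ultimately show ?thesis
    by (simp add: sum.reindex inj_on_def sum.distrib algebra_simps)
qed

lemma sum_split_range:
  fixes f :: "nat \<Rightarrow> 'a::comm_monoid_add"
  shows "sum f {1..n} = sum f {1..n1} + sum f {n1+1..n2} + sum f {n2+1..n}"
proof -
  have "{1..n} = ({1..n1} \<union> {n1+1..n2}) \<union> {n2+1..n}"
    using n1_n2 n2_n by auto
  then have "sum f {1..n} = sum f (({1..n1} \<union> {n1+1..n2}) \<union> {n2+1..n})"
    by (rule arg_cong)
  also have "\<dots> = sum f ({1..n1} \<union> {n1+1..n2}) + sum f {n2+1..n}"
    by (rule sum.union_disjoint) (use n1_n2 in auto)
  also have "sum f ({1..n1} \<union> {n1+1..n2}) = sum f {1..n1} + sum f {n1+1..n2}"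
    by (rule sum.union_disjoint) auto
  finally show ?thesis .
qed

lemma Delta_eq:
  assumes "p \<in> Bsp n m"
  shows "Delta n m n1 n2 p = (\<Sum>i\<in>{1..n}. sDX n1 i (sDY n2 i p)) + (\<Sum>r\<in>{1..m}. dth r (dvt r p))"
proof -
  have 1: "sDX n1 i (sDY n2 i p) = - mx i (dy i p)" if "i \<in> {1..n1}" for i
    using that n1_n2 by (auto simp: sDX_def sDY_def)
  have 2: "sDX n1 i (sDY n2 i p) = dx i (dy i p)" if "i \<in> {n1+1..n2}" for i
    using that by (auto simp: sDX_def sDY_def)
  have 3: "sDX n1 i (sDY n2 i p) = - my i (dx i p)" if "i \<in> {n2+1..n}" for i
    using that n1_n2 annih_creat[of p "X i" "Y i"] annih_neg[of "X i" "my i p"] assms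
    by (auto simp: sDX_def sDY_def swap_sign_def fun_eq_iff)
  show ?thesis
    unfolding sum_split_range
    by (rule ext) (simp add: Delta_def 1 2 3 sum_fun_apply sum_negf)
qed

lemma eta_eq:
  assumes "p \<in> Bsp n m"
  shows "eta n m n1 n2 p = (\<Sum>i\<in>{1..n}. sX n1 i (sY n2 i p)) + (\<Sum>r\<in>{1..m}. th r (vt r p))"
proof -
  have 1: "sX n1 i (sY n2 i p) = my i (dx i p)" if "i \<in> {1..n1}" for i
    using that n1_n2 annih_creat[of p "X i" "Y i"] assms
    by (auto simp: sX_def sY_def swap_sign_def fun_eq_iff)
  have 2: "sX n1 i (sY n2 i p) = mx i (my i p)" if "i \<in> {n1+1..n2}" for i
    using that by (auto simp: sX_def sY_def)
  have 3: "sX n1 i (sY n2 i p) = mx i (dy i p)" if "i \<in> {n2+1..n}" for i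
    using that n1_n2 by (auto simp: sX_def sY_def)
  show ?thesis
    unfolding sum_split_range
    by (rule ext) (simp add: eta_def 1 2 3 sum_fun_apply)
qed

lemma Delta'_eq_Lap:
  assumes "p \<in> Bsp n m"
  shows "Delta' n m n1 n2 p = Lap p"
proof -
  have XY: "Der (Y i) (Der (X i) p) + Der (X i) (Der (Y i) p) = 2 \<odot> sDX n1 i (sDY n2 i p)" if "i \<in> {1..n}" for i
    using that Der_Der[OF assms, of "X i" "Y i"] by (auto simp: Der_eqs swap_sign_def fun_eq_iff)
  have TV: "- Der (Vt r) (Der (Th r) p) + Der (Th r) (Der (Vt r) p) = 2 \<odot> dth r (dvt r p)" for r
    using Der_Der[OF assms, of "Th r" "Vt r"] annih_neg[of "Th r" "dvt r p"]
    by (auto simp: Der_eqs swap_sign_def fun_eq_iff)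
  show ?thesis
    unfolding Lap_def sum_Modes Delta'_def Delta_eq[OF assms]
    using XY TV by (simp add: Der_eqs spoly.scale_right_distrib spoly.scale_sum_right)
qed

lemma eta'_eq_Eta:
  assumes "p \<in> Bsp n m"
  shows "eta' n m n1 n2 p = Eta p"
proof -
  have XY: "Mul (Y i) (Mul (X i) p) + Mul (X i) (Mul (Y i) p) = 2 \<odot> sX n1 i (sY n2 i p)" for i
    using Mul_Mul[OF assms, of "X i" "Y i"] by (auto simp: Mul_eqs swap_sign_def fun_eq_iff)
  have TV: "- Mul (Vt r) (Mul (Th r) p) + Mul (Th r) (Mul (Vt r) p) = 2 \<odot> th r (vt r p)" for r
    using Mul_Mul[OF assms, of "Th r" "Vt r"] by (auto simp: Mul_eqs swap_sign_def fun_eq_iff)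
  show ?thesis
    unfolding Eta_def sum_Modes eta'_def eta_eq[OF assms]
    using XY TV by (simp add: Mul_eqs sX_0 spoly.scale_right_distrib spoly.scale_sum_right)
qed

lemma Lap_linear: "module_hom psmult psmult Lap"
  by unfold_locales
    (simp_all add: Lap_def spoly.scale_right_distrib sum.distrib spoly.scale_sum_right mult_ac)

lemma Eta_linear: "module_hom psmult psmult Eta"
  by unfold_locales
    (simp_all add: Eta_def spoly.scale_right_distrib sum.distrib spoly.scale_sum_right mult_ac)

lemmas Lap_simps [simp] =
  module_hom.add[OF Lap_linear] module_hom.scale[OF Lap_linear]
  module_hom.diff[OF Lap_linear] module_hom.neg[OF Lap_linear]
  module_hom.zero[OF Lap_linear] module_hom.sum[OF Lap_linear]

lemmas Eta_simps [simp] =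
  module_hom.add[OF Eta_linear] module_hom.scale[OF Eta_linear]
  module_hom.diff[OF Eta_linear] module_hom.neg[OF Eta_linear]
  module_hom.zero[OF Eta_linear] module_hom.sum[OF Eta_linear]

lemma Lap_Bsp [simp]: "p \<in> Bsp n m \<Longrightarrow> Lap p \<in> Bsp n m"
  by (simp add: Lap_def Bsp_sum)

lemma Eta_Bsp [simp]: "p \<in> Bsp n m \<Longrightarrow> Eta p \<in> Bsp n m"
  by (simp add: Eta_def Bsp_sum)

lemma sum_Modes_delta:
  "u \<in> Modes \<Longrightarrow> (\<Sum>v\<in>Modes. (if v = u then c v else 0) \<odot> f v) = c u \<odot> f u"
proof -
  assume u: "u \<in> Modes"
  have "(\<Sum>v\<in>Modes. (if v = u then c v else 0) \<odot> f v) = (\<Sum>v\<in>Modes. if v = u then c v \<odot> f v else 0)"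
    by (rule sum.cong) auto
  then show ?thesis using u by simp
qed

text \<open>\<open>Mul u\<close> is contracted once with each of the two \<open>Der\<close> factors,
  at \<open>v = u\<close> and at \<open>v = star u\<close> (one index for \<open>X 0\<close>). Both
  contractions yield \<open>Der u p\<close>, hence the 2.\<close>

lemma Lap_Mul:
  assumes "p \<in> Bsp n m" "u \<in> Modes"
  shows "Lap (Mul u p) = Mul u (Lap p) + 2 \<odot> Der u p"
proof -
  have term_eq: "kappa v \<odot> Der (star v) (Der v (Mul u p)) = Mul u (kappa v \<odot> Der (star v) (Der v p))
      + (if v = star u then 1 else 0) \<odot> Der (star v) p + (if v = u then 1 else 0) \<odot> Der v p"
    if "v \<in> Modes" for v
    using that assms
    by (auto simp: Der_Mul pairing_def kappa_star fun_eq_iff algebra_simps star_eq_iff split: if_splits)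
  have "Lap (Mul u p) = Mul u (Lap p) + (\<Sum>v\<in>Modes. (if v = star u then 1 else 0) \<odot> Der (star v) p)
      + (\<Sum>v\<in>Modes. (if v = u then 1 else 0) \<odot> Der v p)"
    unfolding Lap_def using term_eq by (simp add: sum.distrib)
  then show ?thesis
    using assms by (simp add: sum_Modes_delta) (simp add: fun_eq_iff)
qed

lemma Lap_Der:
  assumes "p \<in> Bsp n m" "u \<in> Modes"
  shows "Lap (Der u p) = Der u (Lap p)"
proof -
  have "Der (star v) (Der v (Der u p)) = Der u (Der (star v) (Der v p))" if "v \<in> Modes" for v
    using that assms Der_Der[of p v u] Der_Der[of "Der v p" "star v" u]
    by (simp add: swap_sign_sym)
  then show ?thesis by (simp add: Lap_def)
qed

lemma Eta_Mul:
  assumes "p \<in> Bsp n m" "u \<in> Modes"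
  shows "Eta (Mul u p) = Mul u (Eta p)"
proof -
  have "Mul (star v) (Mul v (Mul u p)) = Mul u (Mul (star v) (Mul v p))" if "v \<in> Modes" for v
    using that assms Mul_Mul[of p v u] Mul_Mul[of "Mul v p" "star v" u]
    by (simp add: swap_sign_sym)
  then show ?thesis by (simp add: Eta_def)
qed

lemma Eta_Der:
  assumes "p \<in> Bsp n m" "u \<in> Modes"
  shows "Eta (Der u p) = Der u (Eta p) - 2 \<odot> Mul u p"
proof -
  have self_star: "u = star u \<Longrightarrow> swap_sign u u = 1"
    by (cases u) (auto simp: swap_sign_def)
  have term_eq: "Der u (kappa v \<odot> Mul (star v) (Mul v p)) = kappa v \<odot> Mul (star v) (Mul v (Der u p))
      + (if v = star u then 1 else 0) \<odot> Mul (star v) p + (if v = u then 1 else 0) \<odot> Mul v p"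
    if "v \<in> Modes" for v
    using that assms self_star
    by (auto simp: Der_Mul pairing_def kappa_star fun_eq_iff algebra_simps star_eq_iff split: if_splits)
  have "Der u (Eta p) = Eta (Der u p) + (\<Sum>v\<in>Modes. (if v = star u then 1 else 0) \<odot> Mul (star v) p)
      + (\<Sum>v\<in>Modes. (if v = u then 1 else 0) \<odot> Mul v p)"
    unfolding Eta_def using term_eq by (simp add: sum.distrib)
  then show ?thesis
    using assms by (simp add: sum_Modes_delta) (simp add: fun_eq_iff)
qed

text \<open>The contraction terms \<open>2 \<odot> Der v (Der w p)\<close> and
  \<open>2 \<odot> Der w (Der v p)\<close> cancel thanks to the graded antisymmetrisation in
  \<open>osp_op\<close>; a single product \<open>Mul v (Der w p)\<close> does not commute with
  \<open>Lap\<close> in general.\<close>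

lemma Lap_osp_op:
  assumes "p \<in> Bsp n m" "v \<in> Modes" "w \<in> Modes"
  shows "Lap (osp_op v w p) = osp_op v w (Lap p)"
  using assms Der_Der[of p v w] by (simp add: osp_op_def Lap_Mul Lap_Der) (simp add: fun_eq_iff algebra_simps)

lemma Eta_osp_op:
  assumes "p \<in> Bsp n m" "v \<in> Modes" "w \<in> Modes"
  shows "Eta (osp_op v w p) = osp_op v w (Eta p)"
  using assms Mul_Mul[of p v w] by (simp add: osp_op_def Eta_Mul Eta_Der) (simp add: fun_eq_iff algebra_simps)

section \<open>Number operators and gradings\<close>

definition number_ev :: "mode \<Rightarrow> mono \<Rightarrow> int" where
  "number_ev v \<mu> = (if twisted v then - int (expo \<mu> v) else if odd_mode v then int (expo \<mu> v) - 1 else 1 + int (expo \<mu> v))"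

lemma star_twisted: "twisted v \<Longrightarrow> v \<in> Modes \<Longrightarrow> \<not> twisted (star v)"
  using n1_n2 by (cases v) auto

text \<open>For twisted \<open>v\<close> the product is minus creation after annihilation, which
  explains the eigenvalue \<open>- expo\<close> without a constant. All scalars computed below are
  sums of these integers.\<close>

lemma number_ev_apply: "kappa v * Der (star v) (Mul v p) \<mu> = of_int (number_ev v \<mu>) * p \<mu>"
proof (cases "twisted v")
  case True
  then have "kappa v = 1" by (cases v) auto
  then show ?thesis using True by (simp add: Der_def Mul_def der_sign_def number_ev_def creat_annih_self)
next
  case False
  then show ?thesis
    by (simp add: Der_def Mul_def der_sign_def number_ev_def annih_creat_self kappa_star swap_sign_def algebra_simps)
qed

definition grade :: "(mode \<Rightarrow> int) \<Rightarrow> mono \<Rightarrow> int" where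
  "grade c \<mu> = (\<Sum>v\<in>Modes. c v * int (expo \<mu> v))"

definition deg_coeff :: "mode \<Rightarrow> int" where
  "deg_coeff v = (if twisted v then -1 else 1)"

lemma sum_of_bool_card: "A \<subseteq> {1..m} \<Longrightarrow> (\<Sum>r\<in>{1..m}. of_bool (r \<in> A)) = int (card A)"
  by (simp add: of_bool_def sum.If_cases Int_absorb1)

text \<open>Validity confines the index sets of the odd variables to {1..m}, so that their
  cardinalities become sums over modes.\<close>

lemma sdeg_eq_grade:
  assumes "valid \<mu>"
  shows "sdeg n n1 n2 \<mu> = grade deg_coeff \<mu>"
proof -
  obtain a b A B where \<mu>: "\<mu> = (a, b, A, B)" by (cases \<mu>)
  have x: "(\<Sum>i\<in>{1..n}. deg_coeff (X i) * int (a i)) = (\<Sum>r\<in>{n1+1..n}. int (a r)) - (\<Sum>i\<in>{1..n1}. int (a i))"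
  proof -
    have "{1..n} = {1..n1} \<union> {n1+1..n}" using n1_n2 n2_n by auto
    then have "(\<Sum>i\<in>{1..n}. deg_coeff (X i) * int (a i)) =
        (\<Sum>i\<in>{1..n1}. deg_coeff (X i) * int (a i)) + (\<Sum>i\<in>{n1+1..n}. deg_coeff (X i) * int (a i))"
      by (simp add: sum.union_disjoint ivl_disj_int)
    then show ?thesis by (simp add: deg_coeff_def sum_negf)
  qed
  have y: "(\<Sum>i\<in>{1..n}. deg_coeff (Y i) * int (b i)) = (\<Sum>i\<in>{1..n2}. int (b i)) - (\<Sum>r\<in>{n2+1..n}. int (b r))"
  proof -
    have "{1..n} = {1..n2} \<union> {n2+1..n}" using n1_n2 n2_n by auto
    then have "(\<Sum>i\<in>{1..n}. deg_coeff (Y i) * int (b i)) =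
        (\<Sum>i\<in>{1..n2}. deg_coeff (Y i) * int (b i)) + (\<Sum>i\<in>{n2+1..n}. deg_coeff (Y i) * int (b i))"
      by (simp add: sum.union_disjoint ivl_disj_int)
    then show ?thesis by (simp add: deg_coeff_def sum_negf)
  qed
  have "deg_coeff (X 0) = 1" "\<And>r. deg_coeff (Th r) = 1" "\<And>r. deg_coeff (Vt r) = 1"
    by (auto simp: deg_coeff_def)
  then show ?thesis
    using assms x y sum_of_bool_card[of A] sum_of_bool_card[of B] unfolding \<mu> valid_iff
    by (simp add: sdeg_def grade_def sum_Modes sum.distrib)
qed

lemma grade_inc:
  assumes "v \<in> Modes" "free v \<mu>"
  shows "grade c (inc v \<mu>) = grade c \<mu> + c v"
proof -
  have "c w * int (expo (inc v \<mu>) w) = c w * int (expo \<mu> w) + (if w = v then c v else 0)" for w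
    using assms(2) by (auto simp: expo_inc free_def algebra_simps)
  then show ?thesis using assms(1) by (simp add: grade_def sum.distrib)
qed

lemma grade_dec:
  assumes "v \<in> Modes" "0 < expo \<mu> v"
  shows "grade c (dec v \<mu>) = grade c \<mu> - c v"
  using grade_inc[of v "dec v \<mu>" c] free_dec[of v \<mu>] inc_dec[of \<mu> v] assms by simp

text \<open>\<open>Mul v\<close> lowers the exponent of a twisted mode, whose degree coefficient is
  negative as well. So \<open>shift deg_coeff v = 1\<close> for every mode, and each
  \<open>osp_op\<close> preserves the degree.\<close>

definition shift :: "(mode \<Rightarrow> int) \<Rightarrow> mode \<Rightarrow> int" where
  "shift c v = (if twisted v then - c v else c v)"

text \<open>The source monomial \<nu> is chosen before the grading, so that several gradings can be
  compared on one and the same monomial.\<close>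

lemma Mul_shift:
  assumes "Mul v p \<mu> \<noteq> 0" "v \<in> Modes"
  obtains \<nu> where "p \<nu> \<noteq> 0" "\<And>c. grade c \<mu> = grade c \<nu> + shift c v"
proof (cases "twisted v")
  case True
  with assms have "free v \<mu>" "p (inc v \<mu>) \<noteq> 0"
    by (auto simp: Mul_def annih_apply split: if_splits)
  then show ?thesis using that[of "inc v \<mu>"] assms True by (simp add: grade_inc shift_def)
next
  case False
  with assms have "0 < expo \<mu> v" "p (dec v \<mu>) \<noteq> 0"
    by (auto simp: Mul_def creat_apply split: if_splits)
  then show ?thesis using that[of "dec v \<mu>"] assms False by (simp add: grade_dec shift_def)
qed

lemma Der_shift:
  assumes "Der v p \<mu> \<noteq> 0" "v \<in> Modes"
  obtains \<nu> where "p \<nu> \<noteq> 0" "\<And>c. grade c \<mu> = grade c \<nu> - shift c (star v)"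
proof (cases "twisted (star v)")
  case True
  with assms have "0 < expo \<mu> (star v)" "p (dec (star v) \<mu>) \<noteq> 0"
    by (auto simp: Der_def creat_apply split: if_splits)
  then show ?thesis using that[of "dec (star v) \<mu>"] assms True by (simp add: grade_dec shift_def)
next
  case False
  with assms have "free (star v) \<mu>" "p (inc (star v) \<mu>) \<noteq> 0"
    by (auto simp: Der_def annih_apply split: if_splits)
  then show ?thesis using that[of "inc (star v) \<mu>"] assms False by (simp add: grade_inc shift_def)
qed

abbreviation "BK \<equiv> Bk n m n1 n2"
abbreviation "HK \<equiv> Hk n m n1 n2"

lemma mem_BK: "p \<in> BK k \<longleftrightarrow> p \<in> Bsp n m \<and> (\<forall>\<mu>. p \<mu> \<noteq> 0 \<longrightarrow> grade deg_coeff \<mu> = k)"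
  unfolding Bk_def mem_Collect_eq using Bsp_valid sdeg_eq_grade by metis

lemma BK_Bsp: "p \<in> BK k \<Longrightarrow> p \<in> Bsp n m"
  by (simp add: mem_BK)

lemma BK_deg: "p \<in> BK k \<Longrightarrow> p \<mu> \<noteq> 0 \<Longrightarrow> grade deg_coeff \<mu> = k"
  unfolding mem_BK by blast

lemma mem_HK: "p \<in> HK k \<longleftrightarrow> p \<in> BK k \<and> Lap p = 0"
  using BK_Bsp Delta'_eq_Lap by (auto simp: Hk_def)

lemma HK_BK: "p \<in> HK k \<Longrightarrow> p \<in> BK k"
  by (simp add: mem_HK)

lemma HK_Bsp: "p \<in> HK k \<Longrightarrow> p \<in> Bsp n m"
  using mem_HK BK_Bsp by blast

lemma subspace_BK: "spoly.subspace (BK k)"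
proof (rule spoly.subspaceI)
  show "0 \<in> BK k" by (simp add: mem_BK)
next
  fix p q assume *: "p \<in> BK k" "q \<in> BK k"
  have "grade deg_coeff \<mu> = k" if "(p + q) \<mu> \<noteq> 0" for \<mu>
  proof -
    have "p \<mu> \<noteq> 0 \<or> q \<mu> \<noteq> 0" using that by auto
    then show ?thesis using * BK_deg by blast
  qed
  then show "p + q \<in> BK k" using * BK_Bsp Bsp_add unfolding mem_BK by blast
next
  fix c p assume *: "p \<in> BK k"
  have "grade deg_coeff \<mu> = k" if "(c \<odot> p) \<mu> \<noteq> 0" for \<mu>
  proof -
    have "p \<mu> \<noteq> 0" using that by auto
    then show ?thesis using * BK_deg by blast
  qed
  then show "c \<odot> p \<in> BK k" using * BK_Bsp Bsp_scale unfolding mem_BK by blast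
qed

lemma subspace_HK: "spoly.subspace (HK k)"
  using subspace_BK[of k] by (auto simp: spoly.subspace_def mem_HK)

lemma Mul_BK: "p \<in> BK k \<Longrightarrow> v \<in> Modes \<Longrightarrow> Mul v p \<in> BK (k + 1)"
  unfolding mem_BK by (auto elim!: Mul_shift) (auto simp: shift_def deg_coeff_def)

lemma Der_BK: "p \<in> BK k \<Longrightarrow> v \<in> Modes \<Longrightarrow> Der v p \<in> BK (k - 1)"
  unfolding mem_BK by (auto elim!: Der_shift) (auto simp: shift_def deg_coeff_def)

lemma Lap_BK: "p \<in> BK k \<Longrightarrow> Lap p \<in> BK (k - 2)"
  using Der_BK[OF Der_BK[of p k]] unfolding Lap_def
  by (auto intro!: spoly.subspace_sum[OF subspace_BK] spoly.subspace_scale[OF subspace_BK])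

lemma Eta_BK: "p \<in> BK k \<Longrightarrow> Eta p \<in> BK (k + 2)"
  using Mul_BK[OF Mul_BK[of p k]] unfolding Eta_def add.assoc one_add_one
  by (auto intro!: spoly.subspace_sum[OF subspace_BK] spoly.subspace_scale[OF subspace_BK])

lemma osp_op_BK: "p \<in> BK k \<Longrightarrow> v \<in> Modes \<Longrightarrow> w \<in> Modes \<Longrightarrow> osp_op v w p \<in> BK k"
  using Mul_BK[OF Der_BK[of p k]] unfolding osp_op_def
  by (auto intro!: spoly.subspace_diff[OF subspace_BK] spoly.subspace_scale[OF subspace_BK])

lemma osp_op_HK: "p \<in> HK k \<Longrightarrow> v \<in> Modes \<Longrightarrow> w \<in> Modes \<Longrightarrow> osp_op v w p \<in> HK k"
  using Lap_osp_op[of p v w] BK_Bsp module_hom.zero[OF osp_op_linear]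
  by (auto simp: mem_HK osp_op_BK)

end

section \<open>Projections onto eigenspaces of diagonal operators\<close>

definition restrict :: "(mono \<Rightarrow> bool) \<Rightarrow> spoly \<Rightarrow> spoly" where
  "restrict P p = (\<lambda>\<mu>. if P \<mu> then p \<mu> else 0)"

text \<open>Lagrange interpolation by induction: each factor (h - f \<mu>0) / (c - f \<mu>0) removes
  one eigenvalue other than \<open>c\<close> from the finite support and acts as 1 where
  \<open>f\<close> equals \<open>c\<close>. Only the support is finite; the spectrum of
  \<open>h\<close> on \<open>U\<close> may be infinite.\<close>

lemma restrict_diag_mem:
  assumes U: "spoly.subspace U"
    and h: "\<And>p. p \<in> U \<Longrightarrow> h p \<in> U" "\<And>p \<mu>. p \<in> U \<Longrightarrow> h p \<mu> = f \<mu> * p \<mu>"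
    and p: "p \<in> U" "finite {\<mu>. p \<mu> \<noteq> 0}"
  shows "restrict (\<lambda>\<mu>. f \<mu> = c) p \<in> U"
  using p
proof (induction "card (f ` {\<mu>. p \<mu> \<noteq> 0} - {c})" arbitrary: p)
  case 0
  then have "f ` {\<mu>. p \<mu> \<noteq> 0} - {c} = {}" by simp
  then have "restrict (\<lambda>\<mu>. f \<mu> = c) p = p"
    by (auto simp: restrict_def fun_eq_iff)
  then show ?case using 0 by simp
next
  case (Suc k)
  then have "f ` {\<mu>. p \<mu> \<noteq> 0} - {c} \<noteq> {}" by force
  then obtain \<mu>0 where \<mu>0: "p \<mu>0 \<noteq> 0" "f \<mu>0 \<noteq> c" by blast
  define q where "q = inverse (c - f \<mu>0) \<odot> (h p - f \<mu>0 \<odot> p)"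
  have q: "q \<mu> = inverse (c - f \<mu>0) * (f \<mu> - f \<mu>0) * p \<mu>" for \<mu>
    using h(2)[OF Suc.prems(1)] by (simp add: q_def algebra_simps)
  have qU: "q \<in> U"
    unfolding q_def using Suc.prems(1) h(1) U
    by (intro spoly.subspace_scale spoly.subspace_diff) auto
  have sub: "{\<mu>. q \<mu> \<noteq> 0} \<subseteq> {\<mu>. p \<mu> \<noteq> 0}" by (auto simp: q)
  then have fin: "finite {\<mu>. q \<mu> \<noteq> 0}" using Suc.prems(2) finite_subset by blast
  have img: "f ` {\<mu>. q \<mu> \<noteq> 0} - {c} = f ` {\<mu>. p \<mu> \<noteq> 0} - {c} - {f \<mu>0}"
    using \<mu>0 by (auto simp: q)
  have "f \<mu>0 \<in> f ` {\<mu>. p \<mu> \<noteq> 0} - {c}" using \<mu>0 by blast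
  then have "card (f ` {\<mu>. q \<mu> \<noteq> 0} - {c}) = k"
    unfolding img using Suc.hyps(2) Suc.prems(2) by simp
  then have "restrict (\<lambda>\<mu>. f \<mu> = c) q \<in> U"
    using Suc.hyps(1) qU fin by blast
  moreover have "restrict (\<lambda>\<mu>. f \<mu> = c) q = restrict (\<lambda>\<mu>. f \<mu> = c) p"
    using \<mu>0 by (auto simp: restrict_def q fun_eq_iff)
  ultimately show ?case by simp
qed

lemma sum_restrict:
  assumes "finite {\<mu>. p \<mu> \<noteq> 0}"
  shows "p = (\<Sum>c\<in>f ` {\<mu>. p \<mu> \<noteq> 0}. restrict (\<lambda>\<mu>. f \<mu> = c) p)"
proof
  fix \<mu>
  have "(\<Sum>c\<in>f ` {\<mu>. p \<mu> \<noteq> 0}. restrict (\<lambda>\<mu>. f \<mu> = c) p \<mu>) = p \<mu>"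
    using assms by (cases "p \<mu> = 0") (auto simp: restrict_def)
  then show "p \<mu> = (\<Sum>c\<in>f ` {\<mu>. p \<mu> \<noteq> 0}. restrict (\<lambda>\<mu>. f \<mu> = c) p) \<mu>"
    by (simp add: sum_fun_apply)
qed

definition single :: "mono \<Rightarrow> spoly" where
  "single \<mu> = (\<lambda>\<nu>. if \<nu> = \<mu> then 1 else 0)"

lemmas pointwise = psmult_apply plus_fun_apply zero_fun_apply minus_apply uminus_apply

text \<open>Resolution eta-expands terms of function type; with these rules active the simplifier would
  rewrite p + q to a lambda abstraction under the expanded binder.\<close>

declare pointwise [simp del]

context oscillator
begin

section \<open>The sl2 relation and its ladders\<close>

definition number_shift :: "mode \<Rightarrow> int" where
  "number_shift v = (if twisted v then 0 else if odd_mode v then -1 else 1)"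

lemma number_ev_eq: "number_ev v \<mu> = deg_coeff v * int (expo \<mu> v) + number_shift v"
  using twisted_even by (auto simp: number_ev_def deg_coeff_def number_shift_def)

definition sl2_weight :: "int \<Rightarrow> int" where
  "sl2_weight k = 4 * k + 2 + 4 * int n2 - 4 * int n1 - 4 * int m"

definition parity_sign :: "mode \<Rightarrow> int" where
  "parity_sign v = (if odd_mode v then -1 else 1)"

lemma sum_number_shift: "(\<Sum>v\<in>Modes. 4 * number_shift v - 2 * parity_sign v) = 2 + 4 * int n2 - 4 * int n1 - 4 * int m"
proof -
  have "(\<Sum>i\<in>{1..n}. 4 * number_shift (X i) - 2 * parity_sign (X i)) = 2 * int n - 4 * int n1"
    unfolding sum_split_range using n1_n2 n2_n by (simp add: number_shift_def parity_sign_def of_nat_diff algebra_simps)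
  moreover have "(\<Sum>i\<in>{1..n}. 4 * number_shift (Y i) - 2 * parity_sign (Y i)) = 4 * int n2 - 2 * int n"
    unfolding sum_split_range using n1_n2 n2_n by (simp add: number_shift_def parity_sign_def of_nat_diff algebra_simps)
  ultimately show ?thesis
    unfolding sum_Modes by (simp add: sum.distrib) (simp add: number_shift_def parity_sign_def algebra_simps)
qed

text \<open>Exchanging \<open>Mul\<close> and \<open>Der\<close> makes every contraction term
  diagonal, at the cost of the superdimension 2n + 1 - 2m counted by \<open>parity_sign\<close>. The
  eigenvalues then add up to four times the degree plus a constant.\<close>

lemma Lap_Eta:
  assumes "p \<in> BK k"
  shows "Lap (Eta p) = Eta (Lap p) + of_int (sl2_weight k) \<odot> p"
proof -
  note p = BK_Bsp[OF assms]
  have 1: "Lap (kappa v \<odot> Mul (star v) (Mul v p)) = kappa v \<odot> Mul (star v) (Mul v (Lap p))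
      + (2 * kappa v) \<odot> Mul (star v) (Der v p) + (2 * kappa v) \<odot> Der (star v) (Mul v p)" if "v \<in> Modes" for v
    using that p by (simp add: Lap_Mul) (simp add: fun_eq_iff pointwise algebra_simps)
  have 2: "(\<Sum>v\<in>Modes. (2 * kappa v) \<odot> Mul (star v) (Der v p)) =
      (\<Sum>v\<in>Modes. (2 * kappa (star v)) \<odot> Mul v (Der (star v) p))"
    by (rule sum.reindex_bij_witness[of _ star star]) auto
  have 3: "(2 * kappa (star v)) \<odot> Mul v (Der (star v) p)
      = (2 * kappa v) \<odot> Der (star v) (Mul v p) - (2 * of_int (parity_sign v)) \<odot> p" if "v \<in> Modes" for v
  proof -
    have "of_int (parity_sign v) = swap_sign v v" by (simp add: parity_sign_def swap_sign_def)
    then show ?thesis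
      using Der_Mul[OF p, of "star v" v]
      by (simp add: pairing_def kappa_star fun_eq_iff pointwise algebra_simps)
  qed
  have "Lap (Eta p) = Eta (Lap p) + (\<Sum>v\<in>Modes. (2 * kappa v) \<odot> Mul (star v) (Der v p))
      + (\<Sum>v\<in>Modes. (2 * kappa v) \<odot> Der (star v) (Mul v p))"
    using 1 by (simp add: Eta_def sum.distrib)
  also have "\<dots> = Eta (Lap p) + (\<Sum>v\<in>Modes. (4 * kappa v) \<odot> Der (star v) (Mul v p) - (2 * of_int (parity_sign v)) \<odot> p)"
    unfolding 2 using 3
    by (simp add: sum_subtractf sum.distrib fun_eq_iff pointwise sum_fun_apply pointwise flip: sum_distrib_left)
      (simp add: sum_distrib_left mult.assoc algebra_simps)
  also have "(\<Sum>v\<in>Modes. (4 * kappa v) \<odot> Der (star v) (Mul v p) - (2 * of_int (parity_sign v)) \<odot> p) = of_int (sl2_weight k) \<odot> p"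
  proof
    fix \<mu>
    have "(\<Sum>v\<in>Modes. (4 * kappa v) \<odot> Der (star v) (Mul v p) - (2 * of_int (parity_sign v)) \<odot> p) \<mu>
       = (\<Sum>v\<in>Modes. of_int (4 * number_ev v \<mu> - 2 * parity_sign v) * p \<mu>)"
      by (simp add: sum_fun_apply pointwise left_diff_distrib mult.assoc number_ev_apply[symmetric])
    also have "\<dots> = of_int (\<Sum>v\<in>Modes. 4 * number_ev v \<mu> - 2 * parity_sign v) * p \<mu>"
      by (simp add: sum_distrib_right)
    also have "(\<Sum>v\<in>Modes. 4 * number_ev v \<mu> - 2 * parity_sign v) = 4 * grade deg_coeff \<mu> + (\<Sum>v\<in>Modes. 4 * number_shift v - 2 * parity_sign v)"
      by (simp add: number_ev_eq grade_def sum.distrib sum_subtractf sum_distrib_left algebra_simps)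
    also have "of_int (4 * grade deg_coeff \<mu> + (\<Sum>v\<in>Modes. 4 * number_shift v - 2 * parity_sign v)) * p \<mu> = (of_int (sl2_weight k) \<odot> p) \<mu>"
      using BK_deg[OF assms, of \<mu>] by (cases "p \<mu> = 0") (auto simp: sum_number_shift sl2_weight_def pointwise)
    finally show "(\<Sum>v\<in>Modes. (4 * kappa v) \<odot> Der (star v) (Mul v p) - (2 * of_int (parity_sign v)) \<odot> p) \<mu>
        = (of_int (sl2_weight k) \<odot> p) \<mu>" .
  qed
  finally show ?thesis .
qed

text \<open>The sum of \<open>sl2_weight (k + 2 * int i)\<close> for i from 0 to l, collected when
  \<open>Lap\<close> is moved past l + 1 copies of \<open>Eta\<close>.\<close>

definition ladder_coeff :: "int \<Rightarrow> nat \<Rightarrow> int" where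
  "ladder_coeff k l = (int l + 1) * (sl2_weight k + 4 * int l)"

text \<open>The second factor is twice an odd integer: \<open>X 0\<close> adds 4 - 2 = 2 to the
  weight, and what remains is divisible by 4.\<close>

lemma ladder_coeff_nonzero: "ladder_coeff k l \<noteq> 0"
proof -
  have "sl2_weight k + 4 * int l = 2 * (2 * (k + int n2 - int n1 - int m + int l) + 1)"
    by (simp add: sl2_weight_def)
  moreover have "2 * (k + int n2 - int n1 - int m + int l) + 1 \<noteq> 0" by presburger
  ultimately show ?thesis by (simp add: ladder_coeff_def)
qed

lemma Eta_pow_BK: "h \<in> BK k \<Longrightarrow> (Eta ^^ l) h \<in> BK (k + 2 * int l)"
  by (induction l) (auto dest: Eta_BK simp: algebra_simps)

lemma Eta_pow_linear: "module_hom psmult psmult (Eta ^^ l)"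
proof (induction l)
  case 0
  then show ?case by unfold_locales auto
next
  case (Suc l)
  then interpret module_hom psmult psmult "Eta ^^ l" .
  show ?case by unfold_locales (auto simp: add scale)
qed

lemma Lap_pow_linear: "module_hom psmult psmult (Lap ^^ l)"
proof (induction l)
  case 0
  then show ?case by unfold_locales auto
next
  case (Suc l)
  then interpret module_hom psmult psmult "Lap ^^ l" .
  show ?case by unfold_locales (auto simp: add scale)
qed

lemma Lap_Eta_pow:
  assumes "h \<in> HK k"
  shows "Lap ((Eta ^^ Suc l) h) = of_int (ladder_coeff k l) \<odot> (Eta ^^ l) h"
proof (induction l)
  case 0
  show ?case using Lap_Eta[of h k] assms by (simp add: mem_HK ladder_coeff_def)
next
  case (Suc l)
  have "(Eta ^^ Suc l) h \<in> BK (k + 2 * int (Suc l))"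
    using assms Eta_pow_BK mem_HK by blast
  from Lap_Eta[OF this] Suc
  have "Lap ((Eta ^^ Suc (Suc l)) h) =
      of_int (ladder_coeff k l) \<odot> Eta ((Eta ^^ l) h) + of_int (sl2_weight (k + 2 * int (Suc l))) \<odot> (Eta ^^ Suc l) h"
    by simp
  also have "\<dots> = of_int (ladder_coeff k l + sl2_weight (k + 2 * int (Suc l))) \<odot> (Eta ^^ Suc l) h"
    by (simp add: spoly.scale_left_distrib)
  also have "ladder_coeff k l + sl2_weight (k + 2 * int (Suc l)) = ladder_coeff k (Suc l)"
    by (simp add: ladder_coeff_def sl2_weight_def algebra_simps)
  finally show ?case .
qed

lemma Lap_pow_Eta_pow:
  assumes "h \<in> HK k"
  shows "\<exists>c. c \<noteq> 0 \<and> (Lap ^^ l) ((Eta ^^ l) h) = c \<odot> h"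
proof (induction l)
  case 0
  show ?case by (rule exI[of _ 1]) (simp add: fun_eq_iff pointwise)
next
  case (Suc l)
  then obtain c where c: "c \<noteq> 0" "(Lap ^^ l) ((Eta ^^ l) h) = c \<odot> h" by blast
  have "(Lap ^^ Suc l) ((Eta ^^ Suc l) h) = (Lap ^^ l) (Lap ((Eta ^^ Suc l) h))"
    by (simp only: funpow_Suc_right o_apply)
  also have "\<dots> = of_int (ladder_coeff k l) \<odot> (c \<odot> h)"
    unfolding Lap_Eta_pow[OF assms] using c module_hom.scale[OF Lap_pow_linear] by simp
  finally show ?case
    using c(1) ladder_coeff_nonzero by (intro exI[of _ "of_int (ladder_coeff k l) * c"]) simp
qed

lemma Lap_pow_Eta_pow_less:
  assumes "h \<in> HK k" "l < N"
  shows "(Lap ^^ N) ((Eta ^^ l) h) = 0"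
proof -
  obtain c where c: "(Lap ^^ l) ((Eta ^^ l) h) = c \<odot> h"
    using Lap_pow_Eta_pow[OF assms(1)] by blast
  have "Lap ^^ N = (Lap ^^ (N - Suc l)) \<circ> (Lap ^^ Suc l)"
    using funpow_add[of "N - Suc l" "Suc l" Lap] assms(2) by (simp del: funpow.simps)
  then have "(Lap ^^ N) ((Eta ^^ l) h) = (Lap ^^ (N - Suc l)) (Lap ((Lap ^^ l) ((Eta ^^ l) h)))"
    by simp
  also have "\<dots> = 0"
    using assms(1) module_hom.zero[OF Lap_pow_linear] by (simp add: c mem_HK)
  finally show ?thesis .
qed

text \<open>The weight 2 compensates the terms of Lap that lower a variable dual to a twisted one while
  raising the twisted one.\<close>

definition nil_coeff :: "mode \<Rightarrow> int" where
  "nil_coeff v = (if twisted (star v) then 2 else 1)"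

lemma grade_nil_coeff_nonneg: "0 \<le> grade nil_coeff \<mu>"
  unfolding grade_def by (rule sum_nonneg) (simp add: nil_coeff_def)

lemma Lap_lowers:
  assumes "Lap p \<mu> \<noteq> 0"
  obtains \<nu> where "p \<nu> \<noteq> 0" "grade nil_coeff \<mu> < grade nil_coeff \<nu>"
proof -
  obtain v where v: "v \<in> Modes" "Der (star v) (Der v p) \<mu> \<noteq> 0"
    using assms unfolding Lap_def sum_fun_apply pointwise by (auto elim!: sum.not_neutral_contains_not_neutral)
  obtain \<nu>1 where 1: "Der v p \<nu>1 \<noteq> 0" "grade nil_coeff \<mu> = grade nil_coeff \<nu>1 - shift nil_coeff v"
    using Der_shift[OF v(2)] v(1) by (metis star_Modes star_star)
  obtain \<nu> where 2: "p \<nu> \<noteq> 0" "grade nil_coeff \<nu>1 = grade nil_coeff \<nu> - shift nil_coeff (star v)"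
    using Der_shift[OF 1(1) v(1)] by metis
  \<comment> \<open>The sum is 1 + 1 for an untwisted pair and 2 - 1 when one of the two modes is
    twisted.\<close>
  have "0 < shift nil_coeff v + shift nil_coeff (star v)"
    using v(1) star_twisted[of v] by (auto simp: shift_def nil_coeff_def)
  then show ?thesis using that[OF 2(1)] 1(2) 2(2) by linarith
qed

lemma Lap_nilpotent_bound:
  assumes "\<And>\<mu>. p \<mu> \<noteq> 0 \<Longrightarrow> grade nil_coeff \<mu> < int N"
  shows "(Lap ^^ N) p = 0"
  using assms
proof (induction N arbitrary: p)
  case 0
  have "p \<mu> = 0" for \<mu> using 0[of \<mu>] grade_nil_coeff_nonneg[of \<mu>] by force
  then show ?case by (simp add: fun_eq_iff pointwise)
next
  case (Suc N)
  have "grade nil_coeff \<mu> < int N" if \<mu>: "Lap p \<mu> \<noteq> 0" for \<mu>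
  proof -
    obtain \<nu> where "p \<nu> \<noteq> 0" "grade nil_coeff \<mu> < grade nil_coeff \<nu>" using Lap_lowers[OF \<mu>] .
    then show ?thesis using Suc.prems[of \<nu>] by linarith
  qed
  then have "(Lap ^^ N) (Lap p) = 0" by (rule Suc.IH)
  then show ?case by (simp only: funpow_Suc_right o_apply)
qed

lemma Lap_nilpotent:
  assumes "p \<in> Bsp n m"
  shows "\<exists>N. (Lap ^^ N) p = 0"
proof -
  define S where "S = (\<lambda>\<mu>. nat (grade nil_coeff \<mu>)) ` {\<mu>. p \<mu> \<noteq> 0}"
  have "finite S" unfolding S_def using Bsp_finite[OF assms] by simp
  then obtain N where N: "\<forall>x\<in>S. x < N" using finite_nat_set_iff_bounded by blast
  have "grade nil_coeff \<mu> < int N" if "p \<mu> \<noteq> 0" for \<mu>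
  proof -
    have "nat (grade nil_coeff \<mu>) < N" using N that unfolding S_def by blast
    then show ?thesis using grade_nil_coeff_nonneg[of \<mu>] by linarith
  qed
  then show ?thesis using Lap_nilpotent_bound by blast
qed

section \<open>Each degree as the span of raised harmonics\<close>

definition layers :: "int \<Rightarrow> spoly set" where
  "layers k = spoly.span (\<Union>l. (Eta ^^ l) ` HK (k - 2 * int l))"

lemma layers_base: "h \<in> HK (k - 2 * int l) \<Longrightarrow> (Eta ^^ l) h \<in> layers k"
  unfolding layers_def by (rule spoly.span_base) blast

text \<open>One step up a ladder multiplies by a ladder coefficient after \<open>Lap\<close>; as
  this is never 0, dividing by it solves the equation on generators, and linearity does the
  rest.\<close>

lemma Lap_onto_layers:
  assumes "q \<in> layers (k - 2)"
  shows "\<exists>r\<in>layers k. Lap r = q"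
  using assms unfolding layers_def[of "k - 2"]
proof (induction rule: spoly.span_induct)
  case (step q)
  then obtain l h where h: "h \<in> HK (k - 2 - 2 * int l)" "q = (Eta ^^ l) h" by blast
  define c :: complex where "c = of_int (ladder_coeff (k - 2 - 2 * int l) l)"
  have c: "c \<noteq> 0" by (simp add: c_def ladder_coeff_nonzero)
  have "k - 2 - 2 * int l = k - 2 * int (Suc l)" by simp
  then have "(Eta ^^ Suc l) h \<in> layers k" using layers_base[of h k "Suc l"] h(1) by metis
  then have "inverse c \<odot> (Eta ^^ Suc l) h \<in> layers k"
    unfolding layers_def by (rule spoly.span_scale)
  moreover have "Lap (inverse c \<odot> (Eta ^^ Suc l) h) = q"
    using Lap_Eta_pow[OF h(1), of l] c h(2) by (simp add: c_def fun_eq_iff pointwise)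
  ultimately show ?case by blast
next
  case base
  show ?case
  proof (rule spoly.subspaceI; simp only: mem_Collect_eq)
    show "\<exists>r\<in>layers k. Lap r = 0"
      by (rule bexI[of _ 0]) (simp_all add: layers_def spoly.span_zero)
  next
    fix x y assume "\<exists>r\<in>layers k. Lap r = x" "\<exists>r\<in>layers k. Lap r = y"
    then obtain r s where "r \<in> layers k" "s \<in> layers k" "Lap r = x" "Lap s = y" by blast
    then show "\<exists>r\<in>layers k. Lap r = x + y"
      by (intro bexI[of _ "r + s"]) (simp_all add: layers_def spoly.span_add)
  next
    fix c x assume "\<exists>r\<in>layers k. Lap r = x"
    then obtain r where "r \<in> layers k" "Lap r = x" by blast
    then show "\<exists>r\<in>layers k. Lap r = c \<odot> x"
      by (intro bexI[of _ "c \<odot> r"]) (simp_all add: layers_def spoly.span_scale)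
  qed
qed

lemma layers_BK: "layers k \<subseteq> BK k"
  unfolding layers_def
proof (rule spoly.span_minimal[OF _ subspace_BK])
  show "(\<Union>l. (Eta ^^ l) ` HK (k - 2 * int l)) \<subseteq> BK k"
  proof safe
    fix l h assume "h \<in> HK (k - 2 * int l)"
    from Eta_pow_BK[OF HK_BK[OF this], of l] show "(Eta ^^ l) h \<in> BK k" by simp
  qed
qed

text \<open>Induction on the order of nilpotency of \<open>Lap\<close> at \<open>p\<close>: if
  \<open>Lap p\<close> is already spanned, some spanned \<open>r\<close> has the same image under
  \<open>Lap\<close>, and \<open>p - r\<close> is harmonic.\<close>

lemma BK_layers:
  assumes "p \<in> BK k"
  shows "p \<in> layers k"
proof -
  obtain N where "(Lap ^^ N) p = 0" using Lap_nilpotent[OF BK_Bsp[OF assms]] by blast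
  then show ?thesis using assms
  proof (induction N arbitrary: p k)
    case 0
    then show ?case by (simp add: layers_def spoly.span_zero)
  next
    case (Suc N)
    then have "(Lap ^^ N) (Lap p) = 0" by (simp only: funpow_Suc_right o_apply)
    then have "Lap p \<in> layers (k - 2)" using Suc.IH Lap_BK Suc.prems(2) by blast
    then obtain r where r: "r \<in> layers k" "Lap r = Lap p" using Lap_onto_layers by blast
    have "r \<in> BK k" using r(1) layers_BK by blast
    then have "p - r \<in> HK k"
      using Suc.prems(2) r(2) spoly.subspace_diff[OF subspace_BK] by (simp add: mem_HK)
    then have "p - r \<in> layers k" using layers_base[of "p - r" k 0] by simp
    then have "(p - r) + r \<in> layers k" using r(1) unfolding layers_def by (rule spoly.span_add)
    then show ?case by simp
  qed
qed

text \<open>Serves to replace a vector representing a functional by a harmonic one: the part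
  \<open>Eta t\<close> is invisible to harmonics under the contravariant form.\<close>

lemma BK_harmonic_part:
  assumes "p \<in> BK k"
  shows "\<exists>h\<in>HK k. \<exists>t\<in>Bsp n m. p = h + Eta t"
  using BK_layers[OF assms] unfolding layers_def
proof (induction rule: spoly.span_induct)
  case (step p)
  then obtain l h where h: "h \<in> HK (k - 2 * int l)" "p = (Eta ^^ l) h" by blast
  show ?case
  proof (cases l)
    case 0
    then show ?thesis using h by (intro bexI[of _ h] bexI[of _ 0]) auto
  next
    case (Suc l')
    have "(Eta ^^ l') h \<in> Bsp n m" using h(1) Eta_pow_BK HK_BK BK_Bsp by blast
    then show ?thesis using h Suc subspace_HK
      by (intro bexI[of _ 0] bexI[of _ "(Eta ^^ l') h"]) (auto simp: spoly.subspace_0)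
  qed
next
  case base
  show ?case
  proof (rule spoly.subspaceI; simp only: mem_Collect_eq)
    show "\<exists>h\<in>HK k. \<exists>t\<in>Bsp n m. 0 = h + Eta t"
      using subspace_HK by (intro bexI[of _ 0]) (auto simp: spoly.subspace_0)
  next
    fix x y assume "\<exists>h\<in>HK k. \<exists>t\<in>Bsp n m. x = h + Eta t" "\<exists>h\<in>HK k. \<exists>t\<in>Bsp n m. y = h + Eta t"
    then obtain h t h' t' where *: "h \<in> HK k" "t \<in> Bsp n m" "x = h + Eta t"
      "h' \<in> HK k" "t' \<in> Bsp n m" "y = h' + Eta t'" by blast
    then have "x + y = (h + h') + Eta (t + t')" by simp
    then show "\<exists>h\<in>HK k. \<exists>t\<in>Bsp n m. x + y = h + Eta t"
      using * spoly.subspace_add[OF subspace_HK] Bsp_add by blast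
  next
    fix c x assume "\<exists>h\<in>HK k. \<exists>t\<in>Bsp n m. x = h + Eta t"
    then obtain h t where *: "h \<in> HK k" "t \<in> Bsp n m" "x = h + Eta t" by blast
    then have "c \<odot> x = (c \<odot> h) + Eta (c \<odot> t)" by (simp add: spoly.scale_right_distrib)
    then show "\<exists>h\<in>HK k. \<exists>t\<in>Bsp n m. c \<odot> x = h + Eta t"
      using * spoly.subspace_scale[OF subspace_HK] Bsp_scale by blast
  qed
qed

section \<open>The contravariant form\<close>

text \<open>The signs make Mul v adjoint to Der (star v) up to twist_sign.\<close>

fun zeta :: "mode \<Rightarrow> complex" where
  "zeta (X i) = (if n2 < i then -1 else 1)"
| "zeta (Y i) = (if i \<le> n1 then -1 else 1)"
| "zeta (Th r) = 1"
| "zeta (Vt r) = -1"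

lemma zeta_square [simp]: "zeta z * zeta z = 1" "zeta z * (zeta z * c) = c"
  by (cases z; simp)+

lemma zeta_nonzero [simp]: "zeta z \<noteq> 0"
  by (cases z) auto

definition form_coeff :: "mono \<Rightarrow> complex" where
  "form_coeff \<mu> = (\<Prod>z\<in>Modes. zeta z ^ expo \<mu> z * fact (expo \<mu> z))"

lemma form_coeff_nonzero: "form_coeff \<mu> \<noteq> 0"
  by (simp add: form_coeff_def)

lemma form_coeff_inc:
  assumes "z \<in> Modes" "free z \<mu>"
  shows "form_coeff (inc z \<mu>) = form_coeff \<mu> * zeta z * of_nat (expo \<mu> z + 1)"
proof -
  have "(\<Prod>w\<in>Modes - {z}. zeta w ^ expo (inc z \<mu>) w * fact (expo (inc z \<mu>) w)) =
      (\<Prod>w\<in>Modes - {z}. zeta w ^ expo \<mu> w * fact (expo \<mu> w))"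
    by (rule prod.cong) (auto simp: expo_inc)
  moreover have "expo (inc z \<mu>) z = expo \<mu> z + 1"
    using assms(2) by (auto simp: expo_inc free_def)
  ultimately show ?thesis
    using assms(1) by (simp add: form_coeff_def prod.remove[of Modes z] algebra_simps)
qed

text \<open>Bilinear, without conjugation, so that adjoints carry only signs. Summing over the
  support of the first argument makes linearity in the second one immediate; linearity in the first
  comes from symmetry on \<open>Bsp n m\<close>.\<close>

definition form :: "spoly \<Rightarrow> spoly \<Rightarrow> complex" where
  "form p q = (\<Sum>\<mu> | p \<mu> \<noteq> 0. form_coeff \<mu> * p \<mu> * q \<mu>)"

lemma form_superset:
  assumes "finite S" "{\<mu>. p \<mu> \<noteq> 0} \<subseteq> S"
  shows "form p q = (\<Sum>\<mu>\<in>S. form_coeff \<mu> * p \<mu> * q \<mu>)"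
  unfolding form_def by (rule sum.mono_neutral_left) (use assms in auto)

lemma form_sym:
  assumes "p \<in> Bsp n m" "q \<in> Bsp n m"
  shows "form p q = form q p"
proof -
  define S where "S = {\<mu>. p \<mu> \<noteq> 0} \<union> {\<mu>. q \<mu> \<noteq> 0}"
  have "finite S" "{\<mu>. p \<mu> \<noteq> 0} \<subseteq> S" "{\<mu>. q \<mu> \<noteq> 0} \<subseteq> S"
    using assms Bsp_finite by (auto simp: S_def)
  then show ?thesis by (simp add: form_superset mult_ac)
qed

lemma form_add_right [simp]: "form p (q + r) = form p q + form p r"
  by (simp add: pointwise form_def sum.distrib algebra_simps)

lemma form_scale_right [simp]: "form p (c \<odot> q) = c * form p q"
  by (simp add: pointwise form_def sum_distrib_left mult_ac)

lemma form_zero_right [simp]: "form p 0 = 0"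
  by (simp add: pointwise form_def)

lemma form_neg_right [simp]: "form p (- q) = - form p q"
  by (simp add: pointwise form_def sum_negf)

lemma form_diff_right [simp]: "form p (q - r) = form p q - form p r"
  by (simp add: pointwise form_def sum_subtractf algebra_simps)

lemma form_sum_right: "form p (sum f I) = (\<Sum>i\<in>I. form p (f i))"
  by (induction I rule: infinite_finite_induct) auto

lemma form_creat:
  assumes "p \<in> Bsp n m" "z \<in> Modes"
  shows "form (creat z p) q = zeta z * form p (annih z q)"
proof -
  let ?S = "{\<nu>. p \<nu> \<noteq> 0 \<and> free z \<nu>}"
  have fin: "finite ?S" using Bsp_finite[OF assms(1)] by simp
  have inj: "inj_on (inc z) ?S" by (rule inj_on_inverseI[of _ "dec z"]) (simp add: dec_inc)
  have sub: "{\<mu>. creat z p \<mu> \<noteq> 0} \<subseteq> inc z ` ?S"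
  proof
    fix \<mu> assume "\<mu> \<in> {\<mu>. creat z p \<mu> \<noteq> 0}"
    then have "p (dec z \<mu>) \<noteq> 0" "0 < expo \<mu> z" by (auto simp: creat_apply split: if_splits)
    then show "\<mu> \<in> inc z ` ?S"
      by (intro image_eqI[of _ _ "dec z \<mu>"]) (simp_all add: inc_dec free_dec)
  qed
  have "form (creat z p) q = (\<Sum>\<mu>\<in>inc z ` ?S. form_coeff \<mu> * creat z p \<mu> * q \<mu>)"
    by (rule form_superset) (use fin sub in auto)
  also have "\<dots> = (\<Sum>\<nu>\<in>?S. form_coeff (inc z \<nu>) * creat z p (inc z \<nu>) * q (inc z \<nu>))"
    using inj by (simp add: sum.reindex)
  also have "\<dots> = (\<Sum>\<nu>\<in>?S. zeta z * (form_coeff \<nu> * p \<nu> * annih z q \<nu>))"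
  proof (rule sum.cong[OF refl])
    fix \<nu> assume "\<nu> \<in> ?S"
    then have f: "free z \<nu>" by simp
    then have "0 < expo (inc z \<nu>) z" by (simp add: expo_inc)
    then show "form_coeff (inc z \<nu>) * creat z p (inc z \<nu>) * q (inc z \<nu>) = zeta z * (form_coeff \<nu> * p \<nu> * annih z q \<nu>)"
      using f assms(2) by (simp add: form_coeff_inc creat_apply annih_apply dec_inc mono_sign_inc_self mult_ac)
  qed
  also have "\<dots> = (\<Sum>\<nu> | p \<nu> \<noteq> 0. zeta z * (form_coeff \<nu> * p \<nu> * annih z q \<nu>))"
    by (rule sum.mono_neutral_left) (use Bsp_finite[OF assms(1)] in \<open>auto simp: annih_apply\<close>)
  finally show ?thesis by (simp add: form_def sum_distrib_left)
qed

lemma form_annih: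
  assumes "p \<in> Bsp n m" "q \<in> Bsp n m" "z \<in> Modes"
  shows "form (annih z p) q = zeta z * form p (creat z q)"
  using form_creat[OF assms(2,3), of p] form_sym[of "annih z p" q] form_sym[of p "creat z q"] assms by simp

definition twist_sign :: "mode \<Rightarrow> complex" where
  "twist_sign v = (if twisted v \<or> twisted (star v) then -1 else 1)"

lemma twist_sign_star [simp]: "twist_sign (star v) = twist_sign v"
  by (auto simp: twist_sign_def)

lemma twist_sign_square [simp]: "twist_sign v * twist_sign v = 1" "twist_sign v * (twist_sign v * c) = c"
  by (auto simp: twist_sign_def)

lemma form_Mul:
  assumes "p \<in> Bsp n m" "q \<in> Bsp n m" "v \<in> Modes"
  shows "form (Mul v p) q = twist_sign v * form p (Der (star v) q)"
proof (cases "twisted v")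
  case True
  then have "zeta v = 1" using n1_n2 by (cases v) auto
  then show ?thesis using True form_annih[OF assms] by (simp add: Mul_def Der_def der_sign_def twist_sign_def)
next
  case False
  \<comment> \<open>This equation determines \<open>zeta\<close> on the untwisted modes.\<close>
  then have "zeta v = twist_sign v * kappa (star v)" using assms(3) n1_n2 by (cases v) (auto simp: twist_sign_def)
  then show ?thesis using False form_creat[OF assms(1,3)] by (simp add: Mul_def Der_def der_sign_def)
qed

lemma form_Der:
  assumes "p \<in> Bsp n m" "q \<in> Bsp n m" "v \<in> Modes"
  shows "form (Der v p) q = twist_sign v * form p (Mul (star v) q)"
  using form_Mul[of q p "star v"] form_sym[of q "Der v p"] form_sym[of p "Mul (star v) q"] assms by simp

lemma form_diff_left:
  assumes "p \<in> Bsp n m" "q \<in> Bsp n m" "r \<in> Bsp n m"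
  shows "form (p - q) r = form p r - form q r"
  using form_sym[of "p - q" r] form_sym[of p r] form_sym[of q r] assms by simp

lemma form_add_left:
  assumes "p \<in> Bsp n m" "q \<in> Bsp n m" "r \<in> Bsp n m"
  shows "form (p + q) r = form p r + form q r"
  using form_sym[of "p + q" r] form_sym[of p r] form_sym[of q r] assms by simp

lemma form_scale_left:
  assumes "p \<in> Bsp n m" "r \<in> Bsp n m"
  shows "form (c \<odot> p) r = c * form p r"
  using form_sym[of "c \<odot> p" r] form_sym[of p r] assms by simp

text \<open>The adjoint of an operator of the algebra is, up to sign, again one; hence orthogonal
  complements of submodules are submodules.\<close>

lemma form_osp_op:
  assumes "p \<in> Bsp n m" "q \<in> Bsp n m" "v \<in> Modes" "w \<in> Modes"
  shows "form (osp_op v w p) q = twist_sign v * twist_sign w * form p (osp_op (star w) (star v) q)"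
  unfolding osp_op_def
  by (simp add: assms form_diff_left form_scale_left form_Mul form_Der swap_sign_sym algebra_simps)

text \<open>The twist signs of \<open>v\<close> and \<open>star v\<close> agree and cancel in each
  quadratic term, so the adjunction is exact and harmonics are orthogonal to the image of
  \<open>Eta\<close>.\<close>

lemma form_Lap:
  assumes "p \<in> Bsp n m" "q \<in> Bsp n m"
  shows "form p (Lap q) = form (Eta p) q"
proof -
  have "form p (Lap q) = (\<Sum>v\<in>Modes. kappa v * form p (Der (star v) (Der v q)))"
    by (simp add: Lap_def form_sum_right)
  also have "\<dots> = (\<Sum>v\<in>Modes. kappa v * form (Mul (star v) (Mul v p)) q)"
    by (rule sum.cong) (simp_all add: assms form_Mul)
  also have "\<dots> = form q (Eta p)"
    unfolding Eta_def form_sum_right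
    by (rule sum.cong) (use assms form_sym in \<open>auto\<close>)
  also have "\<dots> = form (Eta p) q" using assms by (simp add: form_sym)
  finally show ?thesis .
qed

lemma form_single: "p \<in> Bsp n m \<Longrightarrow> form p (single \<mu>) = form_coeff \<mu> * p \<mu>"
proof -
  assume p: "p \<in> Bsp n m"
  have "form p (single \<mu>) = (\<Sum>\<nu>\<in>insert \<mu> {\<nu>. p \<nu> \<noteq> 0}. form_coeff \<nu> * p \<nu> * single \<mu> \<nu>)"
    by (rule form_superset) (use Bsp_finite[OF p] in auto)
  also have "\<dots> = (\<Sum>\<nu>\<in>insert \<mu> {\<nu>. p \<nu> \<noteq> 0}. if \<nu> = \<mu> then form_coeff \<mu> * p \<mu> else 0)"
    by (rule sum.cong) (auto simp: single_def)
  also have "\<dots> = form_coeff \<mu> * p \<mu>" using Bsp_finite[OF p] by (subst sum.delta) auto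
  finally show ?thesis .
qed

section \<open>Weights and finiteness of weight spaces\<close>

definition weight :: "nat \<Rightarrow> mono \<Rightarrow> int" where
  "weight i \<mu> = deg_coeff (X i) * int (expo \<mu> (X i)) - deg_coeff (Y i) * int (expo \<mu> (Y i))"

text \<open>The operators \<open>osp_op (X i) (Y i)\<close> with 1 \<le> i \<le> n form a Cartan
  subalgebra of the orthogonal part; \<open>weight i\<close> is the eigenvalue freed of its
  constant.\<close>

lemma osp_op_XY_diag:
  assumes "p \<in> Bsp n m" "1 \<le> i"
  shows "osp_op (X i) (Y i) p \<mu> = of_int (weight i \<mu> + (number_shift (X i) - number_shift (Y i))) * p \<mu>"
proof -
  have "Der (Y i) (Mul (X i) p) = Mul (X i) (Der (Y i) p) + p" "Der (X i) (Mul (Y i) p) = Mul (Y i) (Der (X i) p) + p"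
    using Der_Mul[OF assms(1), of "Y i" "X i"] Der_Mul[OF assms(1), of "X i" "Y i"] assms(2)
    by (simp_all add: pairing_def swap_sign_def)
  then have "osp_op (X i) (Y i) p = Der (Y i) (Mul (X i) p) - Der (X i) (Mul (Y i) p)"
    by (simp add: osp_op_def swap_sign_def)
  moreover have "Der (Y i) (Mul (X i) p) \<mu> = of_int (number_ev (X i) \<mu>) * p \<mu>"
    "Der (X i) (Mul (Y i) p) \<mu> = of_int (number_ev (Y i) \<mu>) * p \<mu>"
    using number_ev_apply[of "X i" p \<mu>] number_ev_apply[of "Y i" p \<mu>] assms(2) by simp_all
  ultimately show ?thesis by (simp add: number_ev_eq weight_def pointwise left_diff_distrib)
      (simp add: algebra_simps)
qed

definition osp_sub :: "spoly set \<Rightarrow> bool" where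
  "osp_sub U \<longleftrightarrow> spoly.subspace U \<and> U \<subseteq> Bsp n m \<and> (\<forall>v\<in>Modes. \<forall>w\<in>Modes. \<forall>p\<in>U. osp_op v w p \<in> U)"

lemma restrict_weight_mem:
  assumes U: "osp_sub U" and p: "p \<in> U"
  shows "restrict (\<lambda>\<mu>. \<forall>i\<in>{1..n}. weight i \<mu> = lam i) p \<in> U"
proof -
  have "restrict (\<lambda>\<mu>. \<forall>i\<in>{1..j}. weight i \<mu> = lam i) p \<in> U" if "j \<le> n" for j
    using that
  proof (induction j)
    case 0
    then show ?case using p by (simp add: restrict_def)
  next
    case (Suc j)
    let ?q = "restrict (\<lambda>\<mu>. \<forall>i\<in>{1..j}. weight i \<mu> = lam i) p"
    let ?e = "number_shift (X (Suc j)) - number_shift (Y (Suc j))"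
    let ?f = "\<lambda>\<mu>. of_int (weight (Suc j) \<mu> + ?e) :: complex"
    have q: "?q \<in> U" using Suc by simp
    then have "finite {\<mu>. ?q \<mu> \<noteq> 0}" using U Bsp_finite by (auto simp: osp_sub_def)
    then have "restrict (\<lambda>\<mu>. ?f \<mu> = of_int (lam (Suc j) + ?e)) ?q \<in> U"
      using U Suc.prems osp_op_XY_diag q
      by (intro restrict_diag_mem[where h = "osp_op (X (Suc j)) (Y (Suc j))"]) (auto simp: osp_sub_def)
    moreover have "restrict (\<lambda>\<mu>. ?f \<mu> = of_int (lam (Suc j) + ?e)) ?q =
        restrict (\<lambda>\<mu>. \<forall>i\<in>{1..Suc j}. weight i \<mu> = lam i) p"
      unfolding of_int_eq_iff by (auto simp: restrict_def fun_eq_iff pointwise le_Suc_eq)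
    ultimately show ?case by simp
  qed
  then show ?thesis by simp
qed

text \<open>Gradings that are combinations of weights: Mul v and Der v shift them by the same amount.\<close>

definition weight_coeff :: "(nat \<Rightarrow> int) \<Rightarrow> mode \<Rightarrow> int" where
  "weight_coeff t v = (case v of
      X i \<Rightarrow> if i = 0 then 0 else t i * deg_coeff (X i)
    | Y i \<Rightarrow> - (t i * deg_coeff (Y i))
    | _ \<Rightarrow> 0)"

lemma grade_weight_coeff: "grade (weight_coeff t) \<mu> = (\<Sum>i\<in>{1..n}. t i * weight i \<mu>)"
proof -
  have "(\<Sum>i\<in>{1..n}. weight_coeff t (X i) * int (expo \<mu> (X i)) + weight_coeff t (Y i) * int (expo \<mu> (Y i))) =
      (\<Sum>i\<in>{1..n}. t i * weight i \<mu>)"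
    by (rule sum.cong) (auto simp: weight_coeff_def weight_def algebra_simps)
  then show ?thesis by (simp add: grade_def sum_Modes weight_coeff_def)
qed

lemma grade_weight_coeff_cong: "(\<And>i. i \<in> {1..n} \<Longrightarrow> weight i \<mu> = weight i \<nu>) \<Longrightarrow> grade (weight_coeff t) \<mu> = grade (weight_coeff t) \<nu>"
  unfolding grade_weight_coeff by (rule sum.cong) auto

lemma finite_bounded_monos: "finite {\<mu>. valid \<mu> \<and> grade (\<lambda>_. 1) \<mu> \<le> K}"
proof -
  let ?F = "{f. \<forall>v. (v \<in> Modes \<longrightarrow> f v \<in> {..nat K}) \<and> (v \<notin> Modes \<longrightarrow> f v = (0::nat))}"
  have "finite ?F" by (rule finite_set_of_finite_funs) auto
  moreover have "expo ` {\<mu>. valid \<mu> \<and> grade (\<lambda>_. 1) \<mu> \<le> K} \<subseteq> ?F"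
  proof safe
    fix \<mu> v assume *: "valid \<mu>" "grade (\<lambda>_. 1) \<mu> \<le> K" "v \<in> Modes"
    have "int (expo \<mu> v) \<le> grade (\<lambda>_. 1) \<mu>"
      unfolding grade_def using *(3) member_le_sum[of v Modes "\<lambda>v. int (expo \<mu> v)"] by simp
    then show "expo \<mu> v \<le> nat K" using *(2) by linarith
  next
    fix \<mu> v assume "valid \<mu>" "v \<notin> Modes"
    then show "expo \<mu> v = 0" unfolding valid_def by blast
  qed
  moreover have "inj_on expo A" for A
    by (rule inj_onI) (metis mono_eqI)
  ultimately show ?thesis by (meson finite_imageD finite_subset)
qed

text \<open>Degree alone does not bound a monomial, since twisted variables count negatively. A
  suitable combination of degree and weights gives every mode a coefficient of at least 1 and so
  bounds the total degree.\<close>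

lemma finite_weight_space:
  "finite {\<mu>. valid \<mu> \<and> grade deg_coeff \<mu> = k \<and> (\<forall>i\<in>{1..n}. weight i \<mu> = lam i)}"
proof -
  \<comment> \<open>After adding \<open>deg_coeff\<close>, twisted modes get coefficient 1, their
    duals get 3, and all other modes keep 1.\<close>
  define t where "t i = (if i \<le> n1 then -2 else if n2 < i then 2 else 0 :: int)" for i
  define K where "K = k + (\<Sum>i\<in>{1..n}. t i * lam i)"
  have "grade (\<lambda>_. 1) \<mu> \<le> grade deg_coeff \<mu> + grade (weight_coeff t) \<mu>" for \<mu>
  proof -
    have "1 \<le> deg_coeff v + weight_coeff t v" if "v \<in> Modes" for v
      using that n1_n2 by (cases v) (auto simp: deg_coeff_def weight_coeff_def t_def)
    then show ?thesis
      unfolding grade_def sum.distrib[symmetric] distrib_right[symmetric]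
      by (intro sum_mono mult_right_mono) auto
  qed
  then have "{\<mu>. valid \<mu> \<and> grade deg_coeff \<mu> = k \<and> (\<forall>i\<in>{1..n}. weight i \<mu> = lam i)}
      \<subseteq> {\<mu>. valid \<mu> \<and> grade (\<lambda>_. 1) \<mu> \<le> K}"
    unfolding K_def grade_weight_coeff by (auto simp: le_fun_def) (smt (verit) sum.cong atLeastAtMost_iff)
  then show ?thesis using finite_bounded_monos finite_subset by blast
qed

end

declare creat.simps [simp del] annih.simps [simp del] split_paired_All [simp del] split_paired_Ex [simp del]

lemma creat_single: "\<not> odd_mode v \<Longrightarrow> creat v (single \<mu>) = single (inc v \<mu>)"
proof
  fix \<nu> assume v: "\<not> odd_mode v"
  then have sg1: "mono_sign v \<kappa> = 1" for \<kappa> by (cases v) auto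
  have "0 < expo \<nu> v \<and> dec v \<nu> = \<mu> \<longleftrightarrow> \<nu> = inc v \<mu>"
    using v inc_dec[of \<nu> v] dec_inc[of v \<mu>] by (auto simp: free_def expo_inc)
  then show "creat v (single \<mu>) \<nu> = single (inc v \<mu>) \<nu>"
    by (auto simp: creat_apply single_def sg1)
qed

lemma annih_single: "\<not> odd_mode v \<Longrightarrow> annih v (single \<mu>) = of_nat (expo \<mu> v) \<odot> single (dec v \<mu>)"
proof
  fix \<nu> assume v: "\<not> odd_mode v"
  then have sg1: "mono_sign v \<nu> = 1" by (cases v) auto
  have "free v \<nu>" using v by (simp add: free_def)
  moreover have "inc v \<nu> = \<mu> \<Longrightarrow> expo \<mu> v = expo \<nu> v + 1" using v by (auto simp: expo_inc)
  moreover have "expo \<mu> v \<noteq> 0 \<Longrightarrow> inc v \<nu> = \<mu> \<longleftrightarrow> \<nu> = dec v \<mu>"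
    using inc_dec[of \<mu> v] dec_inc[OF \<open>free v \<nu>\<close>] by auto
  ultimately show "annih v (single \<mu>) \<nu> = (of_nat (expo \<mu> v) \<odot> single (dec v \<mu>)) \<nu>"
    by (cases "expo \<mu> v = 0") (auto simp: annih_apply single_def sg1 pointwise)
qed

lemma annih_single_0: "expo \<mu> v = 0 \<Longrightarrow> annih v (single \<mu>) = 0"
proof
  fix \<nu> assume "expo \<mu> v = 0"
  then have "inc v \<nu> \<noteq> \<mu>" using expo_inc[of v \<nu> v] by (metis add_is_0 zero_neq_one)
  then show "annih v (single \<mu>) \<nu> = 0 \<nu>" by (simp add: pointwise annih_apply single_def)
qed

lemma separating_functional:
  assumes "spoly.subspace U" "g \<notin> U"
  obtains \<phi> :: "spoly \<Rightarrow> complex" where "\<And>p q. \<phi> (p + q) = \<phi> p + \<phi> q" "\<And>c p. \<phi> (c \<odot> p) = c * \<phi> p"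
    "\<And>u. u \<in> U \<Longrightarrow> \<phi> u = 0" "\<phi> g = 1"
proof -
  interpret vp: vector_space_pair psmult "(*) :: complex \<Rightarrow> complex \<Rightarrow> complex"
    by unfold_locales (auto simp: algebra_simps)
  obtain B where B: "spoly.independent B" "spoly.span B = U" "B \<subseteq> U"
    using spoly.basis_exists[of U] assms(1) spoly.span_subspace by metis
  then have "spoly.independent (insert g B)"
    using assms(2) by (intro spoly.independent_insertI) auto
  from vp.linear_independent_extend[OF this, of "\<lambda>x. if x = g then 1 else 0"]
  obtain \<phi> where \<phi>: "Vector_Spaces.linear psmult (*) \<phi>"
    "\<forall>x\<in>insert g B. \<phi> x = (if x = g then 1 else 0)" by blast
  then interpret \<phi>: Vector_Spaces.linear psmult "(*)" \<phi> by simp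
  have "\<phi> u = 0" if "u \<in> U" for u
  proof (rule \<phi>.eq_0_on_span)
    show "u \<in> spoly.span B" using that B(2) by simp
    show "\<phi> x = 0" if "x \<in> B" for x using \<phi>(2) that B(3) assms(2) by auto
  qed
  then show thesis using that[of \<phi>] \<phi>(2) \<phi>.add \<phi>.scale by auto
qed

context oscillator
begin

section \<open>Vectors of minimal depth\<close>

text \<open>Mul w for w in Iso is the derivative by a twisted variable or multiplication by x_{n1+1}. These
  modes span an isotropic subspace, and Rest spans a complement of it in its orthogonal space.\<close>

definition Iso :: "mode set" where
  "Iso = X ` {1..n1+1} \<union> Y ` {n2+1..n}"

definition Rest :: "mode set" where
  "Rest = Modes - Iso - star ` Iso"

lemma Iso_simps [simp]:
  "X i \<in> Iso \<longleftrightarrow> 1 \<le> i \<and> i \<le> n1 + 1" "Y i \<in> Iso \<longleftrightarrow> n2 < i \<and> i \<le> n"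
  "Th r \<notin> Iso" "Vt r \<notin> Iso"
  by (auto simp: Iso_def)

lemma Iso_Modes: "w \<in> Iso \<Longrightarrow> w \<in> Modes"
  using n1_n2 n2_n by (cases w) auto

lemma Iso_even: "w \<in> Iso \<Longrightarrow> \<not> odd_mode w"
  by (cases w) auto

lemma star_Iso: "w \<in> Iso \<Longrightarrow> star w \<notin> Iso"
  using n1_n2 by (cases w) auto

lemma mem_star_Iso: "v \<in> star ` Iso \<longleftrightarrow> star v \<in> Iso"
  by (metis image_iff star_star)

lemma Rest_iff: "v \<in> Rest \<longleftrightarrow> v \<in> Modes \<and> v \<notin> Iso \<and> star v \<notin> Iso"
  by (auto simp: Rest_def mem_star_Iso)

lemma star_Rest: "star v \<in> Rest \<longleftrightarrow> v \<in> Rest"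
  by (auto simp: Rest_iff)

lemma twisted_Iso: "v \<in> Modes \<Longrightarrow> twisted v \<Longrightarrow> v \<in> Iso"
  by (cases v) auto

text \<open>Yields the parabolic grading attached to \<open>Iso\<close>: \<open>Mul v\<close>
  changes it by -1 for \<open>v\<close> in \<open>Iso\<close>, by 1 for the dual modes and by 0 on
  \<open>Rest\<close>. As a combination of weights it is constant on a weight vector.\<close>

definition depth_sign :: "nat \<Rightarrow> int" where
  "depth_sign i = (if i \<le> n1 + 1 then -1 else if n2 < i then 1 else 0)"

abbreviation "depth \<equiv> weight_coeff depth_sign"

lemma shift_weight_coeff_star: "v \<in> Modes \<Longrightarrow> shift (weight_coeff t) (star v) = - shift (weight_coeff t) v"
  by (cases v) (auto simp: shift_def weight_coeff_def deg_coeff_def)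

lemma shift_depth_Iso: "w \<in> Iso \<Longrightarrow> shift depth w = -1"
  using n1_n2 by (cases w) (auto simp: shift_def weight_coeff_def deg_coeff_def depth_sign_def)

lemma shift_depth_Rest: "v \<in> Rest \<Longrightarrow> shift depth v = 0"
  using n1_n2 by (cases v) (auto simp: Rest_iff shift_def weight_coeff_def deg_coeff_def depth_sign_def split: if_splits)

text \<open>The multiplicities with which the number operators enter the contraction below: star w
  contributes the same term as w.\<close>

definition iso_mult :: "mode \<Rightarrow> int" where
  "iso_mult v = (if v \<in> Iso then 2 else if v \<in> Rest then 1 else 0)"

text \<open>Identifies the scalar of the contraction, up to a constant, with degree minus depth, two
  quantities that are constant on a homogeneous weight vector.\<close>

lemma iso_mult_deg_coeff: "v \<in> Modes \<Longrightarrow> iso_mult v * deg_coeff v = deg_coeff v - depth v"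
  using n1_n2 by (cases v) (auto simp: Rest_iff iso_mult_def weight_coeff_def deg_coeff_def depth_sign_def split: if_splits)

lemma grade_iso_mult: "(\<Sum>v\<in>Modes. iso_mult v * deg_coeff v * int (expo \<mu> v)) = grade deg_coeff \<mu> - grade depth \<mu>"
  unfolding grade_def sum_subtractf[symmetric]
  by (rule sum.cong) (simp_all add: iso_mult_deg_coeff left_diff_distrib)

text \<open>On degree k the depth is at least -k, so a nonzero submodule has monomials of least
  depth even though it is infinite-dimensional.\<close>

lemma grade_depth_lower: "- grade deg_coeff \<mu> \<le> grade depth \<mu>"
proof -
  have "0 \<le> deg_coeff v + depth v" if "v \<in> Modes" for v
    using that n1_n2 by (cases v) (auto simp: deg_coeff_def weight_coeff_def depth_sign_def)
  then have "0 \<le> (\<Sum>v\<in>Modes. (deg_coeff v + depth v) * int (expo \<mu> v))"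
    by (intro sum_nonneg mult_nonneg_nonneg) auto
  then show ?thesis by (simp add: grade_def sum.distrib distrib_right)
qed

text \<open>Every dual pair contributes an even number; the self-dual \<open>X 0\<close> alone
  contributes 1.\<close>

lemma odd_sum_iso_mult_number_shift: "odd (\<Sum>v\<in>Modes. iso_mult v * number_shift v)"
proof -
  have "even (\<Sum>i\<in>{1..n}. iso_mult (X i) * number_shift (X i) + iso_mult (Y i) * number_shift (Y i))"
    by (rule dvd_sum) (use n1_n2 in \<open>auto simp: iso_mult_def Rest_iff number_shift_def\<close>)
  moreover have "even (\<Sum>r\<in>{1..m}. iso_mult (Th r) * number_shift (Th r) + iso_mult (Vt r) * number_shift (Vt r))"
    by (rule dvd_sum) (auto simp: iso_mult_def Rest_iff number_shift_def)
  moreover have "iso_mult (X 0) * number_shift (X 0) = 1"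
    by (simp add: iso_mult_def Rest_iff number_shift_def)
  ultimately show ?thesis unfolding sum_Modes by simp
qed

lemma osp_op_shift:
  assumes "osp_op v w p \<mu> \<noteq> 0" "v \<in> Modes" "w \<in> Modes"
  obtains \<nu> where "p \<nu> \<noteq> 0" "\<And>t. grade (weight_coeff t) \<mu> = grade (weight_coeff t) \<nu> + shift (weight_coeff t) v + shift (weight_coeff t) w"
proof -
  have *: "\<exists>\<nu>. p \<nu> \<noteq> 0 \<and> (\<forall>t. grade (weight_coeff t) \<mu> = grade (weight_coeff t) \<nu> + shift (weight_coeff t) v + shift (weight_coeff t) w)"
    if a: "Mul v (Der w p) \<mu> \<noteq> 0" "v \<in> Modes" "w \<in> Modes" for v w
  proof -
    obtain \<nu>1 where 1: "Der w p \<nu>1 \<noteq> 0" "\<And>c. grade c \<mu> = grade c \<nu>1 + shift c v"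
      using Mul_shift[OF a(1,2)] by blast
    obtain \<nu> where 2: "p \<nu> \<noteq> 0" "\<And>c. grade c \<nu>1 = grade c \<nu> - shift c (star w)"
      using Der_shift[OF 1(1) a(3)] by blast
    show ?thesis using 1(2) 2 shift_weight_coeff_star[OF a(3)] by (intro exI[of _ \<nu>]) simp
  qed
  have "Mul v (Der w p) \<mu> \<noteq> 0 \<or> Mul w (Der v p) \<mu> \<noteq> 0"
    using assms(1) by (auto simp: osp_op_def pointwise)
  then have "\<exists>\<nu>. p \<nu> \<noteq> 0 \<and> (\<forall>t. grade (weight_coeff t) \<mu> = grade (weight_coeff t) \<nu> + shift (weight_coeff t) v + shift (weight_coeff t) w)"
    using *[of v w] *[of w v] assms(2,3) by (auto simp: add_ac)
  then show thesis using that by blast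
qed

lemma osp_sub_minimal:
  assumes U: "osp_sub U" "U \<subseteq> HK k" "U \<noteq> {0}"
  obtains u \<mu>0 where "u \<in> U" "u \<noteq> 0"
    "\<forall>\<mu>. u \<mu> \<noteq> 0 \<longrightarrow> (\<forall>i\<in>{1..n}. weight i \<mu> = weight i \<mu>0)"
    "\<forall>w\<in>Iso. \<forall>v\<in>Iso \<union> Rest. osp_op w v u = 0"
proof -
  have sub: "spoly.subspace U" using U(1) by (simp add: osp_sub_def)
  then obtain p where p: "p \<in> U" "p \<noteq> 0" using U(3) spoly.subspace_0 by blast
  then obtain \<mu>1 where "p \<mu>1 \<noteq> 0" by (auto simp: fun_eq_iff pointwise)
  \<comment> \<open>Adding k makes the depth nonnegative, so \<open>nat\<close> loses nothing and
    \<open>LEAST\<close> applies.\<close>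
  define Q where "Q j \<longleftrightarrow> (\<exists>p\<in>U. \<exists>\<mu>. p \<mu> \<noteq> 0 \<and> j = nat (grade depth \<mu> + k))" for j
  have "\<exists>j. Q j" using p(1) \<open>p \<mu>1 \<noteq> 0\<close> unfolding Q_def by blast
  then have "Q (LEAST j. Q j)" by (rule LeastI_ex)
  then obtain p0 \<mu>0 where p0: "p0 \<in> U" "p0 \<mu>0 \<noteq> 0" "(LEAST j. Q j) = nat (grade depth \<mu>0 + k)"
    unfolding Q_def by blast
  have min: "grade depth \<mu>0 \<le> grade depth \<mu>" if "q \<in> U" "q \<mu> \<noteq> 0" for q \<mu>
  proof -
    have "Q (nat (grade depth \<mu> + k))" using that unfolding Q_def by blast
    then have "nat (grade depth \<mu>0 + k) \<le> nat (grade depth \<mu> + k)"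
      using Least_le[of Q] p0(3) by metis
    moreover have "- k \<le> grade depth \<mu>" "- k \<le> grade depth \<mu>0"
      using grade_depth_lower[of \<mu>] grade_depth_lower[of \<mu>0] BK_deg[OF HK_BK] U(2) that p0 by (metis subsetD)+
    ultimately show ?thesis by linarith
  qed
  \<comment> \<open>Projecting to the weight of \<mu>0 keeps the depth minimal on the whole support,
    because the depth is determined by the weights.\<close>
  define u where "u = restrict (\<lambda>\<mu>. \<forall>i\<in>{1..n}. weight i \<mu> = weight i \<mu>0) p0"
  have uU: "u \<in> U" unfolding u_def by (rule restrict_weight_mem[OF U(1) p0(1)])
  have "u \<mu>0 \<noteq> 0" using p0(2) by (simp add: u_def restrict_def)
  then have u0: "u \<noteq> 0" by (auto simp: pointwise)
  have uwt: "weight i \<mu> = weight i \<mu>0" if "u \<mu> \<noteq> 0" "i \<in> {1..n}" for \<mu> i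
    using that by (auto simp: u_def restrict_def split: if_splits)
  have low: "osp_op w v u = 0" if wv: "w \<in> Iso" "v \<in> Iso \<union> Rest" for w v
  proof (rule ccontr)
    assume "osp_op w v u \<noteq> 0"
    then obtain \<mu> where \<mu>: "osp_op w v u \<mu> \<noteq> 0" by (auto simp: fun_eq_iff pointwise)
    have Modes: "w \<in> Modes" "v \<in> Modes" using wv Iso_Modes Rest_iff by auto
    obtain \<nu> where \<nu>: "u \<nu> \<noteq> 0" "\<And>t. grade (weight_coeff t) \<mu> = grade (weight_coeff t) \<nu> + shift (weight_coeff t) w + shift (weight_coeff t) v"
      using osp_op_shift[OF \<mu> Modes] by blast
    have "shift depth w + shift depth v < 0"
      using wv shift_depth_Iso[of w] shift_depth_Iso[of v] shift_depth_Rest[of v] by auto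
    then have "grade depth \<mu> < grade depth \<nu>" using \<nu>(2)[of depth_sign] by simp
    moreover have "grade depth \<nu> = grade depth \<mu>0" by (rule grade_weight_coeff_cong) (use uwt \<nu>(1) in auto)
    moreover have "osp_op w v u \<in> U" using U(1) Modes uU by (auto simp: osp_sub_def)
    ultimately show False using min[of "osp_op w v u" \<mu>] \<mu> by linarith
  qed
  have "\<forall>\<mu>. u \<mu> \<noteq> 0 \<longrightarrow> (\<forall>i\<in>{1..n}. weight i \<mu> = weight i \<mu>0)"
    by (intro allI impI ballI) (rule uwt)
  moreover have "\<forall>w\<in>Iso. \<forall>v\<in>Iso \<union> Rest. osp_op w v u = 0"
    by (intro ballI) (rule low)
  ultimately show thesis by (rule that[OF uU u0])
qed

text \<open>The subtracted 2 stems from the commutator of \<open>Mul w\<close> with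
  \<open>Der (star w)\<close>, which occurs in \<open>Lap\<close> once at \<open>v = w\<close> and
  once at \<open>v = star w\<close>.\<close>

lemma contraction:
  assumes u: "u \<in> HK k"
    and L: "\<And>w v. w \<in> Iso \<Longrightarrow> v \<in> Iso \<union> Rest \<Longrightarrow> osp_op w v u = 0"
    and w: "w \<in> Iso"
  shows "of_int ((\<Sum>v\<in>Modes. iso_mult v * number_ev v \<mu>) - 2) * Der w u \<mu> = 0"
proof -
  have uB: "u \<in> Bsp n m" using u HK_Bsp by blast
  have wV: "w \<in> Modes" using w Iso_Modes by blast
  have ss1: "swap_sign w v = 1" "swap_sign v w = 1" for v using Iso_even[OF w] by (auto simp: swap_sign_def)
  have swap: "Mul w (Der v u) = Mul v (Der w u)" if "v \<in> Iso \<union> Rest" for v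
    using L[OF w that] by (simp add: osp_op_def ss1)
  have VD: "Mul w (Der (star v) (Der v u)) = Der (star v) (Mul w (Der v u)) - pairing (star v) w \<odot> Der v u" if "v \<in> Modes" for v
    using Der_Mul[of "Der v u" "star v" w] that uB by (simp add: ss1)
  have diag: "kappa v * Der (star v) (Mul v (Der w u)) \<mu> = of_int (number_ev v \<mu>) * Der w u \<mu>" for v
    by (rule number_ev_apply)
  have R: "(kappa v \<odot> Mul w (Der (star v) (Der v u))) \<mu> = of_int (number_ev v \<mu>) * Der w u \<mu>" if v: "v \<in> Rest" for v
  proof -
    have "v \<in> Modes" "pairing (star v) w = 0" using v w by (auto simp: Rest_iff pairing_def)
    then show ?thesis using VD[of v] swap[of v] v diag[of v] by (simp add: pointwise)
  qed
  have W1: "Mul w (Der (star v) (Der v u)) \<mu> = of_int (number_ev v \<mu>) * Der w u \<mu> - (if v = w then Der w u \<mu> else 0)"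
    if v: "v \<in> Iso" for v
  proof -
    have k: "kappa v = 1" "kappa (star v) = 1" using v by (cases v; simp)+
    then have "pairing (star v) w = (if v = w then 1 else 0)" by (auto simp: pairing_def)
    then show ?thesis using VD[of v] swap[of v] Iso_Modes[OF v] v diag[of v] k by (simp add: pointwise)
  qed
  \<comment> \<open>The condition on \<open>u\<close> says nothing about modes dual to
    \<open>Iso\<close>, but the two derivations commute, so the term of \<open>star v\<close> equals
    that of \<open>v\<close>.\<close>
  have WW: "(kappa v \<odot> Mul w (Der (star v) (Der v u))) \<mu> + (kappa (star v) \<odot> Mul w (Der (star (star v)) (Der (star v) u))) \<mu>
      = of_int (2 * number_ev v \<mu>) * Der w u \<mu> - (if v = w then 2 * Der w u \<mu> else 0)"
    if v: "v \<in> Iso" for v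
  proof -
    have k: "kappa v = 1" "kappa (star v) = 1" using v by (cases v; simp)+
    have "swap_sign v v = 1" using Iso_even[OF v] by (simp add: swap_sign_def)
    then have "Der (star (star v)) (Der (star v) u) = Der (star v) (Der v u)"
      using Der_Der[OF uB, of v "star v"] by simp
    then show ?thesis using W1[OF v] k by (simp add: pointwise)
  qed
  have split: "sum f Modes = sum f Rest + (\<Sum>v\<in>Iso. f v + f (star v))" for f :: "mode \<Rightarrow> complex"
  proof -
    have "Modes = Rest \<union> (Iso \<union> star ` Iso)" using Iso_Modes by (auto simp: Rest_def)
    moreover have "finite Rest" "finite Iso" by (auto simp: Rest_def Iso_def)
    moreover have "Rest \<inter> (Iso \<union> star ` Iso) = {}" by (auto simp: Rest_def)
    moreover have "Iso \<inter> star ` Iso = {}" using star_Iso by auto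
    moreover have "sum f (star ` Iso) = (\<Sum>v\<in>Iso. f (star v))"
      by (subst sum.reindex) (auto simp: inj_on_def)
    ultimately show ?thesis by (simp add: sum.union_disjoint sum.distrib)
  qed
  have mulsum: "(\<Sum>v\<in>Modes. iso_mult v * number_ev v \<mu>) = (\<Sum>v\<in>Rest. number_ev v \<mu>) + (\<Sum>v\<in>Iso. 2 * number_ev v \<mu>)"
  proof -
    have "(\<Sum>v\<in>Modes. of_int (iso_mult v * number_ev v \<mu>) :: complex) =
        (\<Sum>v\<in>Rest. of_int (number_ev v \<mu>)) + (\<Sum>v\<in>Iso. of_int (2 * number_ev v \<mu>))"
      unfolding split
    proof (intro arg_cong2[where f = "(+)"] sum.cong refl)
      show "of_int (iso_mult v * number_ev v \<mu>) = (of_int (number_ev v \<mu>) :: complex)" if "v \<in> Rest" for v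
        using that by (simp add: iso_mult_def Rest_iff)
      show "of_int (iso_mult v * number_ev v \<mu>) + of_int (iso_mult (star v) * number_ev (star v) \<mu>) = (of_int (2 * number_ev v \<mu>) :: complex)"
        if "v \<in> Iso" for v
        using that star_Iso[OF that] by (simp add: iso_mult_def Rest_iff)
    qed
    then have "(of_int (\<Sum>v\<in>Modes. iso_mult v * number_ev v \<mu>) :: complex) = of_int ((\<Sum>v\<in>Rest. number_ev v \<mu>) + (\<Sum>v\<in>Iso. 2 * number_ev v \<mu>))"
      by simp
    then show ?thesis by (simp only: of_int_eq_iff)
  qed
  have "0 = Mul w (Lap u) \<mu>" using u by (simp add: mem_HK pointwise)
  also have "\<dots> = (\<Sum>v\<in>Modes. (kappa v \<odot> Mul w (Der (star v) (Der v u))) \<mu>)"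
    by (simp add: Lap_def sum_fun_apply)
  also have "\<dots> = (\<Sum>v\<in>Rest. of_int (number_ev v \<mu>) * Der w u \<mu>) +
      (\<Sum>v\<in>Iso. of_int (2 * number_ev v \<mu>) * Der w u \<mu> - (if v = w then 2 * Der w u \<mu> else 0))"
    unfolding split using R WW by simp
  also have "(\<Sum>v\<in>Iso. of_int (2 * number_ev v \<mu>) * Der w u \<mu> - (if v = w then 2 * Der w u \<mu> else 0)) =
      (\<Sum>v\<in>Iso. of_int (2 * number_ev v \<mu>) * Der w u \<mu>) - 2 * Der w u \<mu>"
    using w by (simp add: sum_subtractf Iso_def)
  finally have "(\<Sum>v\<in>Rest. of_int (number_ev v \<mu>) * Der w u \<mu>) +
      ((\<Sum>v\<in>Iso. of_int (2 * number_ev v \<mu>) * Der w u \<mu>) - 2 * Der w u \<mu>) = 0" by simp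
  then show ?thesis
    unfolding mulsum of_int_diff of_int_add of_int_sum left_diff_distrib distrib_right sum_distrib_right
    by (simp add: add_diff_eq)
qed

abbreviation "mid \<equiv> Suc n1"

lemma mid_simps: "X mid \<in> Iso" "\<not> twisted (X mid)" "X mid \<in> Modes" "Y mid \<in> Modes" "\<not> twisted (Y mid)" "star (X mid) = Y mid" "Y mid \<notin> Iso"
  using n1_n2 n2_n by auto

text \<open>A monomial of the support with the largest degree in the variables dual to Iso is free of
  Rest variables: the raising condition for mid would otherwise produce a monomial of larger degree.\<close>

definition dual_coeff :: "mode \<Rightarrow> int" where
  "dual_coeff v = (if star v \<in> Iso then 1 else 0)"

lemma Der_nonzero_dec:
  assumes "u \<mu> \<noteq> 0" "0 < expo \<mu> (star v)" "\<not> twisted (star v)"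
  shows "Der v u (dec (star v) \<mu>) \<noteq> 0"
proof -
  have "free (star v) (dec (star v) \<mu>)" by (rule free_dec)
  moreover have "mono_sign v' \<nu> \<noteq> 0" for v' \<nu> using mono_sign_square[of v' \<nu>] by (metis mult_zero_left zero_neq_one)
  moreover have "(1 + of_nat x :: complex) \<noteq> 0" for x by (metis of_nat_Suc of_nat_eq_0_iff nat.simps(3))
  ultimately show ?thesis
    using assms by (simp add: Der_def der_sign_def annih_apply inc_dec pointwise)
qed

text \<open>Supplies the parity that makes the contraction scalar odd. In a monomial without
  \<open>Rest\<close> variables only \<open>Iso\<close> variables contribute to degree minus depth,
  each with multiplicity 2.\<close>

lemma even_degree_difference:
  assumes u: "u \<in> HK k" "u \<noteq> 0"
    and L: "\<And>w v. w \<in> Iso \<Longrightarrow> v \<in> Iso \<union> Rest \<Longrightarrow> osp_op w v u = 0"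
  obtains \<mu> where "u \<mu> \<noteq> 0" "even (grade deg_coeff \<mu> - grade depth \<mu>)"
proof -
  let ?S = "{\<mu>. u \<mu> \<noteq> 0}"
  have fin: "finite ?S" "?S \<noteq> {}"
    using Bsp_finite[OF HK_Bsp[OF u(1)]] u(2) by (auto simp: fun_eq_iff pointwise)
  then have "Max (grade dual_coeff ` ?S) \<in> grade dual_coeff ` ?S" by (intro Max_in) auto
  then obtain \<mu> where \<mu>: "u \<mu> \<noteq> 0" "grade dual_coeff \<mu> = Max (grade dual_coeff ` ?S)" by auto
  have max: "grade dual_coeff \<nu> \<le> grade dual_coeff \<mu>" if "u \<nu> \<noteq> 0" for \<nu>
    unfolding \<mu>(2) by (rule Max_ge) (use fin that in auto)
  have zero: "expo \<mu> z = 0" if z: "z \<in> Rest" for z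
  proof (rule ccontr)
    assume "expo \<mu> z \<noteq> 0"
    then have pos: "0 < expo \<mu> z" by simp
    let ?v = "star z"
    have v: "?v \<in> Rest" "?v \<in> Modes" "z \<in> Modes" using z star_Rest by (auto simp: Rest_iff)
    have "\<not> twisted z" using z twisted_Iso by (auto simp: Rest_iff)
    then have nz: "Der ?v u (dec z \<mu>) \<noteq> 0" using Der_nonzero_dec[of u \<mu> ?v] \<mu>(1) pos by simp
    \<comment> \<open>Trading the factor \<open>z\<close> for \<open>X mid\<close> gives a monomial
      in \<open>Mul (X mid) (Der ?v u)\<close>, hence in \<open>Mul ?v (Der (X mid) u)\<close>.
      There a factor \<open>Y mid\<close> has been differentiated away, so \<open>u\<close> contains
      a monomial with one more dual variable.\<close>
    let ?\<nu> = "inc (X mid) (dec z \<mu>)"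
    have free: "free (X mid) (dec z \<mu>)" by (simp add: free_def)
    have "Mul (X mid) (Der ?v u) ?\<nu> = Der ?v u (dec z \<mu>)"
      using dec_inc[OF free] by (simp add: Mul_def creat_apply expo_inc)
    moreover have "Mul (X mid) (Der ?v u) = Mul ?v (Der (X mid) u)"
      using L[OF mid_simps(1), of ?v] v(1) by (simp add: osp_op_def swap_sign_def)
    ultimately have "Mul ?v (Der (X mid) u) ?\<nu> \<noteq> 0" using nz by metis
    then obtain \<nu>1 where \<nu>1: "Der (X mid) u \<nu>1 \<noteq> 0" "\<And>c. grade c ?\<nu> = grade c \<nu>1 + shift c ?v"
      using Mul_shift[OF _ v(2)] by blast
    obtain \<nu> where \<nu>: "u \<nu> \<noteq> 0" "\<And>c. grade c \<nu>1 = grade c \<nu> - shift c (Y mid)"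
      using Der_shift[OF \<nu>1(1) mid_simps(3)] mid_simps(6) by metis
    have c: "shift dual_coeff ?v = 0" "shift dual_coeff (Y mid) = 1" "dual_coeff z = 0" "dual_coeff (X mid) = 0"
      using z n1_n2 star_Rest[of z] by (auto simp: shift_def dual_coeff_def Rest_iff)
    have "grade dual_coeff ?\<nu> = grade dual_coeff \<mu>"
      using grade_inc[OF mid_simps(3) free, of dual_coeff] grade_dec[OF v(3) pos, of dual_coeff] c by simp
    then have "grade dual_coeff \<nu> = grade dual_coeff \<mu> + 1"
      using \<nu>(2)[of dual_coeff] \<nu>1(2)[of dual_coeff] c by simp
    then show False using max[OF \<nu>(1)] by simp
  qed
  have "even (iso_mult v * deg_coeff v * int (expo \<mu> v))" for v
    using zero[of v] by (auto simp: iso_mult_def)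
  then have "even (grade deg_coeff \<mu> - grade depth \<mu>)"
    unfolding grade_iso_mult[symmetric] by (intro dvd_sum) auto
  then show thesis using that \<mu>(1) by blast
qed

section \<open>Lowest vectors are monomials\<close>

definition iso_mono :: "mono \<Rightarrow> bool" where
  "iso_mono \<mu> \<longleftrightarrow> (\<forall>v. v \<notin> Iso \<longrightarrow> expo \<mu> v = 0)"

lemma iso_mono_valid: "iso_mono \<mu> \<Longrightarrow> valid \<mu>"
  unfolding valid_def
proof (intro allI impI)
  fix v assume "iso_mono \<mu>" "expo \<mu> v \<noteq> 0"
  then have "v \<in> Iso" by (auto simp: iso_mono_def)
  then show "v \<in> Modes" by (rule Iso_Modes)
qed

lemma lowest_monomial:
  assumes U: "osp_sub U" "U \<subseteq> HK k" "U \<noteq> {0}"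
  obtains \<mu> where "iso_mono \<mu>" "grade deg_coeff \<mu> = k" "single \<mu> \<in> U"
proof -
  obtain u \<mu>0 where u: "u \<in> U" "u \<noteq> 0"
    and uwt': "\<forall>\<mu>. u \<mu> \<noteq> 0 \<longrightarrow> (\<forall>i\<in>{1..n}. weight i \<mu> = weight i \<mu>0)"
    and L': "\<forall>w\<in>Iso. \<forall>v\<in>Iso \<union> Rest. osp_op w v u = 0"
    by (rule osp_sub_minimal[OF U])
  have uwt: "weight i \<mu> = weight i \<mu>0" if "u \<mu> \<noteq> 0" "i \<in> {1..n}" for \<mu> i
    using uwt' that by blast
  have L: "osp_op w v u = 0" if "w \<in> Iso" "v \<in> Iso \<union> Rest" for w v
    using L' that by blast
  have uH: "u \<in> HK k" using u(1) U(2) by blast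
  note uB = HK_Bsp[OF uH]
  have udeg: "grade deg_coeff \<mu> = k" "grade depth \<mu> = grade depth \<mu>0" if "u \<mu> \<noteq> 0" for \<mu>
    using BK_deg[OF HK_BK[OF uH] that] grade_weight_coeff_cong[OF uwt[OF that]] by simp_all
  obtain \<mu>1 where "u \<mu>1 \<noteq> 0" "even (grade deg_coeff \<mu>1 - grade depth \<mu>1)"
    by (rule even_degree_difference[OF uH u(2) L])
  then have even: "even (k - grade depth \<mu>0)" using udeg by simp
  have DW: "Der w u = 0" if w: "w \<in> Iso" for w
  proof
    fix \<mu>
    show "Der w u \<mu> = 0 \<mu>"
    proof (rule ccontr)
      assume nz: "Der w u \<mu> \<noteq> 0 \<mu>"
      then have "Der w u \<mu> \<noteq> 0" by (simp add: pointwise)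
      then obtain \<nu> where \<nu>: "u \<nu> \<noteq> 0" "\<And>c. grade c \<mu> = grade c \<nu> - shift c (star w)"
        using Der_shift Iso_Modes[OF w] by blast
      \<comment> \<open>\<open>Der w\<close> lowers degree and depth by 1 each, so their difference,
        already known to be even for \<open>u\<close>, is unchanged.\<close>
      have "shift deg_coeff (star w) = 1" by (simp add: shift_def deg_coeff_def)
      moreover have "shift depth (star w) = 1" using shift_weight_coeff_star[OF Iso_Modes[OF w]] shift_depth_Iso[OF w] by simp
      ultimately have "grade deg_coeff \<mu> - grade depth \<mu> = k - grade depth \<mu>0"
        using \<nu> udeg[OF \<nu>(1)] by simp
      moreover have "(\<Sum>v\<in>Modes. iso_mult v * number_ev v \<mu>) = (grade deg_coeff \<mu> - grade depth \<mu>) + (\<Sum>v\<in>Modes. iso_mult v * number_shift v)"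
        unfolding grade_iso_mult[symmetric] sum.distrib[symmetric]
        by (rule sum.cong) (simp_all add: number_ev_eq distrib_left)
      ultimately have "odd ((\<Sum>v\<in>Modes. iso_mult v * number_ev v \<mu>) - 2)"
        using even odd_sum_iso_mult_number_shift by simp
      then have "(\<Sum>v\<in>Modes. iso_mult v * number_ev v \<mu>) - 2 \<noteq> 0" by presburger
      then show False
        using contraction[OF uH L w, of \<mu>] \<open>Der w u \<mu> \<noteq> 0\<close>
        by (auto simp only: of_int_eq_0_iff mult_eq_0_iff)
    qed
  qed
  have DR: "Der v u = 0" if v: "v \<in> Rest" for v
  proof
    fix \<mu>
    have "Mul (X mid) (Der v u) = Mul v (Der (X mid) u)"
      using L[OF mid_simps(1), of v] v by (simp add: osp_op_def swap_sign_def)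
    also have "\<dots> = 0" using DW[OF mid_simps(1)] by simp
    finally have "Mul (X mid) (Der v u) (inc (X mid) \<mu>) = 0" by (simp add: pointwise)
    moreover have "Mul (X mid) (Der v u) (inc (X mid) \<mu>) = Der v u \<mu>"
      using dec_inc[of "X mid" \<mu>] by (simp add: Mul_def creat_apply expo_inc free_def)
    ultimately show "Der v u \<mu> = 0 \<mu>" by (simp add: pointwise)
  qed
  have supp: "iso_mono \<mu>" if \<mu>: "u \<mu> \<noteq> 0" for \<mu>
    unfolding iso_mono_def
  proof (intro allI impI)
    fix v assume v: "v \<notin> Iso"
    show "expo \<mu> v = 0"
    proof (rule ccontr)
      assume nz: "expo \<mu> v \<noteq> 0"
      then have vV: "v \<in> Modes" using Bsp_valid[OF uB \<mu>] unfolding valid_def by blast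
      then have "\<not> twisted v" using v twisted_Iso by blast
      then have "Der (star v) u (dec v \<mu>) \<noteq> 0"
        using Der_nonzero_dec[of u \<mu> "star v"] \<mu> nz by simp
      moreover have "star v \<in> Iso \<union> Rest" using v vV by (auto simp: Rest_iff)
      ultimately show False using DW[of "star v"] DR[of "star v"] by (auto simp: pointwise)
    qed
  qed
  obtain \<mu> where \<mu>: "u \<mu> \<noteq> 0" using u(2) by (auto simp: fun_eq_iff pointwise)
  \<comment> \<open>No two modes of \<open>Iso\<close> are dual to each other, so in
    \<open>weight i\<close> at most one exponent survives and the weights determine the
    monomial.\<close>
  have uniq: "\<nu> = \<mu>" if \<nu>: "u \<nu> \<noteq> 0" for \<nu>
  proof (rule mono_eqI)
    fix v
    show "expo \<nu> v = expo \<mu> v"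
    proof (cases "v \<in> Iso")
      case False
      then show ?thesis using supp[OF \<mu>] supp[OF \<nu>] by (simp add: iso_mono_def)
    next
      case True
      then obtain i where i: "v = X i \<or> v = Y i" "i \<in> {1..n}"
        using n1_n2 n2_n by (cases v) auto
      have "star v \<notin> Iso" using star_Iso[OF True] .
      then have "expo \<mu> (star v) = 0" "expo \<nu> (star v) = 0"
        using supp[OF \<mu>] supp[OF \<nu>] by (auto simp: iso_mono_def)
      moreover have "weight i \<nu> = weight i \<mu>" using uwt[OF \<mu> i(2)] uwt[OF \<nu> i(2)] by simp
      ultimately show ?thesis using i by (auto simp: weight_def deg_coeff_def split: if_splits)
    qed
  qed
  have "single \<mu> = inverse (u \<mu>) \<odot> u"
  proof
    fix \<nu>
    show "single \<mu> \<nu> = (inverse (u \<mu>) \<odot> u) \<nu>"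
      using uniq[of \<nu>] \<mu> by (cases "\<nu> = \<mu>") (auto simp add: pointwise single_def)
  qed
  then have "single \<mu> \<in> U"
    using u(1) U(1) by (simp add: osp_sub_def spoly.subspace_scale)
  then show thesis by (rule that[OF supp[OF \<mu>] udeg(1)[OF \<mu>]])
qed

section \<open>A monomial common to all nonzero submodules\<close>

definition canonical_mono :: "int \<Rightarrow> mono" where
  "canonical_mono k = ((\<lambda>_. 0)(1 := nat (- k), mid := nat k), \<lambda>_. 0, {}, {})"

lemma expo_canonical_mono: "expo (canonical_mono k) v = (if v = X 1 then nat (- k) else if v = X mid then nat k else 0)"
  using n1_pos by (cases v) (auto simp: canonical_mono_def)

lemma iso_mono_canonical_mono: "iso_mono (canonical_mono k)"
  using n1_pos by (auto simp: iso_mono_def expo_canonical_mono)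

lemma grade_canonical_mono:
  assumes "\<And>v. v \<noteq> X 1 \<Longrightarrow> v \<noteq> X mid \<Longrightarrow> expo \<mu> v = 0"
  shows "grade deg_coeff \<mu> = int (expo \<mu> (X mid)) - int (expo \<mu> (X 1))"
proof -
  have ne: "X 1 \<noteq> X mid" "X 1 \<in> Modes" using n1_pos n1_n2 n2_n by auto
  have "grade deg_coeff \<mu> = (\<Sum>v\<in>{X 1, X mid}. deg_coeff v * int (expo \<mu> v))"
    unfolding grade_def by (rule sum.mono_neutral_right) (use assms ne mid_simps(3) in auto)
  then show ?thesis using ne n1_pos by (simp add: deg_coeff_def)
qed

lemma grade_deg_coeff_canonical_mono: "grade deg_coeff (canonical_mono k) = k"
proof -
  have "grade deg_coeff (canonical_mono k) = int (expo (canonical_mono k) (X mid)) - int (expo (canonical_mono k) (X 1))"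
    by (rule grade_canonical_mono) (simp add: expo_canonical_mono)
  then show ?thesis using n1_pos by (simp add: expo_canonical_mono)
qed

lemma Der_single_0:
  assumes "iso_mono \<mu>" "v \<in> Iso \<union> Rest"
  shows "Der v (single \<mu>) = 0"
proof -
  have "star v \<notin> Iso" "star v \<in> Modes" using assms(2) star_Iso Iso_Modes by (auto simp: Rest_iff)
  then have "\<not> twisted (star v)" "expo \<mu> (star v) = 0" using twisted_Iso assms(1) by (auto simp: iso_mono_def)
  then show ?thesis by (simp add: Der_def annih_single_0)
qed

lemma single_BK: "valid \<mu> \<Longrightarrow> grade deg_coeff \<mu> = k \<Longrightarrow> single \<mu> \<in> BK k"
  unfolding mem_BK mem_Bsp by (auto simp: single_def split: if_splits)

text \<open>Of \<open>v\<close> and \<open>star v\<close> at least one lies in \<open>Iso\<close> or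
  \<open>Rest\<close>, and its \<open>Der\<close> kills the monomial; so every term of
  \<open>Lap\<close> vanishes separately.\<close>

lemma single_HK:
  assumes "iso_mono \<mu>" "grade deg_coeff \<mu> = k"
  shows "single \<mu> \<in> HK k"
proof -
  have B: "single \<mu> \<in> BK k" using assms single_BK iso_mono_valid by blast
  have "Der (star v) (Der v (single \<mu>)) = 0" if "v \<in> Modes" for v
  proof (cases "v \<in> Iso \<union> Rest")
    case True
    then show ?thesis using Der_single_0[OF assms(1)] by simp
  next
    case False
    then have "star v \<in> Iso" using that by (auto simp: Rest_iff)
    then have "Der (star v) (single \<mu>) = 0" using Der_single_0[OF assms(1)] by simp
    then show ?thesis using Der_Der[OF BK_Bsp[OF B], of "star v" v] by simp
  qed
  then show ?thesis using B by (simp add: mem_HK Lap_def)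
qed

text \<open>Minimises the total exponent outside \<open>X 1\<close>. \<open>osp_op v (Y 1)\<close>
  trades a twisted variable for \<open>X 1\<close>, and \<open>osp_op (X 1) (Y mid)\<close> removes
  a factor \<open>X 1\<close> together with a factor \<open>X mid\<close>. When neither applies, a
  pure power of one variable remains, fixed by the degree.\<close>

lemma canonical_mono_mem:
  assumes U: "osp_sub U" "U \<subseteq> HK k" "U \<noteq> {0}"
  shows "single (canonical_mono k) \<in> U"
proof -
  have sub: "spoly.subspace U" and LU: "\<And>v w p. v \<in> Modes \<Longrightarrow> w \<in> Modes \<Longrightarrow> p \<in> U \<Longrightarrow> osp_op v w p \<in> U"
    using U(1) by (auto simp: osp_sub_def)
  have scaled: "q \<in> U" if "c \<odot> q \<in> U" "c \<noteq> 0" for c q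
    using spoly.subspace_scale[OF sub that(1), of "inverse c"] that(2) by simp
  let ?P = "\<lambda>\<mu>. iso_mono \<mu> \<and> single \<mu> \<in> U"
  let ?e = "\<lambda>\<mu>. \<Sum>v\<in>Iso - {X 1}. expo \<mu> v"
  have finW: "finite Iso" by (simp add: Iso_def)
  have X1: "X 1 \<in> Iso" "twisted (X 1)" "X 1 \<in> Modes" "Y 1 \<in> Modes" "Y 1 \<notin> Iso" "X 1 \<noteq> X mid"
    using n1_pos n1_n2 n2_n by auto
  obtain \<mu>1 where "?P \<mu>1" using lowest_monomial[OF U] by blast
  then obtain \<mu> where \<mu>: "iso_mono \<mu>" "single \<mu> \<in> U" and min: "\<And>\<nu>. ?P \<nu> \<Longrightarrow> ?e \<mu> \<le> ?e \<nu>"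
    using ex_has_least_nat[of ?P \<mu>1 ?e] by blast
  have deg: "grade deg_coeff \<mu> = k"
  proof -
    have "single \<mu> \<in> BK k" using \<mu>(2) U(2) HK_BK by blast
    then show ?thesis using BK_deg[of "single \<mu>" k \<mu>] by (simp add: single_def)
  qed
  have A: "expo \<mu> v = 0" if v: "v \<in> Iso" "v \<noteq> X 1" "v \<noteq> X mid" for v
  proof (rule ccontr)
    assume nz: "expo \<mu> v \<noteq> 0"
    have twisted: "twisted v" using v by (cases v) auto
    have nodd: "\<not> odd_mode v" using Iso_even v(1) by blast
    let ?\<nu> = "dec v (inc (X 1) \<mu>)"
    have "osp_op v (Y 1) (single \<mu>) = Mul v (Der (Y 1) (single \<mu>))"
      using Der_single_0[OF \<mu>(1), of v] v(1) by (simp add: osp_op_def)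
    also have "\<dots> = (- of_nat (expo \<mu> v)) \<odot> single ?\<nu>"
      using X1(2) twisted v(2) nodd by (simp add: Der_def Mul_def der_sign_def creat_single annih_single expo_inc)
    finally have "(- of_nat (expo \<mu> v)) \<odot> single ?\<nu> \<in> U"
      using LU[OF Iso_Modes[OF v(1)] X1(4) \<mu>(2)] by simp
    then have "single ?\<nu> \<in> U" using scaled nz by (metis neg_equal_0_iff_equal of_nat_eq_0_iff)
    moreover have "iso_mono ?\<nu>" using \<mu>(1) X1(1) v(1) by (auto simp: iso_mono_def expo_inc expo_dec)
    ultimately have "?e \<mu> \<le> ?e ?\<nu>" using min by blast
    moreover have "?e ?\<nu> < ?e \<mu>"
      by (rule sum_strict_mono_ex1) (use finW nz v in \<open>auto simp: expo_inc expo_dec\<close>)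
    ultimately show False by simp
  qed
  have B: "expo \<mu> (X 1) = 0 \<or> expo \<mu> (X mid) = 0"
  proof (rule ccontr)
    assume "\<not> ?thesis"
    then have nz: "expo \<mu> (X 1) \<noteq> 0" "expo \<mu> (X mid) \<noteq> 0" by auto
    let ?\<nu> = "dec (X 1) (dec (X mid) \<mu>)"
    let ?c = "of_nat (expo \<mu> (X mid)) * of_nat (expo \<mu> (X 1)) :: complex"
    have "osp_op (X 1) (Y mid) (single \<mu>) = Mul (X 1) (Der (Y mid) (single \<mu>))"
      using Der_single_0[OF \<mu>(1), of "X 1"] X1(1) by (simp add: osp_op_def)
    also have "\<dots> = ?c \<odot> single ?\<nu>"
      using X1(2,6) by (simp add: Der_def Mul_def der_sign_def annih_single expo_dec)
    finally have "?c \<odot> single ?\<nu> \<in> U"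
      using LU[OF X1(3) mid_simps(4) \<mu>(2)] by simp
    then have "single ?\<nu> \<in> U" using scaled[of ?c] nz by simp
    moreover have "iso_mono ?\<nu>" using \<mu>(1) by (auto simp: iso_mono_def expo_dec)
    ultimately have "?e \<mu> \<le> ?e ?\<nu>" using min by blast
    moreover have "?e ?\<nu> < ?e \<mu>"
      by (rule sum_strict_mono_ex1)
        (use finW nz X1 mid_simps(1) in \<open>auto simp: expo_dec intro!: bexI[of _ "X mid"]\<close>)
    ultimately show False by simp
  qed
  have Z: "expo \<mu> v = 0" if "v \<noteq> X 1" "v \<noteq> X mid" for v
    using A[OF _ that] \<mu>(1) by (auto simp: iso_mono_def)
  have "\<mu> = canonical_mono k"
  proof (rule mono_eqI)
    fix v
    show "expo \<mu> v = expo (canonical_mono k) v"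
      using Z[of v] B grade_canonical_mono[OF Z] deg X1(6) unfolding expo_canonical_mono by auto
  qed
  then show ?thesis using \<mu>(2) by simp
qed

section \<open>Irreducibility of the harmonics\<close>

lemma osp_sub_HK: "osp_sub (HK k)"
  using subspace_HK osp_op_HK HK_Bsp by (auto simp: osp_sub_def)

text \<open>A zero complement does not force equality in infinite dimension, so a proper
  \<open>U\<close> must produce a nonzero vector orthogonal to it. A functional vanishing on
  \<open>U\<close> but not on some harmonic weight vector \<open>g\<close> is represented by a
  polynomial of that weight, and the harmonic part \<open>h\<close> of this polynomial is the
  required vector.\<close>

lemma HK_irreducible:
  assumes U: "osp_sub U" "U \<subseteq> HK k" "U \<noteq> {0}"
  shows "U = HK k"
proof (rule ccontr)
  assume "U \<noteq> HK k"
  then obtain f where f: "f \<in> HK k" "f \<notin> U" using U(2) by blast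
  have sub: "spoly.subspace U" using U(1) by (simp add: osp_sub_def)
  define F where "F \<mu> = (\<lambda>i. if i \<in> {1..n} then weight i \<mu> else 0)" for \<mu>
  have F_eq: "F \<mu> = F \<nu> \<longleftrightarrow> (\<forall>i\<in>{1..n}. weight i \<mu> = weight i \<nu>)" for \<mu> \<nu>
    unfolding F_def fun_eq_iff by auto
  \<comment> \<open>If all weight components of \<open>f\<close> were in \<open>U\<close>, their
    finite sum \<open>f\<close> would be as well.\<close>
  have "\<exists>\<mu>1. restrict (\<lambda>\<mu>. F \<mu> = F \<mu>1) f \<notin> U"
  proof (rule ccontr)
    assume "\<not> ?thesis"
    then have "(\<Sum>c\<in>F ` {\<mu>. f \<mu> \<noteq> 0}. restrict (\<lambda>\<mu>. F \<mu> = c) f) \<in> U"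
      by (intro spoly.subspace_sum[OF sub]) auto
    then show False using sum_restrict[OF Bsp_finite[OF HK_Bsp[OF f(1)]], of F] f(2) by simp
  qed
  then obtain \<mu>1 where \<mu>1: "restrict (\<lambda>\<mu>. F \<mu> = F \<mu>1) f \<notin> U" by blast
  define P where "P p = restrict (\<lambda>\<mu>. \<forall>i\<in>{1..n}. weight i \<mu> = weight i \<mu>1) p" for p
  define g where "g = P f"
  have gU: "g \<notin> U" using \<mu>1 by (simp add: g_def P_def F_eq)
  have gH: "g \<in> HK k" unfolding g_def P_def by (rule restrict_weight_mem[OF osp_sub_HK f(1)])
  define S where "S = {\<mu>. valid \<mu> \<and> grade deg_coeff \<mu> = k \<and> (\<forall>i\<in>{1..n}. weight i \<mu> = weight i \<mu>1)}"
  have finS: "finite S" unfolding S_def by (rule finite_weight_space)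
  obtain \<phi> where \<phi>: "\<And>p q. \<phi> (p + q) = \<phi> p + \<phi> q" "\<And>c p. \<phi> (c \<odot> p) = c * \<phi> p"
    "\<And>u. u \<in> U \<Longrightarrow> \<phi> u = 0" "\<phi> g = 1"
    using separating_functional[OF sub gU] by metis
  \<comment> \<open>Distinct monomials are orthogonal, so dividing by \<open>form_coeff\<close>
    makes pairing with \<open>t\<close> reproduce \<phi> on the chosen weight space.\<close>
  define t where "t = (\<Sum>\<mu>\<in>S. (\<phi> (single \<mu>) / form_coeff \<mu>) \<odot> single \<mu>)"
  have t: "t \<in> BK k" unfolding t_def
    by (intro spoly.subspace_sum[OF subspace_BK] spoly.subspace_scale[OF subspace_BK] single_BK)
      (auto simp: S_def)
  have form_t: "form q t = \<phi> (P q)" if q: "q \<in> HK k" for q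
  proof -
    have "q \<in> Bsp n m" using q HK_Bsp by blast
    then have "form q t = (\<Sum>\<mu>\<in>S. q \<mu> * \<phi> (single \<mu>))"
      unfolding t_def form_sum_right
      by (intro sum.cong) (simp_all add: form_single form_coeff_nonzero)
    also have "\<dots> = \<phi> (\<Sum>\<mu>\<in>S. q \<mu> \<odot> single \<mu>)"
    proof -
      have "\<phi> 0 = 0" using \<phi>(1)[of 0 0] by simp
      then have "\<phi> (sum h T) = (\<Sum>x\<in>T. \<phi> (h x))" for h and T :: "mono set"
        using \<phi>(1) by (induction T rule: infinite_finite_induct) simp_all
      then show ?thesis by (simp add: \<phi>(2))
    qed
    also have "(\<Sum>\<mu>\<in>S. q \<mu> \<odot> single \<mu>) = P q"
    proof
      fix \<nu>
      have "(\<Sum>\<mu>\<in>S. q \<mu> \<odot> single \<mu>) \<nu> = (\<Sum>\<mu>\<in>S. if \<nu> = \<mu> then q \<mu> else 0)"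
        by (auto simp: sum_fun_apply pointwise single_def intro!: sum.cong)
      also have "\<dots> = (if \<nu> \<in> S then q \<nu> else 0)" using finS by simp
      also have "\<dots> = P q \<nu>"
        using BK_deg[OF HK_BK[OF q], of \<nu>] Bsp_valid[OF HK_Bsp[OF q], of \<nu>]
        by (auto simp: P_def restrict_def S_def)
      finally show "(\<Sum>\<mu>\<in>S. q \<mu> \<odot> single \<mu>) \<nu> = P q \<nu>" .
    qed
    finally show ?thesis .
  qed
  obtain h t' where h: "h \<in> HK k" "t' \<in> Bsp n m" "t = h + Eta t'"
    using BK_harmonic_part[OF t] by blast
  have form_h: "form h q = \<phi> (P q)" if q: "q \<in> HK k" for q
  proof -
    have qB: "q \<in> Bsp n m" using q HK_Bsp by blast
    have "form q (Eta t') = form (Eta t') q" using form_sym qB h(2) by simp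
    also have "\<dots> = 0" using form_Lap[OF h(2) qB] q by (simp add: mem_HK)
    finally have "form q t = form q h" using h(3) by simp
    then show ?thesis using form_t[OF q] form_sym[OF qB HK_Bsp[OF h(1)]] by simp
  qed
  define U' where "U' = {p \<in> HK k. \<forall>u\<in>U. form p u = 0}"
  have UB: "u \<in> Bsp n m" if "u \<in> U" for u using that U(2) HK_Bsp by blast
  have "spoly.subspace U'"
  proof (rule spoly.subspaceI)
    have "form 0 u = 0" for u by (simp add: form_def pointwise)
    then show "0 \<in> U'" using spoly.subspace_0[OF subspace_HK] by (simp add: U'_def)
  next
    fix p q assume "p \<in> U'" "q \<in> U'"
    then show "p + q \<in> U'"
      using spoly.subspace_add[OF subspace_HK] form_add_left HK_Bsp UB by (auto simp: U'_def)
  next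
    fix c p assume "p \<in> U'"
    then show "c \<odot> p \<in> U'"
      using spoly.subspace_scale[OF subspace_HK] form_scale_left HK_Bsp UB by (auto simp: U'_def)
  qed
  moreover have "osp_op v w p \<in> U'" if "v \<in> Modes" "w \<in> Modes" "p \<in> U'" for v w p
  proof -
    have "osp_op (star w) (star v) u \<in> U" if "u \<in> U" for u
      using U(1) that \<open>v \<in> Modes\<close> \<open>w \<in> Modes\<close> by (auto simp: osp_sub_def)
    then show ?thesis
      using that osp_op_HK form_osp_op HK_Bsp UB by (auto simp: U'_def)
  qed
  ultimately have U': "osp_sub U'" "U' \<subseteq> HK k"
    using HK_Bsp by (auto simp: osp_sub_def U'_def)
  have "U' = {0}"
  proof (rule ccontr)
    assume "U' \<noteq> {0}"
    then have "single (canonical_mono k) \<in> U'" by (rule canonical_mono_mem[OF U'])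
    moreover have "single (canonical_mono k) \<in> U" by (rule canonical_mono_mem[OF U])
    ultimately have "form (single (canonical_mono k)) (single (canonical_mono k)) = 0" by (simp add: U'_def)
    moreover have "single (canonical_mono k) \<in> Bsp n m" using \<open>single (canonical_mono k) \<in> U\<close> by (rule UB)
    moreover have "single (canonical_mono k) (canonical_mono k) = 1" by (simp add: single_def)
    ultimately show False using form_coeff_nonzero by (simp add: form_single)
  qed
  moreover have "h \<in> U'"
  proof -
    \<comment> \<open>Submodules are stable under weight projections, so \<phi> kills
      \<open>P u\<close> also when \<open>u\<close> mixes several weights.\<close>
    have "P u \<in> U" if "u \<in> U" for u unfolding P_def by (rule restrict_weight_mem[OF U(1) that])
    then have "form h u = 0" if "u \<in> U" for u using form_h[of u] that U(2) \<phi>(3) by auto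
    then show ?thesis using h(1) by (simp add: U'_def)
  qed
  ultimately have "h = 0" by simp
  then have "form h g = 0" by (simp add: form_def pointwise)
  moreover have "P g = g" by (auto simp: g_def P_def restrict_def)
  ultimately show False using form_h[OF gH] \<phi>(4) by simp
qed

lemma eta'_pow: "h \<in> Bsp n m \<Longrightarrow> (eta' n m n1 n2 ^^ l) h = (Eta ^^ l) h \<and> (Eta ^^ l) h \<in> Bsp n m"
  by (induction l) (simp_all add: eta'_eq_Eta)

lemma eta'_pow_HK: "(eta' n m n1 n2 ^^ l) ` HK k = (Eta ^^ l) ` HK k"
  using eta'_pow HK_Bsp by (intro image_cong) auto

lemma irreducibleI:
  assumes W: "osp_sub W" "W \<noteq> {0}"
    and min: "\<And>U. osp_sub U \<Longrightarrow> U \<subseteq> W \<Longrightarrow> U \<noteq> {0} \<Longrightarrow> U = W"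
  shows "irreducible_submodule (ospOps n m n1 n2) (Bsp n m) W"
proof -
  have sub: "spoly.subspace W" "W \<subseteq> Bsp n m" using W(1) by (auto simp: osp_sub_def)
  have "U = {0} \<or> U = W" if U: "spoly.subspace U" "U \<subseteq> W" "op_invariant (ospOps n m n1 n2) U" for U
  proof -
    have "osp_sub U" using U sub(2) op_invariant_iff[OF U(1)] by (auto simp: osp_sub_def)
    then show ?thesis using min U(2) by blast
  qed
  moreover have "op_invariant (ospOps n m n1 n2) W"
    using W(1) op_invariant_iff[OF sub(1)] by (auto simp: osp_sub_def)
  ultimately show ?thesis
    using sub W(2) by (simp add: irreducible_submodule_def csubspace_iff)
qed

lemma HK_nonzero: "single (canonical_mono k) \<in> HK k" "single (canonical_mono k) \<noteq> 0"
proof -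
  show "single (canonical_mono k) \<in> HK k" by (rule single_HK[OF iso_mono_canonical_mono grade_deg_coeff_canonical_mono])
  have "single (canonical_mono k) (canonical_mono k) \<noteq> 0" by (simp add: single_def)
  then show "single (canonical_mono k) \<noteq> 0" by (auto simp: pointwise)
qed

lemma Eta_pow_inj:
  assumes "h \<in> HK k" "(Eta ^^ l) h = 0"
  shows "h = 0"
proof -
  obtain c where "c \<noteq> 0" "(Lap ^^ l) ((Eta ^^ l) h) = c \<odot> h"
    using Lap_pow_Eta_pow[OF assms(1)] by blast
  then show ?thesis using assms(2) module_hom.zero[OF Lap_pow_linear] by simp
qed

lemma Eta_pow_osp_op:
  "h \<in> Bsp n m \<Longrightarrow> v \<in> Modes \<Longrightarrow> w \<in> Modes \<Longrightarrow> (Eta ^^ l) (osp_op v w h) = osp_op v w ((Eta ^^ l) h)"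
  using eta'_pow[of h] by (induction l) (simp_all add: Eta_osp_op)

lemma osp_sub_layer: "osp_sub ((Eta ^^ l) ` HK k)"
  unfolding osp_sub_def
proof (intro conjI ballI)
  show "spoly.subspace ((Eta ^^ l) ` HK k)"
    by (rule module_hom.subspace_image[OF Eta_pow_linear subspace_HK])
  show "(Eta ^^ l) ` HK k \<subseteq> Bsp n m"
    using eta'_pow HK_Bsp by blast
next
  fix v w p assume vw: "v \<in> Modes" "w \<in> Modes" and "p \<in> (Eta ^^ l) ` HK k"
  then obtain h where h: "h \<in> HK k" "p = (Eta ^^ l) h" by blast
  then have "osp_op v w p = (Eta ^^ l) (osp_op v w h)" using Eta_pow_osp_op[OF HK_Bsp[OF h(1)] vw] by simp
  then show "osp_op v w p \<in> (Eta ^^ l) ` HK k" using osp_op_HK[OF h(1) vw] by blast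
qed

text \<open>A power of \<open>Eta\<close> is an injective intertwiner on harmonics, so a submodule
  of the image is pulled back to a submodule of \<open>HK k\<close>.\<close>

lemma layer_irreducible:
  "irreducible_submodule (ospOps n m n1 n2) (Bsp n m) ((Eta ^^ l) ` HK k)"
proof (rule irreducibleI[OF osp_sub_layer])
  have "(Eta ^^ l) (single (canonical_mono k)) \<noteq> 0" using Eta_pow_inj HK_nonzero by blast
  then show "(Eta ^^ l) ` HK k \<noteq> {0}" using HK_nonzero(1) by blast
next
  fix U assume U: "osp_sub U" "U \<subseteq> (Eta ^^ l) ` HK k" "U \<noteq> {0}"
  define U0 where "U0 = {h \<in> HK k. (Eta ^^ l) h \<in> U}"
  have sub: "spoly.subspace U" using U(1) by (simp add: osp_sub_def)
  interpret E: module_hom psmult psmult "Eta ^^ l" by (rule Eta_pow_linear)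
  have "spoly.subspace U0"
    using sub subspace_HK[of k]
    by (auto simp: U0_def spoly.subspace_def E.add E.scale E.zero)
  moreover have "osp_op v w h \<in> U0" if "v \<in> Modes" "w \<in> Modes" "h \<in> U0" for v w h
    using that U(1) Eta_pow_osp_op[of h v w l] HK_Bsp osp_op_HK by (auto simp: U0_def osp_sub_def)
  ultimately have "osp_sub U0" using HK_Bsp by (auto simp: osp_sub_def U0_def)
  moreover have img: "U = (Eta ^^ l) ` U0" using U(2) by (auto simp: U0_def)
  moreover have "U0 \<noteq> {0}" using img U(3) E.zero by auto
  moreover have "U0 \<subseteq> HK k" by (auto simp: U0_def)
  ultimately have "U0 = HK k" using HK_irreducible by blast
  then show "U = (Eta ^^ l) ` HK k" using img by simp
qed

section \<open>The direct sum decomposition\<close>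

definition decomposition :: "spoly \<Rightarrow> (nat \<times> int \<Rightarrow> spoly) \<Rightarrow> bool" where
  "decomposition f g \<longleftrightarrow> finite {lk. g lk \<noteq> 0} \<and> (\<forall>l k. g (l, k) \<in> (Eta ^^ l) ` HK k)
    \<and> f = (\<Sum>lk | g lk \<noteq> 0. g lk)"

lemma layer_subspace: "spoly.subspace ((Eta ^^ l) ` HK k)"
  using osp_sub_layer by (simp add: osp_sub_def)

lemma decomposition_superset:
  assumes "decomposition f g" "finite S" "{lk. g lk \<noteq> 0} \<subseteq> S"
  shows "f = (\<Sum>lk\<in>S. g lk)"
proof -
  have "(\<Sum>lk | g lk \<noteq> 0. g lk) = (\<Sum>lk\<in>S. g lk)"
    by (rule sum.mono_neutral_left) (use assms in auto)
  then show ?thesis using assms(1) by (simp add: decomposition_def)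
qed

text \<open>The factor \<open>c\<close> lets one statement serve sums (1), multiples, and
  differences (-1), the last of which reduce uniqueness to decompositions of 0.\<close>

lemma decomposition_linear:
  assumes "decomposition f g" "decomposition f' g'"
  shows "decomposition (f + c \<odot> f') (\<lambda>lk. g lk + c \<odot> g' lk)"
proof -
  let ?h = "\<lambda>lk. g lk + c \<odot> g' lk"
  let ?S = "{lk. g lk \<noteq> 0} \<union> {lk. g' lk \<noteq> 0}"
  have fin: "finite ?S" using assms by (simp add: decomposition_def)
  have sub: "{lk. ?h lk \<noteq> 0} \<subseteq> ?S" by auto
  have "f + c \<odot> f' = (\<Sum>lk\<in>?S. ?h lk)"
    using decomposition_superset[OF assms(1) fin] decomposition_superset[OF assms(2) fin]
    by (simp add: sum.distrib spoly.scale_sum_right)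
  also have "\<dots> = (\<Sum>lk | ?h lk \<noteq> 0. ?h lk)"
    by (rule sum.mono_neutral_right) (use fin sub in auto)
  finally show ?thesis
    using assms finite_subset[OF sub fin] spoly.subspace_add[OF layer_subspace]
      spoly.subspace_scale[OF layer_subspace]
    unfolding decomposition_def by simp
qed

lemma decomposition_zero: "decomposition 0 (\<lambda>_. 0)"
  using spoly.subspace_0[OF layer_subspace] by (simp add: decomposition_def)

lemma decomposition_layer:
  assumes "f \<in> (Eta ^^ l) ` HK k"
  shows "decomposition f (\<lambda>lk. if lk = (l, k) then f else 0)"
proof (cases "f = 0")
  case True
  then show ?thesis using decomposition_zero by (simp add: if_distrib cong: if_cong)
next
  case False
  then have "{lk. (if lk = (l, k) then f else 0) \<noteq> 0} = {(l, k)}" by auto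
  then show ?thesis
    using assms spoly.subspace_0[OF layer_subspace] by (simp add: decomposition_def)
qed

lemma subspace_decomposable: "spoly.subspace {f. \<exists>g. decomposition f g}"
proof (rule spoly.subspaceI; simp only: mem_Collect_eq)
  show "\<exists>g. decomposition 0 g" using decomposition_zero by blast
next
  fix x y assume "\<exists>g. decomposition x g" "\<exists>g. decomposition y g"
  then obtain g g' where "decomposition x g" "decomposition y g'" by blast
  from decomposition_linear[OF this, of 1] show "\<exists>g. decomposition (x + y) g" by auto
next
  fix c x assume "\<exists>g. decomposition x g"
  then obtain g where "decomposition x g" by blast
  from decomposition_linear[OF decomposition_zero this, of c] show "\<exists>g. decomposition (c \<odot> x) g" by auto
qed

lemma decomposition_exists:
  assumes "f \<in> Bsp n m"
  shows "\<exists>g. decomposition f g"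
proof -
  let ?S = "{f. \<exists>g. decomposition f g}"
  have "layers k \<subseteq> ?S" for k
    unfolding layers_def
    by (rule spoly.span_minimal[OF _ subspace_decomposable]) (use decomposition_layer in blast)
  moreover have "restrict (\<lambda>\<mu>. grade deg_coeff \<mu> = k) f \<in> BK k" for k
  proof -
    have "restrict (\<lambda>\<mu>. grade deg_coeff \<mu> = k) f \<in> Bsp n m"
      using assms unfolding mem_Bsp
      by (auto simp: restrict_def elim!: finite_subset[rotated] split: if_splits)
    then show ?thesis unfolding mem_BK by (auto simp: restrict_def)
  qed
  ultimately have "restrict (\<lambda>\<mu>. grade deg_coeff \<mu> = k) f \<in> ?S" for k using BK_layers by blast
  then have "(\<Sum>k\<in>grade deg_coeff ` {\<mu>. f \<mu> \<noteq> 0}. restrict (\<lambda>\<mu>. grade deg_coeff \<mu> = k) f) \<in> ?S"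
    by (intro spoly.subspace_sum[OF subspace_decomposable])
  then show ?thesis using sum_restrict[OF Bsp_finite[OF assms], of "grade deg_coeff"] by simp
qed

text \<open>If \<open>L\<close> is the highest power of \<open>Eta\<close> that occurs,
  \<open>Lap ^^ L\<close> annihilates all lower layers and turns each top component into a nonzero
  multiple of its harmonic; harmonics of different degrees have disjoint supports.\<close>

lemma decomposition_of_zero:
  assumes "decomposition 0 d"
  shows "d lk = 0"
proof (rule ccontr)
  let ?T = "{lk. d lk \<noteq> 0}"
  assume "d lk \<noteq> 0"
  have fin: "finite ?T" and dE: "d (l, k) \<in> (Eta ^^ l) ` HK k" for l k
    using assms by (auto simp: decomposition_def)
  define L where "L = Max (fst ` ?T)"
  have "L \<in> fst ` ?T" unfolding L_def using fin \<open>d lk \<noteq> 0\<close> by (intro Max_in) auto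
  then obtain K where LK: "d (L, K) \<noteq> 0" by auto
  have le: "l \<le> L" if "d (l, k) \<noteq> 0" for l k
    unfolding L_def using fin that by (intro Max_ge) force+
  interpret P: module_hom psmult psmult "Lap ^^ L" by (rule Lap_pow_linear)
  define e where "e lk = (Lap ^^ L) (d lk)" for lk
  have e_top: "\<exists>h\<in>HK k. \<exists>c. c \<noteq> 0 \<and> d (L, k) = (Eta ^^ L) h \<and> e (L, k) = c \<odot> h" for k
  proof -
    obtain h where h: "h \<in> HK k" "d (L, k) = (Eta ^^ L) h" using dE[of L k] by blast
    then show ?thesis using Lap_pow_Eta_pow[OF h(1), of L] by (auto simp: e_def)
  qed
  have e_less: "e (l, k) = 0" if "l \<noteq> L" "d (l, k) \<noteq> 0" for l k
  proof -
    obtain h where "h \<in> HK k" "d (l, k) = (Eta ^^ l) h" using dE by blast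
    moreover have "l < L" using le[OF that(2)] that(1) by simp
    ultimately show ?thesis using Lap_pow_Eta_pow_less by (simp add: e_def)
  qed
  have "e (L, K) \<noteq> 0"
  proof
    assume "e (L, K) = 0"
    then obtain h where "h = 0" "d (L, K) = (Eta ^^ L) h" using e_top[of K] by auto
    then show False using LK module_hom.zero[OF Eta_pow_linear] by simp
  qed
  then obtain \<mu> where \<mu>: "e (L, K) \<mu> \<noteq> 0" by (auto simp: fun_eq_iff pointwise)
  have eB: "e (L, k) \<in> BK k" for k
    using e_top[of k] HK_BK spoly.subspace_scale[OF subspace_BK] by auto
  have other: "e x \<mu> = 0" if "x \<in> ?T - {(L, K)}" for x
  proof (cases x)
    case (Pair l k)
    show ?thesis
    proof (cases "l = L")
      case True
      then have "k \<noteq> K" using that Pair by auto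
      then show ?thesis using BK_deg[OF eB \<mu>] BK_deg[OF eB[of k], of \<mu>] True Pair by auto
    next
      case False
      then show ?thesis using e_less[OF False] that Pair by (simp add: pointwise)
    qed
  qed
  have "0 = (\<Sum>x\<in>?T. e x)"
    using assms unfolding e_def P.sum[symmetric] decomposition_def by (metis P.zero)
  then have "0 = (\<Sum>x\<in>?T. e x) \<mu>" by (simp add: pointwise)
  also have "\<dots> = (\<Sum>x\<in>?T. e x \<mu>)" by (rule sum_fun_apply)
  also have "\<dots> = e (L, K) \<mu>"
    using fin LK other by (simp add: sum.remove[of ?T "(L, K)"])
  finally show False using \<mu> by simp
qed

lemma decomposition_unique:
  assumes "decomposition f g" "decomposition f g'"
  shows "g = g'"
proof
  fix lk
  have "decomposition 0 (\<lambda>lk. g lk + (-1) \<odot> g' lk)"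
    using decomposition_linear[OF assms, of "-1"] by simp
  from decomposition_of_zero[OF this, of lk] show "g lk = g' lk" by simp
qed

lemma decomposition_iff:
  "finite {lk. g lk \<noteq> pzero} \<and> (\<forall>l k. g (l, k) \<in> (eta' n m n1 n2 ^^ l) ` HK k)
    \<and> f = (\<lambda>\<mu>. \<Sum>lk\<in>{lk. g lk \<noteq> pzero}. g lk \<mu>) \<longleftrightarrow> decomposition f g"
  by (auto simp: decomposition_def eta'_pow_HK fun_eq_iff sum_fun_apply)

end

theorem theorem5p2:
  fixes n m n1 n2 :: nat
  assumes "1 \<le> n" and "1 \<le> m" and "1 \<le> n1" and "n1 + 1 < n2" and "n2 \<le> n"
  shows "(\<forall>k::int. irreducible_submodule (ospOps n m n1 n2) (Bsp n m) (Hk n m n1 n2 k))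
    \<and> (\<forall>(l::nat) (k::int). irreducible_submodule (ospOps n m n1 n2) (Bsp n m)
            ((eta' n m n1 n2 ^^ l) ` Hk n m n1 n2 k))
    \<and> (\<forall>f\<in>Bsp n m. \<exists>!g :: nat \<times> int \<Rightarrow> spoly.
          finite {lk. g lk \<noteq> pzero}
        \<and> (\<forall>l k. g (l, k) \<in> (eta' n m n1 n2 ^^ l) ` Hk n m n1 n2 k)
        \<and> f = (\<lambda>\<mu>. \<Sum>lk\<in>{lk. g lk \<noteq> pzero}. g lk \<mu>))"
proof -
  interpret oscillator n m n1 n2
    by unfold_locales (use assms in auto)
  show ?thesis
    unfolding decomposition_iff
  proof (intro conjI allI ballI)
    show "irreducible_submodule (ospOps n m n1 n2) (Bsp n m) (HK k)" for k
      using layer_irreducible[of 0 k] by simp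
    show "irreducible_submodule (ospOps n m n1 n2) (Bsp n m) ((eta' n m n1 n2 ^^ l) ` HK k)" for l k
      using layer_irreducible[of l k] by (simp add: eta'_pow_HK)
    show "\<exists>!g. decomposition f g" if "f \<in> Bsp n m" for f
      using decomposition_exists[OF that] decomposition_unique by blast
  qed
qed

end
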